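(* Let $A$ be a C$^*$-algebra, let $X$ be an essential Banach $^*$-$A$-bimodule, and let $T:A\to X$ be a bounded linear operator. Then the following statements are equivalent: (a) $T$ is r-$^*$-anti-derivable at zero, i.e. for all $a,b\in A$, $ab^*=0$ in $A$ implies $T(b)^*a+b^*T(a)=0$ in $X$; (b) There exist a $^*$-derivation $d:A\to X^{**}$ and an element $\xi\in X^{**}$ satisfying the following properties: (i) $d([a,b])+[a,b]\xi+\xi^*[a,b]=0$ for all $a,b\in A$; (ii) $T(ab)=aT(b)+T(a)b-a\xi b$ and $T(a)=d(a)+a\xi$ for all $a,b\in A$. If we further assume that $A$ is unital or that $X$ is a dual Banach $A$-bimodule, then (b) can be replaced with the following: (b$'$) There exist a $^*$-derivation $d:A\to X$ and an element $\xi\in X$ satisfying properties (i) and (ii) above.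
   Context: All algebras and Banach spaces are complex; $A$ need not be unital. A Banach $A$-bimodule $X$ is essential if the linear span of $\{axb: a,b\in A,\ x\in X\}$ is dense in $X$. An $A$-bimodule involution on $X$ is a continuous conjugate-linear map $x\mapsto x^*$ on $X$ with $(x^* )^*=x$, $(ax)^*=x^*a^*$ and $(xa)^*=a^*x^*$ for all $a\in A$, $x\in X$; a Banach $^*$-$A$-bimodule is a Banach $A$-bimodule equipped with an $A$-bimodule involution. The bidual $X^{**}$ is regarded as a Banach $A$-bimodule whose operations $z\mapsto az$ and $z\mapsto za$ ($a\in A$, $z\in X^{**}$) are the second adjoints of the maps $x\mapsto ax$ and $x\mapsto xa$ on $X$; $X$ is identified with its canonical image in $X^{**}$. The involution on $X^{**}$ is given by $\phi^*(x)=\overline{\phi(x^* )}$ for $\phi\in X^*$, $x\in X$, and $z^*(\phi)=\overline{z(\phi^* )}$ for $z\in X^{**}$, $\phi\in X^*$. A derivation $d:A\to Y$ into an $A$-bimodule $Y$ is a linear map with $d(ab)=d(a)b+a\,d(b)$ for all $a,b\in A$; it is a $^*$-derivation (when $Y$ carries an involution) if moreover $d(a^* )=d(a)^*$ for all $a\in A$. A dual Banach $A$-bimodule is one of the form $Y^*$ for a Banach $A$-bimodule $Y$, with operations $(a\phi)(y)=\phi(ya)$, $(\phi a)(y)=\phi(ay)$. The commutator is $[a,b]=ab-ba$. *)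

theory Defs
  imports "HOL-Analysis.Analysis"
begin

section \<open>Complex Banach spaces and C*-algebras\<close>

class complex_normed_vector = real_normed_vector +
  fixes scaleC :: "complex \<Rightarrow> 'a \<Rightarrow> 'a"  (infixr \<open>*\<^sub>C\<close> 75)
  assumes scaleC_add_right: "c *\<^sub>C (x + y) = c *\<^sub>C x + c *\<^sub>C y"
    and scaleC_add_left: "(b + c) *\<^sub>C x = b *\<^sub>C x + c *\<^sub>C x"
    and scaleC_scaleC: "b *\<^sub>C (c *\<^sub>C x) = (b * c) *\<^sub>C x"
    and scaleR_scaleC: "scaleR t x = complex_of_real t *\<^sub>C x"
    and norm_scaleC: "norm (c *\<^sub>C x) = cmod c * norm x"

class complex_banach = complex_normed_vector + banach

lemma scaleC_one [simp]: "1 *\<^sub>C (x :: 'a::complex_normed_vector) = x"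
  using scaleR_scaleC[of 1 x] by simp

lemma vector_space_scaleC: "vector_space (scaleC :: complex \<Rightarrow> 'a \<Rightarrow> 'a::complex_normed_vector)"
  by unfold_locales
    (simp_all add: scaleC_add_right scaleC_add_left scaleC_scaleC)

abbreviation cspan :: "'a::complex_normed_vector set \<Rightarrow> 'a set"
  where "cspan \<equiv> module.span scaleC"

abbreviation clinear :: "('a::complex_normed_vector \<Rightarrow> 'b::complex_normed_vector) \<Rightarrow> bool"
  where "clinear \<equiv> Vector_Spaces.linear scaleC scaleC"

definition bounded_clinear :: "('a::complex_normed_vector \<Rightarrow> 'b::complex_normed_vector) \<Rightarrow> bool"
  where "bounded_clinear f \<longleftrightarrow> clinear f \<and> bounded_linear f"

lemma clinear_iff:
  "clinear f \<longleftrightarrow> (\<forall>x y. f (x + y) = f x + f y) \<and> (\<forall>c x. f (c *\<^sub>C x) = c *\<^sub>C f x)"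
  by (auto simp: Vector_Spaces.linear_iff vector_space_scaleC)

lemma bounded_clinear_iff:
  "bounded_clinear f \<longleftrightarrow> bounded_linear f \<and> (\<forall>c x. f (c *\<^sub>C x) = c *\<^sub>C f x)"
  by (auto simp: bounded_clinear_def clinear_iff dest: bounded_linear.linear linear_add)

instantiation complex :: complex_banach
begin
definition scaleC_complex :: "complex \<Rightarrow> complex \<Rightarrow> complex"
  where "scaleC_complex = (*)"
instance
  by standard (auto simp: scaleC_complex_def algebra_simps norm_mult scaleR_conv_of_real)
end

text \<open>No unit is assumed; submultiplicativity of the norm and bilinearity of the product over the
  reals come from \<^class>\<open>real_normed_algebra\<close>.\<close>

class complex_banach_algebra = complex_banach + real_normed_algebra +
  assumes mult_scaleC_left: "(c *\<^sub>C a) * b = c *\<^sub>C (a * b)"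
    and mult_scaleC_right: "a * (c *\<^sub>C b) = c *\<^sub>C (a * b)"

class cstar_algebra = complex_banach_algebra +
  fixes star :: "'a \<Rightarrow> 'a"
  assumes star_star: "star (star a) = a"
    and star_add: "star (a + b) = star a + star b"
    and star_scaleC: "star (c *\<^sub>C a) = cnj c *\<^sub>C star a"
    and star_mult: "star (a * b) = star b * star a"
    and cstar_identity: "norm (star a * a) = (norm a)\<^sup>2"

definition commutator :: "'a::ring \<Rightarrow> 'a \<Rightarrow> 'a"
  where "commutator a b = a * b - b * a"

definition unital_algebra :: "'a::ring itself \<Rightarrow> bool"
  where "unital_algebra _ \<longleftrightarrow> (\<exists>e::'a. \<forall>a. e * a = a \<and> a * e = a)"


section \<open>The dual space\<close>

text \<open>Continuous complex-linear functionals; the norm is the operator norm of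
  \<^typ>\<open>'x \<Rightarrow>\<^sub>L complex\<close>, and scalars act by $(c\phi)(x) = c\,\phi(x)$.\<close>

typedef (overloaded) 'x cdual =
  "{f :: 'x::complex_normed_vector \<Rightarrow>\<^sub>L complex. \<forall>c x. blinfun_apply f (c *\<^sub>C x) = c * blinfun_apply f x}"
  morphisms blinfun_of_cdual Abs_cdual
  by (rule exI[of _ 0]) simp

setup_lifting type_definition_cdual

lift_definition cdual_apply :: "'x::complex_normed_vector cdual \<Rightarrow> 'x \<Rightarrow> complex"
  is blinfun_apply .

lift_definition scaleC_blinfun :: "complex \<Rightarrow> ('x::complex_normed_vector \<Rightarrow>\<^sub>L complex) \<Rightarrow> ('x \<Rightarrow>\<^sub>L complex)"
  is "\<lambda>c f x. c * f x"
  by (rule bounded_linear_const_mult)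

lemma norm_scaleC_blinfun: "norm (scaleC_blinfun c f) = cmod c * norm f"
proof (cases "c = 0")
  case True
  then have "scaleC_blinfun c f = 0"
    by (intro blinfun_eqI) (simp add: scaleC_blinfun.rep_eq)
  with True show ?thesis by simp
next
  have le: "norm (scaleC_blinfun b g) \<le> cmod b * norm g" for b and g :: "'a \<Rightarrow>\<^sub>L complex"
  proof (rule norm_blinfun_bound)
    fix x
    have "cmod b * cmod (blinfun_apply g x) \<le> cmod b * (norm g * norm x)"
      by (intro mult_left_mono norm_blinfun) simp
    then show "norm (blinfun_apply (scaleC_blinfun b g) x) \<le> cmod b * norm g * norm x"
      by (simp add: scaleC_blinfun.rep_eq norm_mult mult.assoc)
  qed simp
  case False
  have "scaleC_blinfun (inverse c) (scaleC_blinfun c f) = f"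
    using False by (intro blinfun_eqI) (simp add: scaleC_blinfun.rep_eq)
  then have "norm f \<le> cmod (inverse c) * norm (scaleC_blinfun c f)"
    using le[of "inverse c" "scaleC_blinfun c f"] by simp
  then have "cmod c * norm f \<le> norm (scaleC_blinfun c f)"
    using False by (simp add: norm_inverse norm_divide field_simps)
  with le[of c f] show ?thesis by linarith
qed

instantiation cdual :: (complex_normed_vector) complex_normed_vector
begin

lift_definition zero_cdual :: "'a cdual" is 0 by simp
lift_definition plus_cdual :: "'a cdual \<Rightarrow> 'a cdual \<Rightarrow> 'a cdual" is "(+)"
  by (simp add: blinfun.add_left algebra_simps)
lift_definition minus_cdual :: "'a cdual \<Rightarrow> 'a cdual \<Rightarrow> 'a cdual" is "(-)"
  by (simp add: blinfun.diff_left algebra_simps)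
lift_definition uminus_cdual :: "'a cdual \<Rightarrow> 'a cdual" is uminus
  by (simp add: blinfun.minus_left)
lift_definition scaleR_cdual :: "real \<Rightarrow> 'a cdual \<Rightarrow> 'a cdual" is scaleR
  by (simp add: blinfun.scaleR_left)
lift_definition scaleC_cdual :: "complex \<Rightarrow> 'a cdual \<Rightarrow> 'a cdual" is scaleC_blinfun
  by (simp add: scaleC_blinfun.rep_eq)
lift_definition norm_cdual :: "'a cdual \<Rightarrow> real" is norm .
definition dist_cdual :: "'a cdual \<Rightarrow> 'a cdual \<Rightarrow> real"
  where "dist_cdual f g = norm (f - g)"
definition sgn_cdual :: "'a cdual \<Rightarrow> 'a cdual"
  where "sgn_cdual f = scaleR (inverse (norm f)) f"
definition uniformity_cdual :: "('a cdual \<times> 'a cdual) filter"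
  where "uniformity_cdual = (INF e\<in>{0 <..}. principal {(f, g). dist f g < e})"
definition open_cdual :: "'a cdual set \<Rightarrow> bool"
  where "open_cdual U \<longleftrightarrow> (\<forall>f\<in>U. eventually (\<lambda>(f', g). f' = f \<longrightarrow> g \<in> U) uniformity)"

instance
proof
  fix f g h :: "'a cdual" and s t :: real and b c :: complex
  show "f + g + h = f + (g + h)" by transfer (simp add: add.assoc)
  show "f + g = g + f" by transfer (simp add: add.commute)
  show "0 + f = f" by transfer simp
  show "- f + f = 0" by transfer simp
  show "f - g = f + - g" by transfer simp
  show "s *\<^sub>R (f + g) = s *\<^sub>R f + s *\<^sub>R g" by transfer (simp add: scaleR_add_right)
  show "(s + t) *\<^sub>R f = s *\<^sub>R f + t *\<^sub>R f" by transfer (simp add: scaleR_add_left)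
  show "s *\<^sub>R t *\<^sub>R f = (s * t) *\<^sub>R f" by transfer simp
  show "1 *\<^sub>R f = f" by transfer simp
  show "dist f g = norm (f - g)" by (rule dist_cdual_def)
  show "sgn f = scaleR (inverse (norm f)) f" by (rule sgn_cdual_def)
  show "(uniformity :: ('a cdual \<times> 'a cdual) filter) =
      (INF e\<in>{0 <..}. principal {(f, g). dist f g < e})"
    by (rule uniformity_cdual_def)
  show "open U \<longleftrightarrow> (\<forall>f\<in>U. \<forall>\<^sub>F (f', g) in uniformity. f' = f \<longrightarrow> g \<in> U)" for U :: "'a cdual set"
    by (rule open_cdual_def)
  show "norm f = 0 \<longleftrightarrow> f = 0" by transfer simp
  show "norm (f + g) \<le> norm f + norm g" by transfer (rule norm_triangle_ineq)
  show "norm (s *\<^sub>R f) = \<bar>s\<bar> * norm f" by transfer simp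
  show "c *\<^sub>C (f + g) = c *\<^sub>C f + c *\<^sub>C g"
    by transfer (intro blinfun_eqI, simp add: scaleC_blinfun.rep_eq blinfun.add_left algebra_simps)
  show "(b + c) *\<^sub>C f = b *\<^sub>C f + c *\<^sub>C f"
    by transfer (intro blinfun_eqI, simp add: scaleC_blinfun.rep_eq blinfun.add_left algebra_simps)
  show "b *\<^sub>C (c *\<^sub>C f) = (b * c) *\<^sub>C f"
    by transfer (intro blinfun_eqI, simp add: scaleC_blinfun.rep_eq)
  show "s *\<^sub>R f = complex_of_real s *\<^sub>C f"
    by transfer (intro blinfun_eqI,
        simp add: scaleC_blinfun.rep_eq blinfun.scaleR_left scaleR_conv_of_real)
  show "norm (c *\<^sub>C f) = cmod c * norm f" by transfer (rule norm_scaleC_blinfun)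
qed

end

instance cdual :: (complex_normed_vector) complex_banach
proof
  fix F :: "nat \<Rightarrow> 'a cdual"
  assume "Cauchy F"
  then have "Cauchy (\<lambda>n. blinfun_of_cdual (F n))"
    by (simp add: Cauchy_def dist_norm norm_cdual.rep_eq minus_cdual.rep_eq)
  then obtain g where g: "(\<lambda>n. blinfun_of_cdual (F n)) \<longlonglongrightarrow> g"
    using convergent_def Cauchy_convergent by blast
  have lim: "(\<lambda>n. blinfun_apply (blinfun_of_cdual (F n)) x) \<longlonglongrightarrow> blinfun_apply g x" for x
    by (intro tendsto_intros g)
  have "blinfun_apply g (c *\<^sub>C x) = c * blinfun_apply g x" for c x
  proof (rule LIMSEQ_unique)
    show "(\<lambda>n. blinfun_apply (blinfun_of_cdual (F n)) (c *\<^sub>C x)) \<longlonglongrightarrow> blinfun_apply g (c *\<^sub>C x)"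
      by (rule lim)
    have "(\<lambda>n. c * blinfun_apply (blinfun_of_cdual (F n)) x) \<longlonglongrightarrow> c * blinfun_apply g x"
      by (intro tendsto_mult tendsto_const lim)
    then show "(\<lambda>n. blinfun_apply (blinfun_of_cdual (F n)) (c *\<^sub>C x)) \<longlonglongrightarrow> c * blinfun_apply g x"
      using blinfun_of_cdual[of "F _"] by auto
  qed
  then have "blinfun_of_cdual (Abs_cdual g) = g"
    by (simp add: Abs_cdual_inverse)
  with g have "F \<longlonglongrightarrow> Abs_cdual g"
    by (simp add: tendsto_iff dist_norm norm_cdual.rep_eq minus_cdual.rep_eq)
  then show "convergent F" by (auto simp: convergent_def)
qed

text \<open>The functional given by a function; only meaningful for bounded complex-linear functions.\<close>

definition cdual_of :: "('x::complex_normed_vector \<Rightarrow> complex) \<Rightarrow> 'x cdual"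
  where "cdual_of f = Abs_cdual (Blinfun f)"

lemma cdual_apply_cdual_of:
  assumes "bounded_clinear f"
  shows "cdual_apply (cdual_of f) = f"
proof -
  have "blinfun_apply (Blinfun f) = f"
    using assms by (simp add: bounded_clinear_def bounded_linear_Blinfun_apply)
  with assms show ?thesis
    by (simp add: cdual_of_def cdual_apply.rep_eq Abs_cdual_inverse bounded_clinear_iff
        scaleC_complex_def)
qed

lemma cdual_eqI: "(\<And>x. cdual_apply f x = cdual_apply g x) \<Longrightarrow> f = g"
  by transfer (rule blinfun_eqI)

lemma cdual_apply_add: "cdual_apply (f + g) x = cdual_apply f x + cdual_apply g x"
  by transfer (rule blinfun.add_left)

lemma cdual_apply_scaleC: "cdual_apply (c *\<^sub>C f) x = c * cdual_apply f x"
  by transfer (simp add: scaleC_blinfun.rep_eq)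

lemma norm_cdual_apply: "cmod (cdual_apply f x) \<le> norm f * norm x"
  by transfer (rule norm_blinfun)

lemma norm_cdual_eq_onorm: "norm f = onorm (cdual_apply f)"
  by transfer (rule norm_blinfun.rep_eq)

lemma bounded_clinear_cdual_apply: "bounded_clinear (cdual_apply f)"
  unfolding bounded_clinear_iff scaleC_complex_def
  by transfer (auto intro: blinfun.bounded_linear_right)

text \<open>The Banach space adjoint of a bounded operator.\<close>

definition dual_map ::
    "('x::complex_normed_vector \<Rightarrow> 'y::complex_normed_vector) \<Rightarrow> 'y cdual \<Rightarrow> 'x cdual"
  where "dual_map f \<phi> = cdual_of (\<lambda>x. cdual_apply \<phi> (f x))"

definition bidual_embed :: "'x::complex_normed_vector \<Rightarrow> 'x cdual cdual"
  where "bidual_embed x = cdual_of (\<lambda>\<phi>. cdual_apply \<phi> x)"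

definition dual_star :: "('x::complex_normed_vector \<Rightarrow> 'x) \<Rightarrow> 'x cdual \<Rightarrow> 'x cdual"
  where "dual_star s \<phi> = cdual_of (\<lambda>x. cnj (cdual_apply \<phi> (s x)))"

lemma bounded_clinear_compose:
  "bounded_clinear f \<Longrightarrow> bounded_clinear g \<Longrightarrow> bounded_clinear (\<lambda>x. f (g x))"
  by (auto simp: bounded_clinear_iff intro: bounded_linear_compose)

lemma dual_map_apply:
  "bounded_clinear f \<Longrightarrow> cdual_apply (dual_map f \<phi>) x = cdual_apply \<phi> (f x)"
  by (simp add: dual_map_def cdual_apply_cdual_of bounded_clinear_compose
      bounded_clinear_cdual_apply)

lemma bounded_clinear_dual_map:
  assumes f: "bounded_clinear f"
  shows "bounded_clinear (dual_map f)"
  unfolding bounded_clinear_iff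
proof (intro conjI allI)
  obtain K where K: "\<And>x. norm (f x) \<le> norm x * K" "K \<ge> 0"
    using f bounded_linear.nonneg_bounded unfolding bounded_clinear_def by blast
  show hom: "dual_map f (c *\<^sub>C \<phi>) = c *\<^sub>C dual_map f \<phi>" for c \<phi>
    by (intro cdual_eqI) (simp add: dual_map_apply f cdual_apply_scaleC)
  show "bounded_linear (dual_map f)"
  proof (rule bounded_linear_intro)
    show "dual_map f (\<phi> + \<psi>) = dual_map f \<phi> + dual_map f \<psi>" for \<phi> \<psi>
      by (intro cdual_eqI) (simp add: dual_map_apply f cdual_apply_add)
    show "dual_map f (t *\<^sub>R \<phi>) = t *\<^sub>R dual_map f \<phi>" for t \<phi>
      by (simp add: scaleR_scaleC hom)
    show "norm (dual_map f \<phi>) \<le> norm \<phi> * K" for \<phi>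
      unfolding norm_cdual_eq_onorm[of "dual_map f \<phi>"]
    proof (rule onorm_bound)
      fix x
      have "cmod (cdual_apply \<phi> (f x)) \<le> norm \<phi> * norm (f x)" by (rule norm_cdual_apply)
      also have "\<dots> \<le> norm \<phi> * (norm x * K)" by (intro mult_left_mono K) simp
      finally show "cmod (cdual_apply (dual_map f \<phi>) x) \<le> norm \<phi> * K * norm x"
        by (simp add: dual_map_apply f mult_ac)
    qed (simp add: K)
  qed
qed

lemma bidual_embed_apply: "cdual_apply (bidual_embed x) \<phi> = cdual_apply \<phi> x"
proof -
  have "bounded_clinear (\<lambda>\<phi>. cdual_apply \<phi> x)"
    unfolding bounded_clinear_iff
  proof (intro conjI allI)
    show "bounded_linear (\<lambda>\<phi>. cdual_apply \<phi> x)"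
      by (rule bounded_linear_intro[where K = "norm x"])
        (simp_all add: cdual_apply_add scaleR_scaleC cdual_apply_scaleC scaleC_complex_def
          norm_cdual_apply)
  qed (simp add: cdual_apply_scaleC scaleC_complex_def)
  then show ?thesis by (simp add: bidual_embed_def cdual_apply_cdual_of)
qed

lemma bounded_linear_if_continuous:
  fixes f :: "'x::real_normed_vector \<Rightarrow> 'y::real_normed_vector"
  assumes "linear f" and "continuous_on UNIV f"
  shows "bounded_linear f"
proof -
  interpret linear f by fact
  have "isCont f 0" using assms(2) by (simp add: continuous_on_eq_continuous_at)
  then obtain e where e: "e > 0" "\<And>x. norm x < e \<Longrightarrow> norm (f x) < 1"
    unfolding continuous_at_eps_delta by (auto simp: zero dist_norm dest: spec[of _ 1])
  have "norm (f x) \<le> norm x * (2 / e)" for x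
  proof (cases "x = 0")
    case True
    then show ?thesis by (simp add: zero)
  next
    case False
    define t where "t = e / (2 * norm x)"
    have t: "t > 0" using e False by (simp add: t_def)
    have "norm (scaleR t x) = e / 2" using False t e by (simp add: t_def)
    then have "norm (f (scaleR t x)) < 1" using e by simp
    then have "t * norm (f x) < 1" using t by (simp add: scale)
    then show ?thesis using e False by (simp add: t_def field_simps)
  qed
  then show ?thesis by (intro bounded_linear_intro[where K = "2 / e"]) (simp_all add: add scale)
qed

lemma dual_star_apply:
  assumes "continuous_on UNIV s" and add: "\<And>x y. s (x + y) = s x + s y"
    and hom: "\<And>c x. s (c *\<^sub>C x) = cnj c *\<^sub>C s x"
  shows "cdual_apply (dual_star s \<phi>) x = cnj (cdual_apply \<phi> (s x))"
proof -
  have "linear s" by (rule linearI) (simp_all add: add scaleR_scaleC hom)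
  then have "bounded_linear s" using assms(1) by (rule bounded_linear_if_continuous)
  then have "bounded_clinear (\<lambda>x. cnj (cdual_apply \<phi> (s x)))"
    using bounded_clinear_cdual_apply[of \<phi>] unfolding bounded_clinear_iff scaleC_complex_def
    by (auto simp: hom intro!: bounded_linear_compose[OF bounded_linear_cnj]
        intro: bounded_linear_compose)
  then show ?thesis by (simp add: dual_star_def cdual_apply_cdual_of)
qed


section \<open>Banach bimodules\<close>

locale banach_bimodule =
  fixes l :: "'a::complex_banach_algebra \<Rightarrow> 'x::complex_banach \<Rightarrow> 'x"
    and r :: "'x \<Rightarrow> 'a \<Rightarrow> 'x"
  assumes bounded_bilinear_l: "bounded_bilinear l"
    and bounded_bilinear_r: "bounded_bilinear r"
    and l_scaleC_left: "l (c *\<^sub>C a) x = c *\<^sub>C l a x"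
    and l_scaleC_right: "l a (c *\<^sub>C x) = c *\<^sub>C l a x"
    and r_scaleC_left: "r (c *\<^sub>C x) a = c *\<^sub>C r x a"
    and r_scaleC_right: "r x (c *\<^sub>C a) = c *\<^sub>C r x a"
    and l_mult: "l (a * b) x = l a (l b x)"
    and r_mult: "r x (a * b) = r (r x a) b"
    and l_r: "l a (r x b) = r (l a x) b"

locale banach_star_bimodule = banach_bimodule l r
  for l :: "'a::cstar_algebra \<Rightarrow> 'x::complex_banach \<Rightarrow> 'x" and r :: "'x \<Rightarrow> 'a \<Rightarrow> 'x" +
  fixes s :: "'x \<Rightarrow> 'x"
  assumes continuous_s: "continuous_on UNIV s"
    and s_add: "s (x + y) = s x + s y"
    and s_scaleC: "s (c *\<^sub>C x) = cnj c *\<^sub>C s x"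
    and s_s: "s (s x) = x"
    and s_l: "s (l a x) = r (s x) (star a)"
    and s_r: "s (r x a) = l (star a) (s x)"

definition essential_bimodule ::
    "('a::complex_banach_algebra \<Rightarrow> 'x::complex_banach \<Rightarrow> 'x) \<Rightarrow> ('x \<Rightarrow> 'a \<Rightarrow> 'x) \<Rightarrow> bool"
  where "essential_bimodule l r \<longleftrightarrow> closure (cspan {r (l a x) b | a b x. True}) = UNIV"

text \<open>On the dual, $(a\phi)(y) = \phi(ya)$ and $(\phi a)(y) = \phi(ay)$.\<close>

definition dual_left :: "('y::complex_normed_vector \<Rightarrow> 'a \<Rightarrow> 'y) \<Rightarrow> 'a \<Rightarrow> 'y cdual \<Rightarrow> 'y cdual"
  where "dual_left r a \<phi> = dual_map (\<lambda>y. r y a) \<phi>"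

definition dual_right :: "('a \<Rightarrow> 'y::complex_normed_vector \<Rightarrow> 'y) \<Rightarrow> 'y cdual \<Rightarrow> 'a \<Rightarrow> 'y cdual"
  where "dual_right l \<phi> a = dual_map (l a) \<phi>"

text \<open>``Of the form $Y^*$'' is read up to isometric bimodule isomorphism. The space $Y$ ranges over
  the type argument, as types cannot be quantified existentially.\<close>

definition dual_banach_bimodule ::
    "'y::complex_banach itself \<Rightarrow> ('a::complex_banach_algebra \<Rightarrow> 'x::complex_banach \<Rightarrow> 'x) \<Rightarrow>
      ('x \<Rightarrow> 'a \<Rightarrow> 'x) \<Rightarrow> bool"
  where "dual_banach_bimodule _ l r \<longleftrightarrow>
    (\<exists>(lY :: 'a \<Rightarrow> 'y \<Rightarrow> 'y) rY (\<Phi> :: 'x \<Rightarrow> 'y cdual).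
      banach_bimodule lY rY \<and>
      clinear \<Phi> \<and> bij \<Phi> \<and> (\<forall>x. norm (\<Phi> x) = norm x) \<and>
      (\<forall>a x. \<Phi> (l a x) = dual_left rY a (\<Phi> x)) \<and>
      (\<forall>a x. \<Phi> (r x a) = dual_right lY (\<Phi> x) a))"

definition bidual_left ::
    "('a \<Rightarrow> 'x::complex_normed_vector \<Rightarrow> 'x) \<Rightarrow> 'a \<Rightarrow> 'x cdual cdual \<Rightarrow> 'x cdual cdual"
  where "bidual_left l a z = dual_map (dual_map (l a)) z"

definition bidual_right ::
    "('x::complex_normed_vector \<Rightarrow> 'a \<Rightarrow> 'x) \<Rightarrow> 'x cdual cdual \<Rightarrow> 'a \<Rightarrow> 'x cdual cdual"
  where "bidual_right r z a = dual_map (dual_map (\<lambda>x. r x a)) z"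

definition bidual_star ::
    "('x::complex_normed_vector \<Rightarrow> 'x) \<Rightarrow> 'x cdual cdual \<Rightarrow> 'x cdual cdual"
  where "bidual_star s = dual_star (dual_star s)"


section \<open>Derivations\<close>

definition derivation ::
    "('a::complex_banach_algebra \<Rightarrow> 'x::complex_banach \<Rightarrow> 'x) \<Rightarrow> ('x \<Rightarrow> 'a \<Rightarrow> 'x) \<Rightarrow>
      ('a \<Rightarrow> 'x) \<Rightarrow> bool"
  where "derivation l r d \<longleftrightarrow> clinear d \<and> (\<forall>a b. d (a * b) = r (d a) b + l a (d b))"

definition star_derivation ::
    "('a::cstar_algebra \<Rightarrow> 'x::complex_banach \<Rightarrow> 'x) \<Rightarrow> ('x \<Rightarrow> 'a \<Rightarrow> 'x) \<Rightarrow> ('x \<Rightarrow> 'x) \<Rightarrow>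
      ('a \<Rightarrow> 'x) \<Rightarrow> bool"
  where "star_derivation l r s d \<longleftrightarrow> derivation l r d \<and> (\<forall>a. d (star a) = s (d a))"

definition r_star_anti_derivable_at_zero ::
    "('a::cstar_algebra \<Rightarrow> 'x::complex_banach \<Rightarrow> 'x) \<Rightarrow> ('x \<Rightarrow> 'a \<Rightarrow> 'x) \<Rightarrow> ('x \<Rightarrow> 'x) \<Rightarrow>
      ('a \<Rightarrow> 'x) \<Rightarrow> bool"
  where "r_star_anti_derivable_at_zero l r s T \<longleftrightarrow>
    (\<forall>a b. a * star b = 0 \<longrightarrow> r (s (T b)) a + l (star b) (T a) = 0)"

end

theory Submission
  imports Defs "HOL-Computational_Algebra.Polynomial"
begin

text \<open>Put \<open>S(c) = T(c\<^sup>*)\<^sup>*\<close>. The condition says that the bilinear map \<open>\<phi>(a,c) = S(c)a + cT(a)\<close> vanishes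
whenever \<open>ac = 0\<close>. On a C*-algebra a bounded bilinear map with this property satisfies
\<open>\<phi>(ab,c) = \<phi>(a,bc)\<close> (\<open>zero_product_determined\<close>), that is,
\<open>S(c)ab + cT(ab) = S(bc)a + bcT(a)\<close>. Let \<open>a\<close> run through an approximate identity \<open>e\<close>: the left side and
\<open>S(bc)e\<close> converge because \<open>X\<close> is essential, so \<open>bcT(e)\<close> converges, and by density of the products
\<open>R(a) = lim aT(e)\<close> exists in \<open>X\<close> for every \<open>a\<close>. Clearly \<open>R(ab) = aR(b)\<close>. The derivation will be
\<open>d = T - R\<close>, with values in \<open>X\<close>; the bidual is only needed to represent \<open>R\<close> as \<open>R(a) = a\<xi>\<close>, where
\<open>\<xi>\<close> is a weak* limit of \<open>T(e)\<close>. If \<open>A\<close> is unital then \<open>\<xi> = R(1)\<close> does, and if \<open>X\<close> is a dual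
bimodule the weak* limit exists in \<open>X\<close>.

The point is that \<open>d\<close> is a derivation. The displayed identity gives \<open>d(a\<^sup>*) = d(a)\<^sup>*\<close>, and it shows that
the defect \<open>B(b,c) = d(bc) - d(b)c - bd(c)\<close> equals \<open>\<tau>([b,c])\<close> for the bounded linear map
\<open>\<tau>(a) = T(a) + R(a\<^sup>*)\<^sup>*\<close>. Since \<open>B\<close> is a Hochschild coboundary, it then satisfies
\<open>B(b,ca) = B(b,a)c + aB(b,c)\<close>. Such maps vanish (\<open>antibiderivation_zero\<close>): comparing two expansions
of \<open>B(a,xyc)\<close> and of \<open>B(ab,cd)\<close> makes commutators annihilate the values of \<open>B\<close> (a C*-algebra being
semiprime in a strong sense), consequently the values commute with \<open>A\<close>, each \<open>B(b,-)\<close> is a derivation into a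
symmetric module, and the zero product theorem applied to \<open>(a,c) \<mapsto> aB(b,c)\<close> kills it. Now
\<open>B = 0\<close> says both that \<open>d\<close> is a derivation and that \<open>\<tau>\<close> vanishes on commutators, which is property (i).

Conversely, if \<open>ac = 0\<close> then \<open>ca = [c,a]\<close>, and (i) for this commutator is the condition on \<open>T\<close>; when \<open>\<xi>\<close> lives in
the bidual one returns to \<open>X\<close> by the Hahn-Banach theorem.

For the zero product theorem one may replace the middle factor by a self-adjoint \<open>h\<close> of small norm and study
\<open>\<psi>(f,g) = \<phi>(af(h), g(h)c)\<close> for continuous functions on \<open>[-1,1]\<close>. As \<open>\<psi>(f,g) = 0\<close> for \<open>fg = 0\<close>,
a fine piecewise linear subdivision shows \<open>\<psi>(id,1) = \<psi>(1,id)\<close>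
(\<open>diagonal_determines_bilinear_form\<close>). The functional calculus, with the bound by the supremum norm, is
obtained without spectral theory (\<open>norm_opoly_le\<close>): \<open>h\<close> is the mean of a unitary multiplier \<open>U\<close> and its
inverse, so a polynomial in \<open>h\<close> is a Laurent polynomial in \<open>U\<close> and its norm is at most the supremum norm times
the number of coefficients; applying this to high powers removes the extra factor, by the C*-identity.
The same estimate yields approximate identities.\<close>

section \<open>Hahn-Banach theorem and weak* limits\<close>

definition sublinear :: "('v::real_vector \<Rightarrow> real) \<Rightarrow> bool" where
  "sublinear q \<longleftrightarrow> (\<forall>x y. q (x + y) \<le> q x + q y) \<and> (\<forall>t\<ge>0. \<forall>x. q (t *\<^sub>R x) = t * q x)"

lemma sublinearD:
  assumes "sublinear q"
  shows "q (x + y) \<le> q x + q y" "t \<ge> 0 \<Longrightarrow> q (t *\<^sub>R x) = t * q x" "q 0 = 0" "- q (- x) \<le> q x"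
proof -
  show 1: "q (x + y) \<le> q x + q y" and "t \<ge> 0 \<Longrightarrow> q (t *\<^sub>R x) = t * q x" for x y t
    using assms by (auto simp: sublinear_def)
  then show 0: "q 0 = 0" by (metis mult_zero_left order_refl scaleR_zero_left)
  show "- q (- x) \<le> q x" using 1[of x "- x"] 0 by simp
qed

text \<open>Used for two kinds of infima: over a chain of sublinear functionals, where \<open>f\<close> is the identity, and over
the translates in \<open>sublinear_shrink\<close>.\<close>

lemma sublinear_Inf:
  assumes ne: "I \<noteq> {}" and bdd: "\<And>x. bdd_below ((\<lambda>i. f i x) ` I)"
    and add: "\<And>i j x y. i \<in> I \<Longrightarrow> j \<in> I \<Longrightarrow> \<exists>k\<in>I. f k (x + y) \<le> f i x + f j y"
    and scale: "\<And>i t x. i \<in> I \<Longrightarrow> t > 0 \<Longrightarrow> \<exists>k\<in>I. f k (t *\<^sub>R x) \<le> t * f i x"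
    and zero: "\<And>i. i \<in> I \<Longrightarrow> f i 0 = 0"
  shows "sublinear (\<lambda>x. INF i\<in>I. (f i x :: real))" (is "sublinear ?q")
proof -
  have le: "?q x \<le> f i x" if "i \<in> I" for i x
    using that bdd by (intro cINF_lower)
  have sc: "?q (t *\<^sub>R x) \<le> t * ?q x" if t: "t > 0" for t x
  proof -
    have "?q (t *\<^sub>R x) / t \<le> ?q x"
    proof (rule cINF_greatest[OF ne])
      fix i assume "i \<in> I"
      then obtain k where "k \<in> I" "f k (t *\<^sub>R x) \<le> t * f i x" using scale t by blast
      then show "?q (t *\<^sub>R x) / t \<le> f i x" using le[of k "t *\<^sub>R x"] t by (simp add: field_simps)
    qed
    then show ?thesis using t by (simp add: field_simps)
  qed
  show ?thesis unfolding sublinear_def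
  proof (intro conjI allI impI)
    fix x y
    have "?q (x + y) - f j y \<le> ?q x" if j: "j \<in> I" for j
    proof (rule cINF_greatest[OF ne])
      fix i assume "i \<in> I"
      then obtain k where "k \<in> I" "f k (x + y) \<le> f i x + f j y" using add j by blast
      then show "?q (x + y) - f j y \<le> f i x" using le[of k "x + y"] by simp
    qed
    then have "?q (x + y) - ?q x \<le> ?q y" by (intro cINF_greatest[OF ne]) force
    then show "?q (x + y) \<le> ?q x + ?q y" by simp
  next
    fix t :: real and x assume "t \<ge> 0"
    show "?q (t *\<^sub>R x) = t * ?q x"
    proof (cases "t = 0")
      case True
      then show ?thesis using zero ne by (simp cong: INF_cong_simp)
    next
      case False
      with \<open>t \<ge> 0\<close> have t: "t > 0" by simp
      have "?q x \<le> inverse t * ?q (t *\<^sub>R x)" using sc[of "inverse t" "t *\<^sub>R x"] t by simp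
      then have "t * ?q x \<le> ?q (t *\<^sub>R x)" using t by (simp add: field_simps)
      with sc[OF t, of x] show ?thesis by simp
    qed
  qed
qed

text \<open>The infimum of \<open>q (x + t y) - t q y\<close> over \<open>t \<ge> 0\<close> lowers \<open>q\<close> as far as needed in the direction
\<open>- y\<close>. Hence a minimal sublinear functional is odd, and therefore linear; applied to the norm, the same
construction prepares a norming functional.\<close>

lemma sublinear_shrink:
  assumes q: "sublinear q"
  shows "\<exists>q'. sublinear q' \<and> (\<forall>x. q' x \<le> q x) \<and> q' (- y) \<le> - q y"
proof -
  note D = sublinearD[OF q]
  define f where "f t x = q (x + t *\<^sub>R y) - t * q y" for t x
  have bdd: "bdd_below ((\<lambda>t. f t x) ` {0..})" for x
  proof (rule bdd_belowI2)
    fix t :: real assume "t \<in> {0..}"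
    then have "t * q y \<le> q (x + t *\<^sub>R y) + q (- x)"
      using D(2)[of t y] D(1)[of "x + t *\<^sub>R y" "- x"] by simp
    then show "- q (- x) \<le> f t x" by (simp add: f_def)
  qed
  define q' where "q' x = (INF t\<in>{0..}. f t x)" for x
  have le: "q' x \<le> f t x" if "t \<ge> 0" for t x
    unfolding q'_def using that bdd by (intro cINF_lower) auto
  have "sublinear q'" unfolding q'_def
  proof (rule sublinear_Inf[OF _ bdd])
    show "\<exists>k\<in>{0..}. f k (u + v) \<le> f i u + f j v" if "i \<in> {0..}" "j \<in> {0..}" for i j u v
    proof (rule bexI[of _ "i + j"])
      show "f (i + j) (u + v) \<le> f i u + f j v"
        using D(1)[of "u + i *\<^sub>R y" "v + j *\<^sub>R y"] by (simp add: f_def algebra_simps)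
    qed (use that in auto)
    show "\<exists>k\<in>{0..}. f k (t *\<^sub>R u) \<le> t * f i u" if "i \<in> {0..}" "t > 0" for i t u
    proof (rule bexI[of _ "t * i"])
      show "f (t * i) (t *\<^sub>R u) \<le> t * f i u"
        using D(2)[of t "u + i *\<^sub>R y"] that by (simp add: f_def algebra_simps)
    qed (use that in auto)
  qed (auto simp: f_def D)
  moreover have "q' x \<le> q x" for x using le[of 0 x] by (simp add: f_def)
  moreover have "q' (- y) \<le> - q y" using le[of 1 "- y"] by (simp add: f_def D)
  ultimately show ?thesis by blast
qed

text \<open>By Zorn's lemma there is a minimal sublinear functional below \<open>p\<close>; minimality and
\<open>sublinear_shrink\<close> make it odd. This form of the Hahn-Banach theorem needs no extension from subspaces.\<close>

theorem sublinear_dominates_linear: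
  assumes p: "sublinear p"
  shows "\<exists>f. linear f \<and> (\<forall>x. f x \<le> p x)"
proof -
  define S where "S = {q. sublinear q \<and> (\<forall>x. q x \<le> p x)}"
  define P where "P q q' \<longleftrightarrow> (\<forall>x. q' x \<le> q x)" for q q' :: "'a \<Rightarrow> real"
  have "\<exists>m\<in>S. \<forall>q\<in>S. P m q \<longrightarrow> q = m"
  proof (rule predicate_Zorn)
    show "partial_order_on S (relation_of P S)"
      by (rule partial_order_on_relation_ofI)
        (auto simp: P_def fun_eq_iff intro: order_trans antisym)
  next
    fix C assume C: "C \<in> Chains (relation_of P S)"
    then have CS: "C \<subseteq> S" and ch: "\<And>a b. a \<in> C \<Longrightarrow> b \<in> C \<Longrightarrow> P a b \<or> P b a"
      by (auto simp: Chains_def relation_of_def)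
    show "\<exists>u\<in>S. \<forall>a\<in>C. P a u"
    proof (cases "C = {}")
      case True
      then show ?thesis using p by (auto simp: S_def)
    next
      case False
      have bdd: "bdd_below ((\<lambda>q. q x) ` C)" for x
      proof (rule bdd_belowI2)
        fix q assume "q \<in> C"
        then have "sublinear q" "q (- x) \<le> p (- x)" using CS by (auto simp: S_def)
        then show "- p (- x) \<le> q x" using sublinearD(4)[of q x] by simp
      qed
      let ?u = "\<lambda>x. INF q\<in>C. q x"
      have le: "?u x \<le> q x" if "q \<in> C" for q x using that bdd by (intro cINF_lower)
      have "sublinear ?u"
      proof (rule sublinear_Inf[OF False bdd])
        fix a b x y assume ab: "a \<in> C" "b \<in> C"
        have sl: "sublinear a" "sublinear b" using ab CS by (auto simp: S_def)
        show "\<exists>k\<in>C. k (x + y) \<le> a x + b y"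
        proof (cases "P a b")
          case True
          then have "b (x + y) \<le> a x + b y"
            using sublinearD(1)[OF sl(2), of x y] by (simp add: P_def) (meson add_right_mono order_trans)
          then show ?thesis using ab by blast
        next
          case False
          then have "P b a" using ch ab by blast
          then have "a (x + y) \<le> a x + b y"
            using sublinearD(1)[OF sl(1), of x y] by (simp add: P_def) (meson add_left_mono order_trans)
          then show ?thesis using ab by blast
        qed
      next
        fix a t x assume "a \<in> C" "(t::real) > 0"
        then show "\<exists>k\<in>C. k (t *\<^sub>R x) \<le> t * a x"
          using CS sublinearD(2)[of a t x] by (intro bexI[of _ a]) (auto simp: S_def)
      next
        show "a 0 = 0" if "a \<in> C" for a using that CS sublinearD(3)[of a] by (auto simp: S_def)
      qed
      moreover obtain q where "q \<in> C" using False by blast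
      then have "?u x \<le> p x" for x using le[of q x] CS by (auto simp: S_def intro: order_trans)
      ultimately show ?thesis using le by (intro bexI[of _ ?u]) (auto simp: S_def P_def)
    qed
  qed
  then obtain m where m: "sublinear m" "\<And>x. m x \<le> p x"
    and min: "\<And>q. sublinear q \<Longrightarrow> (\<And>x. q x \<le> m x) \<Longrightarrow> q = m"
    unfolding S_def P_def by (auto intro: order_trans) (metis order_trans)
  note D = sublinearD[OF m(1)]
  have neg: "m (- y) = - m y" for y
  proof -
    obtain q' where "sublinear q'" "\<And>x. q' x \<le> m x" "q' (- y) \<le> - m y"
      using sublinear_shrink[OF m(1), of y] by blast
    then have "m (- y) \<le> - m y" using min[of q'] by simp
    then show ?thesis using D(4)[of y] by simp
  qed
  have "linear m"
  proof (rule linearI)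
    show "m (x + y) = m x + m y" for x y
      using D(1)[of x y] D(1)[of "- x" "- y"] neg[of "x + y"] neg[of x] neg[of y] by simp
    show "m (t *\<^sub>R x) = t *\<^sub>R m x" for t x
    proof (cases "t \<ge> 0")
      case False
      then have "m ((- t) *\<^sub>R x) = - t * m x" by (intro D(2)) simp
      then show ?thesis using neg[of "t *\<^sub>R x"] by simp
    qed (simp add: D(2))
  qed
  with m(2) show ?thesis by blast
qed

text \<open>A complex functional is determined by its real part \<open>f\<close> through \<open>\<phi>(x) = f(x) - \<i> f(\<i>x)\<close>.\<close>

lemma cdual_from_real_part:
  fixes f :: "'v::complex_normed_vector \<Rightarrow> real"
  assumes f: "linear f" and bound: "\<And>x. f x \<le> K * norm x"
  shows "\<exists>\<phi>. \<forall>x. cdual_apply \<phi> x = Complex (f x) (- f (\<i> *\<^sub>C x))"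
proof -
  interpret linear f by fact
  define g where "g x = Complex (f x) (- f (\<i> *\<^sub>C x))" for x
  have abs: "\<bar>f x\<bar> \<le> K * norm x" for x
    using bound[of x] bound[of "- x"] by (simp add: neg)
  have gadd: "g (x + y) = g x + g y" for x y
    by (simp add: g_def complex_eq_iff add scaleC_add_right)
  have i2: "\<i> *\<^sub>C \<i> *\<^sub>C x = - x" for x :: 'v
    using scaleR_scaleC[of "-1" x] by (simp add: scaleC_scaleC)
  have gR: "g (t *\<^sub>R x) = t *\<^sub>R g x" for t x
  proof -
    have "\<i> *\<^sub>C (t *\<^sub>R x) = t *\<^sub>R (\<i> *\<^sub>C x)" by (simp add: scaleR_scaleC scaleC_scaleC mult.commute)
    then show ?thesis by (simp add: g_def complex_eq_iff scale)
  qed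
  have gi: "g (\<i> *\<^sub>C x) = \<i> * g x" for x
    by (simp add: g_def complex_eq_iff i2 neg)
  have gC: "g (c *\<^sub>C x) = c * g x" for c x
  proof -
    have "c *\<^sub>C x = Re c *\<^sub>R x + Im c *\<^sub>R (\<i> *\<^sub>C x)"
      unfolding scaleR_scaleC scaleC_scaleC scaleC_add_left[symmetric]
      using complex_eq[of c] by (simp add: mult.commute)
    then have "g (c *\<^sub>C x) = Re c *\<^sub>R g x + Im c *\<^sub>R (\<i> * g x)" by (simp add: gadd gR gi)
    also have "\<dots> = c * g x" by (simp add: complex_eq_iff)
    finally show ?thesis .
  qed
  have "bounded_linear g"
  proof (rule bounded_linear_intro)
    show "norm (g x) \<le> norm x * (K + K)" for x
    proof -
      have "norm (g x) \<le> \<bar>f x\<bar> + \<bar>f (\<i> *\<^sub>C x)\<bar>"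
        using cmod_le[of "g x"] by (simp add: g_def)
      also have "\<dots> \<le> K * norm x + K * norm x"
        using abs[of x] abs[of "\<i> *\<^sub>C x"] by (simp add: norm_scaleC)
      finally show ?thesis by (simp add: algebra_simps)
    qed
  qed (simp_all add: gadd gR)
  then have "bounded_clinear g" by (simp add: bounded_clinear_iff gC scaleC_complex_def)
  then have "cdual_apply (cdual_of g) x = g x" for x by (simp add: cdual_apply_cdual_of)
  then show ?thesis unfolding g_def by blast
qed

theorem cdual_separates_points:
  fixes x :: "'v::complex_normed_vector"
  assumes "\<And>\<phi>. cdual_apply \<phi> x = 0"
  shows "x = 0"
proof -
  have "sublinear (norm :: 'v \<Rightarrow> real)" by (simp add: sublinear_def norm_triangle_ineq)
  from sublinear_shrink[OF this, of x] obtain q where q: "sublinear q"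
    "\<And>y. q y \<le> norm y" "q (- x) \<le> - norm x" by blast
  obtain f where f: "linear f" "\<And>y. f y \<le> q y" using sublinear_dominates_linear[OF q(1)] by blast
  have "f y \<le> 1 * norm y" for y using f(2)[of y] q(2)[of y] by simp
  from cdual_from_real_part[OF f(1) this] obtain \<phi> where
    "\<forall>y. cdual_apply \<phi> y = Complex (f y) (- f (\<i> *\<^sub>C y))" by blast
  then have "f x = 0" using assms[of \<phi>] by (simp add: complex_eq_iff)
  moreover have "f (- x) \<le> - norm x" using f(2)[of "- x"] q(3) by simp
  ultimately show ?thesis using linear_neg[OF f(1), of x] by simp
qed

text \<open>A substitute for weak* compactness of balls: \<open>\<xi>\<close> is a linear functional dominated by the upper limit of
the real parts along \<open>F\<close>, so it has to agree with every limit that exists.\<close>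

theorem weak_star_limit:
  fixes g :: "'i \<Rightarrow> 'v::complex_normed_vector cdual"
  assumes F: "F \<noteq> bot" and bound: "\<forall>\<^sub>F i in F. norm (g i) \<le> K"
  shows "\<exists>\<xi>. \<forall>y L. ((\<lambda>i. cdual_apply (g i) y) \<longlongrightarrow> L) F \<longrightarrow> cdual_apply \<xi> y = L"
proof -
  \<comment> \<open>\<open>p\<close> is the upper limit along \<open>F\<close>, written as the infimum of the eventual upper bounds.\<close>
  define E where "E y = {c. \<forall>\<^sub>F i in F. Re (cdual_apply (g i) y) \<le> c}" for y
  define p where "p y = Inf (E y)" for y
  have abs: "\<forall>\<^sub>F i in F. \<bar>Re (cdual_apply (g i) y)\<bar> \<le> K * norm y" for y
    using bound
  proof eventually_elim
    case (elim i)
    have "\<bar>Re (cdual_apply (g i) y)\<bar> \<le> norm (g i) * norm y"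
      using abs_Re_le_cmod norm_cdual_apply order_trans by blast
    also have "\<dots> \<le> K * norm y" using elim by (simp add: mult_right_mono)
    finally show ?case .
  qed
  have top: "K * norm y \<in> E y" for y
    unfolding E_def mem_Collect_eq using abs[of y] by (rule eventually_mono) auto
  have low: "- (K * norm y) \<le> c" if "c \<in> E y" for c y
  proof -
    have "\<forall>\<^sub>F i in F. - (K * norm y) \<le> c"
      using that abs[of y] unfolding E_def mem_Collect_eq by eventually_elim auto
    then show ?thesis using F by (simp add: eventually_const)
  qed
  have bdd: "bdd_below (E y)" for y using low by (rule bdd_belowI)
  have pE: "p y \<le> c" if "c \<in> E y" for c y unfolding p_def using that bdd by (rule cInf_lower)
  have lub: "z \<le> p y" if "\<And>c. c \<in> E y \<Longrightarrow> z \<le> c" for z y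
    unfolding p_def using top by (intro cInf_greatest that) auto
  have sc: "p (t *\<^sub>R y) \<le> t * p y" if t: "t > 0" for t y
  proof -
    have "p (t *\<^sub>R y) / t \<le> p y"
    proof (rule lub)
      fix c assume "c \<in> E y"
      then have "\<forall>\<^sub>F i in F. Re (cdual_apply (g i) y) \<le> c" by (simp add: E_def)
      then have "t * c \<in> E (t *\<^sub>R y)" unfolding E_def mem_Collect_eq
        by eventually_elim (use t in \<open>simp add: scaleR_scaleC bounded_clinear_cdual_apply[unfolded bounded_clinear_iff] scaleC_complex_def\<close>)
      then show "p (t *\<^sub>R y) / t \<le> c" using pE t by (simp add: field_simps)
    qed
    then show ?thesis using t by (simp add: field_simps)
  qed
  have add: "cdual_apply \<phi> (x + y) = cdual_apply \<phi> x + cdual_apply \<phi> y" for \<phi> :: "'v cdual" and x y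
    using bounded_clinear_cdual_apply[of \<phi>] by (simp add: bounded_clinear_iff bounded_linear.linear linear_add)
  have hom: "cdual_apply \<phi> (c *\<^sub>C x) = c * cdual_apply \<phi> x" for \<phi> :: "'v cdual" and c x
    using bounded_clinear_cdual_apply[of \<phi>] by (simp add: bounded_clinear_iff scaleC_complex_def)
  have "sublinear p" unfolding sublinear_def
  proof (intro conjI allI impI)
    fix x y
    have "p (x + y) - c \<le> p y" if c: "c \<in> E x" for c
    proof (rule lub)
      fix c' assume "c' \<in> E y"
      then have "\<forall>\<^sub>F i in F. Re (cdual_apply (g i) y) \<le> c'" by (simp add: E_def)
      moreover have "\<forall>\<^sub>F i in F. Re (cdual_apply (g i) x) \<le> c" using c by (simp add: E_def)
      ultimately have "c + c' \<in> E (x + y)" unfolding E_def mem_Collect_eq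
        by eventually_elim (simp add: add)
      then show "p (x + y) - c \<le> c'" using pE[of "c + c'" "x + y"] by simp
    qed
    then have "p (x + y) - p y \<le> p x" by (intro lub) force
    then show "p (x + y) \<le> p x + p y" by simp
  next
    fix t :: real and x assume "t \<ge> 0"
    have p0: "p 0 = 0"
      using low[of _ 0] top[of 0] by (intro antisym pE lub) auto
    show "p (t *\<^sub>R x) = t * p x"
    proof (cases "t = 0")
      case False
      with \<open>t \<ge> 0\<close> have t: "t > 0" by simp
      have "p x \<le> inverse t * p (t *\<^sub>R x)" using sc[of "inverse t" "t *\<^sub>R x"] t by simp
      then have "t * p x \<le> p (t *\<^sub>R x)" using t by (simp add: field_simps)
      with sc[OF t, of x] show ?thesis by simp
    qed (simp add: p0)
  qed
  then obtain f where f: "linear f" "\<And>y. f y \<le> p y" using sublinear_dominates_linear by blast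
  have "f y \<le> K * norm y" for y using f(2)[of y] pE[OF top[of y]] by simp
  from cdual_from_real_part[OF f(1) this] obtain \<xi> where
    xi: "\<And>y. cdual_apply \<xi> y = Complex (f y) (- f (\<i> *\<^sub>C y))" by blast
  have up: "f y \<le> l" if "((\<lambda>i. Re (cdual_apply (g i) y)) \<longlongrightarrow> l) F" for y l
  proof (rule field_le_epsilon)
    fix e :: real assume "e > 0"
    then have "\<forall>\<^sub>F i in F. Re (cdual_apply (g i) y) < l + e" using that by (intro order_tendstoD(2)[OF that]) simp
    then have "l + e \<in> E y" unfolding E_def mem_Collect_eq by (rule eventually_mono) simp
    then show "f y \<le> l + e" using pE f(2)[of y] by force
  qed
  have eq: "f y = l" if "((\<lambda>i. Re (cdual_apply (g i) y)) \<longlongrightarrow> l) F" for y l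
  proof -
    have neg: "cdual_apply (g i) (- y) = - cdual_apply (g i) y" for i
      using bounded_clinear_cdual_apply[of "g i"]
      by (simp add: bounded_clinear_iff bounded_linear.linear linear_neg)
    have "((\<lambda>i. Re (cdual_apply (g i) (- y))) \<longlongrightarrow> - l) F"
      using tendsto_minus[OF that] by (simp add: neg)
    then have "f (- y) \<le> - l" by (rule up)
    then show ?thesis using up[OF that] linear_neg[OF f(1), of y] by simp
  qed
  have "cdual_apply \<xi> y = L" if lim: "((\<lambda>i. cdual_apply (g i) y) \<longlongrightarrow> L) F" for y L
  proof -
    have "((\<lambda>i. Re (\<i> * cdual_apply (g i) y)) \<longlongrightarrow> Re (\<i> * L)) F"
      by (intro tendsto_intros lim)
    then have "f (\<i> *\<^sub>C y) = Re (\<i> * L)" by (intro eq) (simp only: hom)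
    moreover have "f y = Re L" by (intro eq tendsto_intros lim)
    ultimately show ?thesis by (simp add: xi complex_eq_iff)
  qed
  then show ?thesis by blast
qed

section \<open>Complex scalars, linear maps and the involution\<close>

lemma scaleC_zero_right [simp]: "c *\<^sub>C (0 :: 'v::complex_normed_vector) = 0"
  by (metis norm_eq_zero norm_scaleC mult_zero_right norm_zero)

lemma scaleC_zero_left [simp]: "0 *\<^sub>C (x :: 'v::complex_normed_vector) = 0"
  by (metis norm_eq_zero norm_scaleC mult_zero_left norm_zero)

lemma scaleC_minus_right: "c *\<^sub>C (- x) = - (c *\<^sub>C (x :: 'v::complex_normed_vector))"
  by (metis add.right_inverse add_eq_0_iff scaleC_add_right scaleC_zero_right)

lemma scaleC_minus_left: "(- c) *\<^sub>C x = - (c *\<^sub>C (x :: 'v::complex_normed_vector))"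
  by (metis add.right_inverse add_eq_0_iff scaleC_add_left scaleC_zero_left)

lemma scaleC_diff_right: "c *\<^sub>C (x - y) = c *\<^sub>C x - c *\<^sub>C (y :: 'v::complex_normed_vector)"
  by (metis scaleC_add_right scaleC_minus_right diff_conv_add_uminus)

lemma scaleC_sum_right: "c *\<^sub>C sum f A = (\<Sum>i\<in>A. c *\<^sub>C (f i :: 'v::complex_normed_vector))"
  by (induction A rule: infinite_finite_induct) (simp_all add: scaleC_add_right)

lemma clinearD:
  assumes "clinear f"
  shows "f (x + y) = f x + f y" "f (c *\<^sub>C x) = c *\<^sub>C f x" "f 0 = 0" "f (- x) = - f x" "f (x - y) = f x - f y"
    "f (sum g A) = (\<Sum>i\<in>A. f (g i))"
proof -
  show 1: "f (x + y) = f x + f y" and 2: "f (c *\<^sub>C x) = c *\<^sub>C f x" for x y c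
    using assms by (auto simp: clinear_iff)
  show 0: "f 0 = 0" using 1[of 0 0] by simp
  show m: "f (- x) = - f x" for x using 1[of x "- x"] 0 by (simp add: eq_neg_iff_add_eq_0 add.commute)
  show "f (x - y) = f x - f y" using 1[of x "- y"] m[of y] by simp
  show "f (sum g A) = (\<Sum>i\<in>A. f (g i))"
    by (induction A rule: infinite_finite_induct) (simp_all add: 0 1)
qed

lemma bounded_clinear_clinear: "bounded_clinear f \<Longrightarrow> clinear f"
  by (simp add: bounded_clinear_def)

lemma bounded_clinear_bounded_linear: "bounded_clinear f \<Longrightarrow> bounded_linear f"
  by (simp add: bounded_clinear_def)

lemma star_zero [simp]: "star 0 = (0 :: 'a::cstar_algebra)"
  using star_add[of 0 "0::'a"] by simp

lemma star_minus: "star (- a) = - star (a :: 'a::cstar_algebra)"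
  using star_add[of a "- a"] by (simp add: eq_neg_iff_add_eq_0 add.commute)

lemma star_diff: "star (a - b) = star a - star (b :: 'a::cstar_algebra)"
  using star_add[of a "- b"] by (simp add: star_minus)

lemma star_scaleR: "star (t *\<^sub>R a) = t *\<^sub>R star (a :: 'a::cstar_algebra)"
  by (simp add: scaleR_scaleC star_scaleC)

lemma norm_star [simp]: "norm (star a) = norm (a :: 'a::cstar_algebra)"
proof -
  have le: "norm a \<le> norm (star a)" for a :: 'a
  proof (cases "a = 0")
    case False
    have "norm a * norm a \<le> norm (star a) * norm a"
      using cstar_identity[of a] norm_mult_ineq[of "star a" a] by (simp add: power2_eq_square)
    then show ?thesis using False by simp
  qed simp
  from le[of a] le[of "star a"] show ?thesis by (simp add: star_star)
qed

lemma bounded_linear_star: "bounded_linear (star :: 'a::cstar_algebra \<Rightarrow> 'a)"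
  by (rule bounded_linear_intro[where K = 1]) (simp_all add: star_add star_scaleR)

lemma cstar_identity': "norm (a * star a) = (norm (a :: 'a::cstar_algebra))\<^sup>2"
  using cstar_identity[of "star a"] by (simp add: star_star)

text \<open>Because \<open>z z\<^sup>*\<close> has norm the square of that of \<open>z\<close>, an element is never larger than the operator of left
multiplication by it.\<close>

lemma norm_le_if_left_mult_le:
  fixes z :: "'a::cstar_algebra"
  assumes "\<delta> \<ge> 0" and "\<And>y. norm (z * y) \<le> \<delta> * norm y"
  shows "norm z \<le> \<delta>"
proof (cases "z = 0")
  case False
  have "norm z * norm z \<le> \<delta> * norm z"
    using assms(2)[of "star z"] by (simp add: cstar_identity' power2_eq_square)
  then show ?thesis using False by simp
qed (simp add: assms)

section \<open>Polynomials in a self-adjoint element\<close>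

definition opoly :: "complex poly \<Rightarrow> ('v::complex_normed_vector \<Rightarrow> 'v) \<Rightarrow> 'v \<Rightarrow> 'v" where
  "opoly p f y = (\<Sum>k\<le>degree p. coeff p k *\<^sub>C (f ^^ k) y)"

lemma opoly_altdef:
  assumes "degree p \<le> n"
  shows "opoly p f y = (\<Sum>k\<le>n. coeff p k *\<^sub>C (f ^^ k) y)"
  unfolding opoly_def using assms
  by (intro sum.mono_neutral_left) (auto simp: coeff_eq_0)

lemma opoly_zero [simp]: "opoly 0 f y = 0"
  by (simp add: opoly_def)

lemma opoly_add: "opoly (p + q) f y = opoly p f y + opoly q f y"
proof -
  define n where "n = max (degree p) (degree q)"
  have "degree (p + q) \<le> n" "degree p \<le> n" "degree q \<le> n"
    using degree_add_le_max[of p q] by (auto simp: n_def)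
  then show ?thesis by (simp add: opoly_altdef scaleC_add_left sum.distrib)
qed

lemma opoly_smult: "opoly (smult c p) f y = c *\<^sub>C opoly p f y"
proof -
  have "opoly (smult c p) f y = (\<Sum>k\<le>degree p. coeff (smult c p) k *\<^sub>C (f ^^ k) y)"
    by (rule opoly_altdef) (rule degree_smult_le)
  then show ?thesis by (simp add: opoly_def scaleC_sum_right scaleC_scaleC)
qed

lemma opoly_pCons:
  assumes "clinear f"
  shows "opoly (pCons a p) f y = a *\<^sub>C y + f (opoly p f y)"
proof -
  have "degree (pCons a p) \<le> Suc (degree p)" by (rule degree_pCons_le)
  then have "opoly (pCons a p) f y = (\<Sum>k\<le>Suc (degree p). coeff (pCons a p) k *\<^sub>C (f ^^ k) y)"
    by (rule opoly_altdef)
  also have "\<dots> = a *\<^sub>C y + f (opoly p f y)"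
    by (simp add: sum.atMost_Suc_shift opoly_def clinearD[OF assms] del: sum.atMost_Suc)
  finally show ?thesis .
qed

lemma opoly_monom: "clinear f \<Longrightarrow> opoly (monom a k) f y = a *\<^sub>C (f ^^ k) y"
  by (induction k) (simp_all add: monom_0 monom_Suc opoly_pCons clinearD)

lemma opoly_mult:
  assumes "clinear f"
  shows "opoly (p * q) f y = opoly p f (opoly q f y)"
proof (induction p)
  case (pCons a p)
  then show ?case by (simp add: opoly_add opoly_smult opoly_pCons[OF assms])
qed simp

lemma opoly_swap: "clinear f \<Longrightarrow> opoly p f (f y) = f (opoly p f y)"
  using opoly_mult[of f p "[:0, 1:]" y] opoly_mult[of f "[:0, 1:]" p y]
  by (simp add: opoly_pCons mult.commute clinearD)

text \<open>The coefficients are averages of the polynomial, twisted by a character, over the roots of unity of an order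
exceeding the degree.\<close>

lemma norm_coeff_le_circle:
  fixes Q :: "complex poly"
  assumes M: "\<And>z. cmod z = 1 \<Longrightarrow> cmod (poly Q z) \<le> M"
  shows "cmod (coeff Q k) \<le> M"
proof (cases "k \<le> degree Q")
  case False
  then have "coeff Q k = 0" by (simp add: coeff_eq_0)
  moreover have "0 \<le> M" using order_trans[OF norm_ge_zero M[of 1]] by simp
  ultimately show ?thesis by simp
next
  case True
  define m where "m = Suc (degree Q)"
  define w where "w = cis (2 * pi / m)"
  have wpow: "w ^ j = cis (2 * pi * j / m)" for j
  proof -
    have "w ^ j = cis (real j * (2 * pi / real m))" unfolding w_def by (rule Complex.DeMoivre)
    also have "real j * (2 * pi / real m) = 2 * pi * j / m" by simp
    finally show ?thesis .
  qed
  have "m \<noteq> 0" by (simp add: m_def)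
  then have wm: "w ^ m = 1" by (simp add: wpow)
  have cw: "cmod w = 1" by (simp add: w_def)
  then have wc: "w * cnj w = 1" using complex_norm_square[of w] by simp
  have inj: "inj_on (\<lambda>j. w ^ j) {..<m}"
    using Complex.bij_betw_roots_unity[of m] by (simp add: wpow m_def bij_betw_def)
  have geo: "(\<Sum>j<m. (w ^ j) ^ l * cnj ((w ^ j) ^ k)) = (if l = k then of_nat m else 0)"
    if l: "l \<le> degree Q" for l
  proof -
    define q where "q = w ^ l * cnj w ^ k"
    have term_eq: "(w ^ j) ^ l * cnj ((w ^ j) ^ k) = q ^ j" for j
      unfolding q_def power_mult_distrib complex_cnj_power power_mult[symmetric]
      by (simp only: mult.commute[of j])
    show ?thesis
    proof (cases "l = k")
      case True
      have "q = (w * cnj w) ^ k" unfolding q_def True by (rule power_mult_distrib[symmetric])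
      with True show ?thesis unfolding term_eq by (simp add: wc)
    next
      case False
      have "q * w ^ k = w ^ l * (w * cnj w) ^ k" unfolding q_def power_mult_distrib by (simp only: mult_ac)
      then have qk: "q * w ^ k = w ^ l" by (simp add: wc)
      have "q \<noteq> 1"
      proof
        assume "q = 1"
        then have "w ^ k = w ^ l" using qk by simp
        moreover have "k \<in> {..<m}" "l \<in> {..<m}" using l True by (auto simp: m_def)
        ultimately have "k = l" by (rule inj_onD[OF inj])
        then show False using False by simp
      qed
      moreover have "q ^ m = 1"
      proof -
        have "q ^ m = (w ^ m) ^ l * cnj ((w ^ m) ^ k)"
          unfolding q_def power_mult_distrib complex_cnj_power power_mult[symmetric]
          by (simp only: mult.commute[of m])
        then show ?thesis by (simp add: wm)
      qed
      ultimately show ?thesis using False unfolding term_eq by (simp add: geometric_sum)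
    qed
  qed
  have "(\<Sum>j<m. poly Q (w ^ j) * cnj ((w ^ j) ^ k))
      = (\<Sum>j<m. \<Sum>l\<le>degree Q. coeff Q l * ((w ^ j) ^ l * cnj ((w ^ j) ^ k)))"
    by (simp add: poly_altdef sum_distrib_right mult.assoc)
  also have "\<dots> = (\<Sum>l\<le>degree Q. coeff Q l * (\<Sum>j<m. (w ^ j) ^ l * cnj ((w ^ j) ^ k)))"
    by (subst sum.swap) (simp add: sum_distrib_left)
  also have "\<dots> = (\<Sum>l\<le>degree Q. if l = k then coeff Q l * of_nat m else 0)"
    by (intro sum.cong refl) (subst geo, auto)
  also have "\<dots> = coeff Q k * of_nat m" using True by simp
  finally have eq: "coeff Q k * of_nat m = (\<Sum>j<m. poly Q (w ^ j) * cnj ((w ^ j) ^ k))" ..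
  have "cmod (coeff Q k) * m = cmod (coeff Q k * of_nat m)" by (simp add: norm_mult)
  also have "\<dots> \<le> (\<Sum>j<m. cmod (poly Q (w ^ j) * cnj ((w ^ j) ^ k)))"
    unfolding eq by (rule norm_sum)
  also have "\<dots> \<le> (\<Sum>j<m. M)"
    by (intro sum_mono) (simp add: norm_mult norm_power cw M)
  finally have "cmod (coeff Q k) * m \<le> M * m" by (simp add: mult.commute)
  then show ?thesis by (simp add: m_def)
qed

text \<open>Substituting \<open>H = (U + U')/2\<close>, with \<open>U'\<close> inverse to \<open>U\<close>, turns a polynomial in \<open>H\<close> into a Laurent
polynomial in \<open>U\<close>; multiplication by \<open>U\<close> to the power \<open>n\<close> clears the negative exponents. On the unit
circle the same substitution reads \<open>(z + 1/z)/2 = Re z\<close>.\<close>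

lemma opoly_laurent:
  fixes H U U' :: "'v::complex_normed_vector \<Rightarrow> 'v"
  assumes U: "clinear U" and H: "clinear H"
    and UU': "\<And>y. U (U' y) = y" and H2: "\<And>y. H y = (1/2) *\<^sub>C (U y + U' y)"
  shows "degree p \<le> n \<Longrightarrow> \<exists>Q. degree Q \<le> 2 * n \<and>
    (\<forall>z. z \<noteq> 0 \<longrightarrow> poly Q z = z ^ n * poly p ((z + 1 / z) / 2)) \<and>
    (\<forall>y. (U ^^ n) (opoly p H y) = opoly Q U y)"
proof (induction n arbitrary: p)
  case 0
  then obtain a where "p = [:a:]" by (metis degree_eq_zeroE le_zero_eq)
  then show ?case by (intro exI[of _ p]) (simp add: opoly_pCons U H clinearD)
next
  case (Suc n)
  obtain a p' where p: "p = pCons a p'" by (cases p)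
  then have "degree p' \<le> n" using Suc.prems by (cases "p' = 0") auto
  then obtain Q where Q: "degree Q \<le> 2 * n"
      "\<And>z. z \<noteq> 0 \<Longrightarrow> poly Q z = z ^ n * poly p' ((z + 1 / z) / 2)"
      "\<And>y. (U ^^ n) (opoly p' H y) = opoly Q U y" using Suc.IH by blast
  define Q' where "Q' = monom a (Suc n) + smult (1/2) ([:1, 0, 1:] * Q)"
  have "degree Q' \<le> 2 * Suc n"
  proof -
    have "degree ([:1, 0, 1:] * Q) \<le> 2 + degree Q"
      using degree_mult_le[of "[:1, 0, 1:]" Q] by simp
    moreover have "degree (monom a (Suc n)) \<le> Suc n" by (rule degree_monom_le)
    ultimately have "degree (monom a (Suc n)) \<le> 2 * Suc n" "degree ([:1, 0, 1:] * Q) \<le> 2 * Suc n"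
      using Q(1) by simp_all
    then show ?thesis unfolding Q'_def by (intro degree_add_le order_trans[OF degree_smult_le])
  qed
  moreover have "poly Q' z = z ^ Suc n * poly p ((z + 1 / z) / 2)" if "z \<noteq> 0" for z
    using that by (simp add: Q'_def p Q(2) poly_monom field_simps)
  moreover have "(U ^^ Suc n) (opoly p H y) = opoly Q' U y" for y
  proof -
    have Un: "clinear (U ^^ n)" for n
      by (induction n) (simp_all add: clinear_iff clinearD[OF U])
    let ?w = "opoly p' H y"
    have UH: "U (H ?w) = (1/2) *\<^sub>C (U (U ?w) + ?w)"
      by (simp add: H2 clinearD[OF U] UU')
    have "(U ^^ Suc n) (opoly p H y) = a *\<^sub>C (U ^^ Suc n) y + (U ^^ n) (U (H ?w))"
      by (simp add: p opoly_pCons H clinearD[OF Un] clinearD[OF U] funpow_swap1)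
    also have "(U ^^ n) (U (H ?w)) = (1/2) *\<^sub>C (U (U ((U ^^ n) ?w)) + (U ^^ n) ?w)"
      by (simp add: UH clinearD[OF Un] funpow_swap1)
    also have "a *\<^sub>C (U ^^ Suc n) y + \<dots> = opoly Q' U y"
      by (simp add: Q'_def opoly_add opoly_smult opoly_monom[OF U] Q(3) opoly_pCons[OF U] clinearD[OF U] opoly_swap[OF U]
          scaleC_add_right del: funpow.simps mult_pCons_left add: opoly_mult[OF U] add.commute)
    finally show ?thesis .
  qed
  ultimately show ?case by blast
qed

text \<open>Sum the at most \<open>2n + 1\<close> terms of the Laurent polynomial: powers of \<open>U\<close> are isometric and each coefficient is
bounded by the supremum on the circle, which is a supremum over \<open>[-1,1]\<close>.\<close>

lemma norm_opoly_le_degree: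
  fixes H U U' :: "'v::complex_normed_vector \<Rightarrow> 'v"
  assumes U: "clinear U" and H: "clinear H"
    and UU': "\<And>y. U (U' y) = y" and H2: "\<And>y. H y = (1/2) *\<^sub>C (U y + U' y)"
    and iso: "\<And>y. norm (U y) = norm y"
    and M: "\<And>t. \<bar>t\<bar> \<le> 1 \<Longrightarrow> cmod (poly p (complex_of_real t)) \<le> M"
  shows "norm (opoly p H y) \<le> (2 * real (degree p) + 1) * M * norm y"
proof -
  obtain Q where Q: "degree Q \<le> 2 * degree p"
      "\<And>z. z \<noteq> 0 \<Longrightarrow> poly Q z = z ^ degree p * poly p ((z + 1 / z) / 2)"
      "\<And>y. (U ^^ degree p) (opoly p H y) = opoly Q U y"
    using opoly_laurent[OF U H UU' H2 order_refl] by blast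
  have isoN: "norm ((U ^^ n) y) = norm y" for n y by (induction n) (simp_all add: iso)
  have circle: "cmod (poly Q z) \<le> M" if z: "cmod z = 1" for z
  proof -
    have z0: "z \<noteq> 0" using z by auto
    have "1 / z = cnj z" using z by (simp add: divide_conv_cnj)
    then have "(z + 1 / z) / 2 = complex_of_real (Re z)" by (simp add: complex_eq_iff)
    moreover have "\<bar>Re z\<bar> \<le> 1" using abs_Re_le_cmod[of z] z by simp
    ultimately show ?thesis using M by (simp add: Q(2)[OF z0] norm_mult norm_power z)
  qed
  have M0: "0 \<le> M" using order_trans[OF norm_ge_zero M[of 0]] by simp
  have "norm (opoly p H y) = norm (opoly Q U y)" by (simp add: Q(3)[symmetric] isoN)
  also have "\<dots> \<le> (\<Sum>k\<le>degree Q. norm (coeff Q k *\<^sub>C (U ^^ k) y))"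
    unfolding opoly_def by (rule norm_sum)
  also have "\<dots> \<le> (\<Sum>k\<le>degree Q. M * norm y)"
    by (intro sum_mono) (simp add: norm_scaleC isoN mult_right_mono norm_coeff_le_circle circle)
  also have "\<dots> = (degree Q + 1) * (M * norm y)" by (simp add: algebra_simps)
  also have "\<dots> \<le> (2 * real (degree p) + 1) * (M * norm y)"
    using Q(1) M0 by (intro mult_right_mono) auto
  finally show ?thesis by (simp only: mult.assoc)
qed

lemma le_if_powers_le_linear:
  fixes a M C :: real
  assumes a: "a \<ge> 0" and M: "M \<ge> 0" 
    and le: "\<And>m. a ^ (2 ^ m) \<le> (C * 2 ^ m + 1) * M ^ (2 ^ m)"
  shows "a \<le> M"
proof (rule ccontr)
  assume "\<not> a \<le> M"
  then have aM: "M < a" "0 < a" using M by auto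
  define x where "x = M / a"
  have x: "0 \<le> x" "x < 1" using aM M by (auto simp: x_def)
  have "(\<lambda>n. C * (real n * x ^ n) + x ^ n) \<longlonglongrightarrow> C * 0 + 0"
    using x by (intro tendsto_intros powser_times_n_limit_0 LIMSEQ_realpow_zero) auto
  then have "\<forall>\<^sub>F n in sequentially. C * (real n * x ^ n) + x ^ n < 1"
    by (intro order_tendstoD(2)) auto
  moreover have "filterlim (\<lambda>m. 2 ^ m :: nat) sequentially sequentially"
    by (rule filterlim_subseq) (simp add: strict_mono_def)
  ultimately have "\<forall>\<^sub>F m in sequentially. C * (real (2 ^ m) * x ^ (2 ^ m)) + x ^ (2 ^ m) < 1"
    by (rule eventually_compose_filterlim)
  then obtain m where "C * (real (2 ^ m) * x ^ (2 ^ m)) + x ^ (2 ^ m) < 1"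
    using eventually_happens'[OF sequentially_bot] by blast
  moreover have "1 \<le> (C * 2 ^ m + 1) * x ^ (2 ^ m)"
    using le[of m] aM by (simp add: x_def power_divide field_simps)
  ultimately show False by (simp add: algebra_simps)
qed

text \<open>A symmetric operator for the algebra-valued inner product \<open>x\<^sup>* y\<close> behaves like a self-adjoint operator on a
Hilbert space.\<close>

lemma symmetric_onorm_square:
  fixes P :: "'a::cstar_algebra \<Rightarrow> 'a"
  assumes P: "bounded_linear P" and sym: "\<And>x y. star (P x) * y = star x * P y"
  shows "(onorm P)\<^sup>2 \<le> onorm (\<lambda>y. P (P y))"
proof -
  let ?K = "onorm (\<lambda>y. P (P y))"
  have PP: "bounded_linear (\<lambda>y. P (P y))" using P by (rule bounded_linear_compose[OF P])
  have K0: "0 \<le> ?K" by (rule onorm_pos_le[OF PP])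
  have "norm (P y) \<le> sqrt ?K * norm y" for y
  proof (rule power2_le_imp_le)
    have "(norm (P y))\<^sup>2 = norm (star y * P (P y))" by (simp add: cstar_identity[symmetric] sym)
    also have "\<dots> \<le> norm y * norm (P (P y))" using norm_mult_ineq[of "star y" "P (P y)"] by simp
    also have "\<dots> \<le> norm y * (?K * norm y)" by (intro mult_left_mono onorm[OF PP]) simp
    finally show "(norm (P y))\<^sup>2 \<le> (sqrt ?K * norm y)\<^sup>2"
      using K0 by (simp add: power_mult_distrib power2_eq_square mult_ac)
  qed (use K0 in simp)
  then have "onorm P \<le> sqrt ?K" using K0 by (intro onorm_bound) auto
  then have "(onorm P)\<^sup>2 \<le> (sqrt ?K)\<^sup>2" by (intro power_mono onorm_pos_le[OF P])
  then show ?thesis using K0 by simp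
qed

lemma symmetric_onorm_power:
  fixes P :: "'a::cstar_algebra \<Rightarrow> 'a"
  assumes "bounded_linear P" and "\<And>x y. star (P x) * y = star x * P y"
  shows "onorm P ^ (2 ^ m) \<le> onorm (P ^^ (2 ^ m))"
  using assms
proof (induction m arbitrary: P)
  case (Suc m)
  let ?P2 = "\<lambda>y. P (P y)"
  have "onorm P ^ (2 ^ Suc m) = ((onorm P)\<^sup>2) ^ (2 ^ m)" by (simp add: power_mult)
  also have "\<dots> \<le> onorm ?P2 ^ (2 ^ m)"
    by (intro power_mono symmetric_onorm_square Suc.prems) simp
  also have "\<dots> \<le> onorm (?P2 ^^ (2 ^ m))"
    by (rule Suc.IH) (simp_all add: bounded_linear_compose Suc.prems)
  also have "?P2 ^^ (2 ^ m) = P ^^ (2 ^ Suc m)"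
  proof -
    have "?P2 = P ^^ 2" by (simp add: fun_eq_iff numeral_2_eq_2)
    then show ?thesis by (simp add: funpow_mult mult.commute)
  qed
  finally show ?case .
qed simp

text \<open>The element \<open>1 + v\<close> of the unitization is the square root of \<open>1 - h\<^sup>2\<close>. The equation for \<open>v\<close> is the fixed point
equation of \<open>v \<mapsto> - (h\<^sup>2 + v\<^sup>2)/2\<close>, a contraction of the ball of radius 1/2. Working with \<open>v\<close> avoids a unit.\<close>

lemma sqrt_defect_exists:
  fixes h :: "'a::cstar_algebra"
  assumes h: "star h = h" and n: "norm h \<le> 1/2"
  shows "\<exists>v. star v = v \<and> h * v = v * h \<and> v + v + v * v + h * h = 0"
proof -
  define F where "F v = - ((1/2::real) *\<^sub>R (h * h + v * v))" for v
  define s where "s = {v. norm v \<le> 1/2 \<and> star v = v \<and> h * v = v * h}"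
  have cs: "continuous_on UNIV (star :: 'a \<Rightarrow> 'a)"
    using bounded_linear_star by (rule linear_continuous_on)
  have sq: "norm (x * y) \<le> 1/4" if "norm x \<le> 1/2" "norm y \<le> 1/2" for x y :: 'a
    using mult_mono[OF that] norm_mult_ineq[of x y] by auto
  have "\<exists>!v\<in>s. F v = v"
  proof (rule Banach_fix)
    have "closed s"
    proof -
      have "s = {v. norm v \<le> 1/2} \<inter> {v. star v = v} \<inter> {v. h * v = v * h}" by (auto simp: s_def)
      then show ?thesis
        using cs by (auto intro!: closed_Int closed_Collect_le closed_Collect_eq continuous_intros)
    qed
    then show "complete s" by (simp add: complete_eq_closed)
    show "s \<noteq> {}" by (auto simp: s_def intro!: exI[of _ 0])
    show "F ` s \<subseteq> s"
    proof safe
      fix v assume v: "v \<in> s"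
      have "norm (h * h + v * v) \<le> 1/4 + 1/4"
        using v n by (intro norm_triangle_le add_mono sq) (auto simp: s_def)
      then have 1: "norm (F v) \<le> 1/2" by (simp add: F_def)
      have vh: "h * v = v * h" using v by (simp add: s_def)
      then have "h * (v * v) = v * v * h" by (metis mult.assoc)
      then have 2: "h * F v = F v * h"
        by (simp add: F_def algebra_simps)
      have "star (F v) = F v"
        using v h by (simp add: F_def star_minus star_scaleR star_add star_mult s_def)
      with 1 2 show "F v \<in> s" by (simp add: s_def)
    qed
    show "dist (F v) (F w) \<le> 1/2 * dist v w" if v: "v \<in> s" and w: "w \<in> s" for v w
    proof -
      have "F v - F w = - ((1/2::real) *\<^sub>R (v * (v - w) + (v - w) * w))"
        by (simp add: F_def algebra_simps)
      then have "norm (F v - F w) = 1/2 * norm (v * (v - w) + (v - w) * w)" by simp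
      also have "\<dots> \<le> 1/2 * (norm v * norm (v - w) + norm (v - w) * norm w)"
        by (intro mult_left_mono norm_triangle_le add_mono norm_mult_ineq) simp
      also have "\<dots> \<le> 1/2 * (1/2 * norm (v - w) + norm (v - w) * (1/2))"
        using v w by (intro mult_left_mono add_mono mult_right_mono) (auto simp: s_def)
      finally show ?thesis by (simp add: dist_norm)
    qed
  qed auto
  then obtain v where v: "v \<in> s" "F v = v" by blast
  have "v + v = 2 *\<^sub>R F v" using v(2) by (simp add: scaleR_2)
  then have "v + v = - (h * h + v * v)" by (simp add: F_def)
  then have "v + v + v * v + h * h = 0" by (simp add: algebra_simps)
  with v(1) show ?thesis by (auto simp: s_def)
qed

lemma clinear_left_mult: "clinear (\<lambda>y. a * (y :: 'a::complex_banach_algebra))"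
  by (simp add: clinear_iff distrib_left mult_scaleC_right)

text \<open>\<open>U\<close> is left multiplication by \<open>h + \<i> (1 - h\<^sup>2)\<^sup>1\<^sup>/\<^sup>2\<close>, a unitary of the unitization, and \<open>U'\<close> is left
multiplication by its adjoint.\<close>

lemma unitary_dilation:
  fixes h :: "'a::cstar_algebra"
  assumes h: "star h = h" and n: "norm h \<le> 1/2"
  shows "\<exists>U U'. clinear U \<and> (\<forall>y. U (U' y) = y) \<and> (\<forall>y. h * y = (1/2) *\<^sub>C (U y + U' y)) \<and>
     (\<forall>y. norm (U y) = norm y)"
proof -
  obtain v where v: "star v = v" "h * v = v * h" "v + v + v * v + h * h = 0"
    using sqrt_defect_exists[OF assms] by blast
  have hv: "h * (v * y) = v * (h * y)" for y using v(2) by (metis mult.assoc)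
  have v3: "v * y + v * y + v * (v * y) + h * (h * y) = 0" for y
    using arg_cong[OF v(3), of "\<lambda>x. x * y"] by (simp add: distrib_right mult.assoc)
  define U where "U y = h * y + \<i> *\<^sub>C (y + v * y)" for y
  define U' where "U' y = h * y - \<i> *\<^sub>C (y + v * y)" for y
  have lin: "clinear U"
    by (simp add: clinear_iff U_def algebra_simps scaleC_add_right mult_scaleC_right scaleC_scaleC)
  have ii: "\<i> *\<^sub>C \<i> *\<^sub>C x = - x" for x :: 'a
    using scaleC_minus_left[of 1 x] by (simp add: scaleC_scaleC)
  have UU': "U (U' y) = y" for y
  proof -
    have "U (U' y) = y + (v * y + v * y + v * (v * y) + h * (h * y))"
      by (simp add: U_def U'_def algebra_simps scaleC_add_right scaleC_diff_right mult_scaleC_right ii hv)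
    then show ?thesis by (simp add: v3)
  qed
  have U'U: "U' (U y) = y" for y
  proof -
    have "U' (U y) = y + (v * y + v * y + v * (v * y) + h * (h * y))"
      by (simp add: U_def U'_def algebra_simps scaleC_add_right scaleC_diff_right mult_scaleC_right ii hv)
    then show ?thesis by (simp add: v3)
  qed
  have half: "(1/2) *\<^sub>C (x + x) = x" for x :: 'a
  proof -
    have "(1/2) *\<^sub>C (x + x) = (1/2 + 1/2) *\<^sub>C x"
      by (simp only: scaleC_add_left scaleC_add_right)
    then show ?thesis by simp
  qed
  have sum: "h * y = (1/2) *\<^sub>C (U y + U' y)" for y
    using half[of "h * y"] by (simp add: U_def U'_def)
  have adj: "star (U y) * z = star y * U' z" for y z
    by (simp add: U_def U'_def star_add star_scaleC star_mult h v(1) algebra_simps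
        scaleC_minus_left mult_scaleC_left mult_scaleC_right scaleC_add_right)
  have "norm (U y) = norm y" for y
  proof -
    have "(norm (U y))\<^sup>2 = (norm y)\<^sup>2"
      by (simp add: cstar_identity[symmetric] adj U'U)
    then show ?thesis by simp
  qed
  with lin UU' sum show ?thesis by blast
qed

lemma bounded_linear_opoly:
  assumes "bounded_clinear f"
  shows "bounded_linear (opoly p f)"
proof (induction p)
  case (pCons a p)
  have sc: "bounded_linear (\<lambda>y::'a. c *\<^sub>C y)" for c
    by (rule bounded_linear_intro[where K = "cmod c"])
      (simp_all add: scaleC_add_right scaleR_scaleC scaleC_scaleC norm_scaleC mult.commute)
  have "opoly (pCons a p) f = (\<lambda>y. a *\<^sub>C y + f (opoly p f y))"
    using opoly_pCons[OF bounded_clinear_clinear[OF assms]] by blast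
  then show ?case
    using bounded_linear_add[OF sc bounded_linear_compose[OF bounded_clinear_bounded_linear[OF assms] pCons.IH]] by simp
qed (simp add: opoly_def[abs_def] bounded_linear_zero)

lemma bounded_clinear_left_mult: "bounded_clinear (\<lambda>y. a * (y :: 'a::complex_banach_algebra))"
  by (simp add: bounded_clinear_iff bounded_linear_mult_right mult_scaleC_right)

lemma opoly_symmetric:
  fixes h :: "'a::cstar_algebra"
  assumes h: "star h = h" and real: "\<And>k. coeff p k \<in> \<real>"
  shows "star (opoly p ((*) h) x) * y = star x * opoly p ((*) h) y"
  using real
proof (induction p arbitrary: x y)
  case (pCons a p)
  have a: "cnj a = a" using pCons.prems[of 0] by (simp add: Reals_cnj_iff)
  have p: "coeff p k \<in> \<real>" for k using pCons.prems[of "Suc k"] by simp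
  have "star (opoly p ((*) h) x) * (h * y) = star x * (h * opoly p ((*) h) y)"
    using pCons.IH[OF p] by (simp add: opoly_swap clinear_left_mult)
  then show ?case
    by (simp add: opoly_pCons clinear_left_mult star_add star_scaleC star_mult h a distrib_left distrib_right
        mult_scaleC_left mult_scaleC_right mult.assoc)
qed simp

text \<open>The estimate \<open>norm_opoly_le_degree\<close> loses a factor that is linear in the degree. For the power with exponent
\<open>N = 2 ^ m\<close> of the polynomial it loses only a factor linear in \<open>N\<close>, while symmetric operators satisfy
\<open>onorm P ^ N \<le> onorm (P ^^ N)\<close>; extracting \<open>N\<close>-th roots, the factor disappears in the limit.\<close>

theorem norm_opoly_le:
  fixes h :: "'a::cstar_algebra"
  assumes h: "star h = h" "norm h \<le> 1/2" and real: "\<And>k. coeff p k \<in> \<real>"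
    and M: "\<And>t. \<bar>t\<bar> \<le> 1 \<Longrightarrow> cmod (poly p (complex_of_real t)) \<le> M"
  shows "norm (opoly p ((*) h) y) \<le> M * norm y"
proof -
  let ?H = "(*) h"
  let ?P = "opoly p ?H"
  obtain U U' where U: "clinear U" "\<And>y. U (U' y) = y" "\<And>y. h * y = (1/2) *\<^sub>C (U y + U' y)"
     "\<And>y. norm (U y) = norm y" using unitary_dilation[OF h] by blast
  have P: "bounded_linear ?P" by (rule bounded_linear_opoly[OF bounded_clinear_left_mult])
  have M0: "0 \<le> M" using order_trans[OF norm_ge_zero M[of 0]] by simp
  have pow: "opoly (p ^ k) ?H = ?P ^^ k" for k
    by (induction k) (simp_all add: fun_eq_iff opoly_mult clinear_left_mult opoly_def[of 1])
  have "onorm ?P \<le> M"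
  proof (rule le_if_powers_le_linear[where C = "2 * real (degree p)"])
    fix m :: nat
    let ?N = "2 ^ m :: nat"
    have "onorm ?P ^ ?N \<le> onorm (?P ^^ ?N)"
      by (rule symmetric_onorm_power[OF P opoly_symmetric[OF h(1) real]])
    also have "\<dots> \<le> (2 * real (degree p) * 2 ^ m + 1) * M ^ ?N"
    proof (rule onorm_bound)
      fix y
      have "norm (opoly (p ^ ?N) ?H y) \<le> (2 * real (degree (p ^ ?N)) + 1) * M ^ ?N * norm y"
        by (rule norm_opoly_le_degree[OF U(1) clinear_left_mult U(2,3,4)])
          (simp_all add: norm_power power_mono M)
      also have "\<dots> \<le> (2 * real (degree p) * 2 ^ m + 1) * M ^ ?N * norm y"
      proof (intro mult_right_mono)
        have "real (degree (p ^ ?N)) \<le> real (degree p * ?N)" using degree_power_le[of p ?N] by (simp only: of_nat_le_iff)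
        then show "2 * real (degree (p ^ ?N)) + 1 \<le> 2 * real (degree p) * 2 ^ m + 1" by simp
      qed (use M0 in auto)
      finally show "norm ((?P ^^ ?N) y) \<le> (2 * real (degree p) * 2 ^ m + 1) * M ^ ?N * norm y"
        by (simp add: pow)
    qed (use M0 in simp)
    finally show "onorm ?P ^ (2 ^ m) \<le> (2 * real (degree p) * 2 ^ m + 1) * M ^ (2 ^ m)" by simp
  qed (use M0 onorm_pos_le[OF P] in auto)
  then have "onorm ?P * norm y \<le> M * norm y" by (intro mult_right_mono) auto
  then show ?thesis using onorm[OF P, of y] by simp
qed

section \<open>Approximate identities\<close>

lemma opoly_left_mult:
  fixes h :: "'a::complex_banach_algebra"
  shows "opoly p ((*) h) x * y = opoly p ((*) h) (x * y)"
  by (induction p) (simp_all add: opoly_pCons clinear_left_mult distrib_right mult_scaleC_left mult.assoc)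

lemma coeff_mult_Reals:
  fixes p q :: "complex poly"
  assumes "\<And>k. coeff p k \<in> \<real>" "\<And>k. coeff q k \<in> \<real>"
  shows "coeff (p * q) k \<in> \<real>"
  unfolding coeff_mult by (intro sum_in_Reals Reals_mult assms)

text \<open>\<open>(1 - t\<^sup>2)\<^sup>n\<close> is the polynomial that becomes the operator \<open>1 - e\<close> in \<open>right_unit_for_element\<close>; multiplied by
\<open>t\<close> it is uniformly small on \<open>[-1,1]\<close>.\<close>

lemma small_cutoff:
  fixes \<delta> :: real
  assumes "\<delta> > 0"
  shows "\<exists>n. \<forall>t. \<bar>t\<bar> \<le> 1 \<longrightarrow> \<bar>t\<bar> * (1 - t\<^sup>2) ^ n \<le> \<delta>"
proof (cases "\<delta> < 1")
  case False
  then show ?thesis by (intro exI[of _ 0]) auto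
next
  case True
  have "\<delta>\<^sup>2 < 1" "0 < \<delta>\<^sup>2" using True assms by (auto simp: power_less_one_iff)
  then obtain n where n: "(1 - \<delta>\<^sup>2) ^ n < \<delta>" using real_arch_pow_inv[OF assms, of "1 - \<delta>\<^sup>2"] by auto
  have "\<bar>t\<bar> * (1 - t\<^sup>2) ^ n \<le> \<delta>" if t: "\<bar>t\<bar> \<le> 1" for t :: real
  proof -
    have t2: "0 \<le> 1 - t\<^sup>2" "1 - t\<^sup>2 \<le> 1" using t by (auto simp: abs_square_le_1)
    show ?thesis
    proof (cases "\<bar>t\<bar> \<le> \<delta>")
      case True
      have "\<bar>t\<bar> * (1 - t\<^sup>2) ^ n \<le> \<bar>t\<bar> * 1" using t2 by (intro mult_left_mono power_le_one) auto
      then show ?thesis using True by simp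
    next
      case False
      then have "\<delta>\<^sup>2 \<le> t\<^sup>2" using assms by (metis abs_le_square_iff abs_of_pos le_less not_le)
      then have "(1 - t\<^sup>2) ^ n \<le> (1 - \<delta>\<^sup>2) ^ n" using t2 by (intro power_mono) auto
      then have "\<bar>t\<bar> * (1 - t\<^sup>2) ^ n \<le> 1 * \<delta>" using t t2 n by (intro mult_mono) auto
      then show ?thesis by simp
    qed
  qed
  then show ?thesis by blast
qed

text \<open>In the unitization, \<open>1 - e\<close> has norm at most 1 as a left multiplier; taking adjoints, it has norm at most 1 as a
right multiplier.\<close>

lemma right_contraction:
  fixes e :: "'a::cstar_algebra"
  assumes "\<And>y. norm (y - e * y) \<le> norm y"
  shows "norm (x - x * e) \<le> norm x"
proof -
  define z where "z = x - x * e"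
  have "z * star z = x * (star z - e * star z)"
    by (simp add: z_def algebra_simps)
  then have "(norm z)\<^sup>2 \<le> norm x * norm (star z - e * star z)"
    using norm_mult_ineq[of x "star z - e * star z"] by (simp add: cstar_identity'[symmetric])
  also have "\<dots> \<le> norm x * norm z" using assms[of "star z"] by (intro mult_left_mono) auto
  finally show ?thesis by (cases "z = 0") (auto simp: power2_eq_square z_def)
qed

lemma star_contraction:
  fixes e :: "'a::cstar_algebra"
  assumes "\<And>y. norm (y - e * y) \<le> norm y"
  shows "norm (y - star e * y) \<le> norm y"
proof -
  have "star (y - star e * y) = star y - star y * e" by (simp add: star_diff star_mult star_star)
  then have "norm (y - star e * y) = norm (star y - star y * e)" by (metis norm_star)
  then show ?thesis using right_contraction[OF assms, of "star y"] by simp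
qed

lemma norm_le_2_if_contraction:
  fixes e :: "'a::cstar_algebra"
  assumes "\<And>y. norm (y - e * y) \<le> norm y"
  shows "norm e \<le> 2"
proof (rule norm_le_if_left_mult_le)
  fix y
  have "norm (e * y) \<le> norm y + norm (y - e * y)" using norm_triangle_ineq4[of y "y - e * y"] by simp
  then show "norm (e * y) \<le> 2 * norm y" using assms[of y] by simp
qed simp

text \<open>Take \<open>1 - e = (1 - h\<^sup>2)\<^sup>n\<close> for a small multiple \<open>h\<close> of \<open>a\<^sup>* a\<close>: then the square of the norm of
\<open>a - a e\<close> is that of \<open>(1 - e)\<^sup>* a\<^sup>* a (1 - e)\<close>, which is controlled by \<open>t (1 - t\<^sup>2)\<^sup>n\<close>. As \<open>h\<close> is only known to
be self-adjoint, the cutoff has to be bounded on all of \<open>[-1,1]\<close>, whence the square. That \<open>e\<close> is a right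
multiple of \<open>a\<^sup>* a\<close> matters for \<open>approximate_cubic_factorization\<close>.\<close>

lemma right_unit_for_element:
  fixes a :: "'a::cstar_algebra"
  assumes "\<epsilon> > 0"
  shows "\<exists>k. (\<forall>y. norm (y - star a * a * k * y) \<le> norm y) \<and> norm (a - a * (star a * a * k)) < \<epsilon>"
proof -
  define s where "s = 2 * (norm a)\<^sup>2 + 1"
  have s: "s > 0" by (simp add: s_def add_nonneg_pos)
  define h where "h = (1 / s) *\<^sub>R (star a * a)"
  have sh: "s *\<^sub>R h = star a * a" using s by (simp add: h_def)
  have h: "star h = h" by (simp add: h_def star_scaleR star_mult star_star)
  have "norm h = (norm a)\<^sup>2 / s" using s by (simp add: h_def cstar_identity)
  also have "\<dots> \<le> 1/2" using s by (simp add: s_def field_simps)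
  finally have nh: "norm h \<le> 1/2" .
  \<comment> \<open>Any bound with \<open>s * \<delta> < \<epsilon>\<^sup>2\<close> will do.\<close>
  define \<delta> where "\<delta> = \<epsilon>\<^sup>2 / (4 * s)"
  have \<delta>: "\<delta> > 0" using s assms by (simp add: \<delta>_def)
  obtain n where n: "\<And>t. \<bar>t\<bar> \<le> 1 \<Longrightarrow> \<bar>t\<bar> * (1 - t\<^sup>2) ^ n \<le> \<delta>" using small_cutoff[OF \<delta>] by blast
  define p :: "complex poly" where "p = [:1, 0, -1:] ^ n"
  have "\<exists>g. [:1, 0, -1:] ^ n + [:0, 0, 1:] * g = (1 :: complex poly)" for n
  proof (induction n)
    case (Suc n)
    then obtain g where g: "[:1, 0, -1:] ^ n + [:0, 0, 1:] * g = (1 :: complex poly)" by blast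
    have split: "[:1, 0, -1:] = (1 :: complex poly) - [:0, 0, 1:]" by (simp add: one_pCons)
    have "[:1, 0, -1:] ^ Suc n + [:0, 0, 1:] * ([:1, 0, -1:] ^ n + g)
        = [:1, 0, -1:] ^ n + [:0, 0, 1:] * g"
      unfolding power_Suc by (subst (1) split) (simp only: left_diff_distrib distrib_left mult_1_left diff_add_cancel add.assoc[symmetric])
    then show ?case using g by metis
  qed (auto intro!: exI[of _ 0])
  then obtain g where g: "p + [:0, 0, 1:] * g = 1" unfolding p_def by blast
  have realp: "coeff p k \<in> \<real>" for k
    unfolding p_def
  proof (induction n arbitrary: k)
    case (Suc n)
    have "coeff [:1, 0, -1 :: complex:] k \<in> \<real>" for k
      by (auto simp: coeff_pCons split: nat.splits)
    from coeff_mult_Reals[OF this Suc] show ?case by simp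
  qed (simp add: coeff_pCons one_pCons split: nat.splits)
  have ppoly: "poly p (complex_of_real t) = complex_of_real ((1 - t\<^sup>2) ^ n)" for t
    by (simp add: p_def power2_eq_square)
  let ?H = "(*) h"
  define k where "k = opoly g ?H h"
  define e where "e = h * k"
  have lin: "clinear ?H" by (rule clinear_left_mult)
  have ey: "e * y = h * (h * opoly g ?H y)" for y
    by (simp add: e_def k_def mult.assoc opoly_left_mult opoly_swap[OF lin])
  have pe: "opoly p ?H y + e * y = y" for y
  proof -
    have "opoly p ?H y + e * y = opoly (p + [:0, 0, 1:] * g) ?H y"
      unfolding opoly_add opoly_mult[OF lin] ey by (simp add: opoly_pCons[OF lin])
    then show ?thesis unfolding g by (simp add: opoly_def)
  qed
  then have pe': "opoly p ?H y = y - e * y" for y by (metis eq_diff_eq)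
  have bound1: "norm (y - e * y) \<le> norm y" for y
  proof -
    have "norm (opoly p ?H y) \<le> 1 * norm y"
    proof (rule norm_opoly_le[OF h nh realp])
      fix t :: real assume "\<bar>t\<bar> \<le> 1"
      then have "0 \<le> 1 - t\<^sup>2" "1 - t\<^sup>2 \<le> 1" by (auto simp: abs_square_le_1)
      then show "cmod (poly p (complex_of_real t)) \<le> 1"
        unfolding ppoly norm_of_real by (simp add: power_le_one)
    qed
    then show ?thesis by (simp add: pe')
  qed
  define z where "z = h - h * e"
  have he: "h * e = e * h" unfolding ey by (simp add: e_def k_def)
  have "norm z \<le> \<delta>"
  proof (rule norm_le_if_left_mult_le)
    fix y
    have "z = opoly p ?H h" by (simp add: z_def he pe')
    then have "z * y = opoly (p * [:0, 1:]) ?H y"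
      unfolding opoly_mult[OF lin] by (simp add: opoly_left_mult opoly_pCons[OF lin])
    also have "norm \<dots> \<le> \<delta> * norm y"
    proof (rule norm_opoly_le[OF h nh])
      have "coeff [:0, 1 :: complex:] k \<in> \<real>" for k by (auto simp: coeff_pCons split: nat.splits)
      then show "coeff (p * [:0, 1:]) k \<in> \<real>" for k by (intro coeff_mult_Reals realp)
      fix t :: real assume t: "\<bar>t\<bar> \<le> 1"
      then have "0 \<le> 1 - t\<^sup>2" by (auto simp: abs_square_le_1)
      then have "cmod (poly (p * [:0, 1:]) (complex_of_real t)) = \<bar>t\<bar> * (1 - t\<^sup>2) ^ n"
        unfolding poly_mult ppoly norm_mult norm_of_real by (simp add: power_abs mult.commute)
      then show "cmod (poly (p * [:0, 1:]) (complex_of_real t)) \<le> \<delta>" using n[OF t] by simp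
    qed
    finally show "norm (z * y) \<le> \<delta> * norm y" .
  qed (use \<delta> in simp)
  have aa: "star a * a - star a * a * e = s *\<^sub>R z" by (simp add: z_def scaleR_diff_right sh[symmetric])
  have "star (a - a * e) * (a - a * e) = (star a * a - star a * a * e) - star e * (star a * a - star a * a * e)"
    by (simp add: star_diff star_mult algebra_simps)
  then have "(norm (a - a * e))\<^sup>2 = norm (s *\<^sub>R z - star e * (s *\<^sub>R z))"
    unfolding cstar_identity[symmetric] aa by simp
  also have "\<dots> \<le> norm (s *\<^sub>R z)" by (rule star_contraction[OF bound1])
  also have "\<dots> = s * norm z" using s by simp
  also have "\<dots> \<le> s * \<delta>" using s \<open>norm z \<le> \<delta>\<close> by (intro mult_left_mono) auto
  also have "\<dots> < \<epsilon>\<^sup>2" using s assms by (simp add: \<delta>_def)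
  finally have "norm (a - a * e) < \<epsilon>" using assms by (simp add: power_less_imp_less_base)
  moreover have "e = star a * a * ((1 / s) *\<^sub>R k)" by (simp add: e_def h_def)
  ultimately show ?thesis using bound1 by (intro exI[of _ "(1 / s) *\<^sub>R k"]) simp
qed

text \<open>Units are combined by \<open>1 - u = (1 - f)(1 - g)\<close>, where \<open>g\<close> serves the new element \<open>a (1 - f)\<close>; the product is again a
contraction, so the elements treated before are not spoilt.\<close>

lemma right_unit_for_finite_set:
  fixes F :: "'a::cstar_algebra set"
  assumes "finite F" and "\<epsilon> > 0"
  shows "\<exists>f. (\<forall>y. norm (y - f * y) \<le> norm y) \<and> (\<forall>a\<in>F. norm (a - a * f) < \<epsilon>)"
  using assms(1)
proof (induction F rule: finite_induct)
  case empty
  then show ?case by (intro exI[of _ 0]) simp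
next
  case (insert a F)
  then obtain f where f: "\<And>y. norm (y - f * y) \<le> norm y" "\<And>b. b \<in> F \<Longrightarrow> norm (b - b * f) < \<epsilon>"
    by blast
  obtain g where g: "\<And>y. norm (y - g * y) \<le> norm y" "norm ((a - a * f) - (a - a * f) * g) < \<epsilon>"
    using right_unit_for_element[OF assms(2), of "a - a * f"] by blast
  let ?u = "f + g - f * g"
  have 1: "norm (y - ?u * y) \<le> norm y" for y
  proof -
    have eq: "y - ?u * y = (y - g * y) - f * (y - g * y)" by (simp add: algebra_simps)
    show ?thesis unfolding eq by (rule order_trans[OF f(1) g(1)])
  qed
  have split: "b - b * ?u = (b - b * f) - (b - b * f) * g" for b by (simp add: algebra_simps)
  have "norm (b - b * ?u) < \<epsilon>" if "b \<in> F" for b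
    using right_contraction[OF g(1), of "b - b * f"] f(2)[OF that] unfolding split by simp
  moreover have "norm (a - a * ?u) < \<epsilon>" using g(2) unfolding split .
  ultimately show ?case using 1 by (intro exI[of _ ?u]) simp
qed

text \<open>\<open>1 - e = (1 - f)(1 - f)\<^sup>*\<close> with a right unit \<open>f\<close> for the finite set and its adjoints.\<close>

lemma selfadjoint_unit_for_finite_set:
  fixes F :: "'a::cstar_algebra set"
  assumes "finite F" and "\<epsilon> > 0"
  shows "\<exists>e. star e = e \<and> norm e \<le> 2 \<and> (\<forall>a\<in>F. norm (a - a * e) < \<epsilon> \<and> norm (a - e * a) < \<epsilon>)"
proof -
  obtain f where f: "\<And>y. norm (y - f * y) \<le> norm y"
    "\<And>a. a \<in> F \<union> star ` F \<Longrightarrow> norm (a - a * f) < \<epsilon>"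
    using right_unit_for_finite_set[of "F \<union> star ` F" \<epsilon>] assms by auto
  let ?e = "f + star f - f * star f"
  have e: "star ?e = ?e" by (simp add: star_add star_diff star_mult star_star)
  have "norm (y - ?e * y) \<le> norm y" for y
  proof -
    have eq: "y - ?e * y = (y - star f * y) - f * (y - star f * y)" by (simp add: algebra_simps)
    show ?thesis unfolding eq by (rule order_trans[OF f(1) star_contraction[OF f(1)]])
  qed
  then have "norm ?e \<le> 2" by (rule norm_le_2_if_contraction)
  moreover have right: "norm (a - a * ?e) < \<epsilon>" if "a \<in> F \<union> star ` F" for a
  proof -
    have eq: "a - a * ?e = (a - a * f) - (a - a * f) * star f" by (simp add: algebra_simps)
    show ?thesis unfolding eq
      by (rule le_less_trans[OF right_contraction[OF star_contraction[OF f(1)]] f(2)[OF that]])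
  qed
  moreover have "norm (a - ?e * a) < \<epsilon>" if "a \<in> F" for a
  proof -
    have "star (a - ?e * a) = star a - star a * ?e"
      unfolding star_diff[of a] star_mult[of ?e] e ..
    then have "norm (a - ?e * a) = norm (star a - star a * ?e)" by (metis norm_star)
    then show ?thesis using right[of "star a"] that by simp
  qed
  ultimately show ?thesis using e by (intro exI[of _ ?e]) auto
qed

text \<open>A filter on the algebra takes the place of a net; the limits below are limits along it.\<close>

definition approximate_identity :: "'a::cstar_algebra filter \<Rightarrow> bool" where
  "approximate_identity F \<longleftrightarrow> F \<noteq> bot \<and> (\<forall>\<^sub>F e in F. star e = e) \<and> (\<forall>\<^sub>F e in F. norm e \<le> 2) \<and>
     (\<forall>a. ((\<lambda>e. a * e) \<longlongrightarrow> a) F \<and> ((\<lambda>e. e * a) \<longlongrightarrow> a) F)"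

theorem approximate_identity_exists: "\<exists>F :: 'a::cstar_algebra filter. approximate_identity F"
proof -
  \<comment> \<open>The filter is generated by the sets of self-adjoint units for one element up to a given error.\<close>
  define E where "E = (\<lambda>(a :: 'a, \<epsilon>).
    {e. star e = e \<and> norm e \<le> 2 \<and> norm (a - a * e) < \<epsilon> \<and> norm (a - e * a) < \<epsilon>})"
  define I where "I = (UNIV :: 'a set) \<times> {0 <.. (1::real)}"
  define F where "F = (INF p\<in>I. principal (E p))"
  have ev: "\<forall>\<^sub>F e in F. e \<in> E p" if "p \<in> I" for p
    unfolding F_def by (rule eventually_INF1[OF that]) (simp add: eventually_principal)
  have "F \<noteq> bot" unfolding F_def
  proof (rule INF_filter_not_bot)
    fix X assume X: "X \<subseteq> I" "finite X"
    define \<epsilon> where "\<epsilon> = Min (insert 1 (snd ` X))"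
    have \<epsilon>: "\<epsilon> > 0" unfolding \<epsilon>_def using X by (subst Min_gr_iff) (auto simp: I_def)
    have le: "\<epsilon> \<le> snd p" if "p \<in> X" for p unfolding \<epsilon>_def using X that by (intro Min_le) auto
    obtain e where e: "star e = e" "norm e \<le> 2"
      "\<And>a. a \<in> fst ` X \<Longrightarrow> norm (a - a * e) < \<epsilon> \<and> norm (a - e * a) < \<epsilon>"
      using selfadjoint_unit_for_finite_set[of "fst ` X" \<epsilon>] X \<epsilon> by auto
    have "e \<in> E p" if "p \<in> X" for p
    proof -
      obtain a r where p: "p = (a, r)" by (cases p)
      have "a \<in> fst ` X" using that unfolding p by force
      then have "norm (a - a * e) < r" "norm (a - e * a) < r" using e(3)[of a] le[OF that] by (auto simp: p)
      then show ?thesis using e by (simp add: E_def p)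
    qed
    then have "e \<in> (\<Inter>p\<in>X. E p)" by blast
    moreover have "(INF p\<in>X. principal (E p)) = principal (\<Inter>p\<in>X. E p)"
      using X(2) by (rule INF_principal_finite)
    ultimately show "(INF p\<in>X. principal (E p)) \<noteq> bot" by (auto simp: principal_eq_bot_iff)
  qed
  moreover have "\<forall>\<^sub>F e in F. star e = e" "\<forall>\<^sub>F e in F. norm e \<le> 2"
    using ev[of "(0, 1)"] by (auto simp: I_def E_def elim!: eventually_mono)
  moreover have "((\<lambda>e. a * e) \<longlongrightarrow> a) F \<and> ((\<lambda>e. e * a) \<longlongrightarrow> a) F" for a
  proof -
    have *: "\<forall>\<^sub>F e in F. norm (a - a * e) < \<epsilon> \<and> norm (a - e * a) < \<epsilon>" if "\<epsilon> > 0" for \<epsilon>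
      using ev[of "(a, min 1 \<epsilon>)"] that by (auto simp: I_def E_def elim!: eventually_mono)
    show ?thesis
    proof (intro conjI tendstoI; subst dist_commute)
      fix \<epsilon> :: real assume "\<epsilon> > 0"
      from *[OF this] show "\<forall>\<^sub>F e in F. dist a (a * e) < \<epsilon>" "\<forall>\<^sub>F e in F. dist a (e * a) < \<epsilon>"
        by (simp_all add: dist_norm eventually_conj_iff)
    qed
  qed
  ultimately show ?thesis by (auto simp: approximate_identity_def)
qed

section \<open>Continuous functions of a self-adjoint element\<close>

definition poly_approx :: "(nat \<Rightarrow> complex poly) \<Rightarrow> (real \<Rightarrow> real) \<Rightarrow> bool" where
  "poly_approx p f \<longleftrightarrow> (\<forall>n k. coeff (p n) k \<in> \<real>) \<and>
     uniform_limit {-1..1} (\<lambda>n t. poly (p n) (complex_of_real t)) (\<lambda>t. complex_of_real (f t)) sequentially"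

lemma poly_approx_exists:
  assumes f: "continuous_on {-1..1} f"
  shows "\<exists>p. poly_approx p f"
proof -
  have "\<exists>p :: complex poly. (\<forall>k. coeff p k \<in> \<real>) \<and>
      (\<forall>t\<in>{-1..1}. cmod (poly p (complex_of_real t) - complex_of_real (f t)) < 1 / Suc n)" for n
  proof -
    obtain g where "real_polynomial_function g" and g: "\<And>t. t \<in> {-1..1} \<Longrightarrow> \<bar>f t - g t\<bar> < 1 / Suc n"
      using Stone_Weierstrass_real_polynomial_function[of "{-1..1}" f "1 / Suc n"] f by auto
    then obtain a m where ga: "g = (\<lambda>x. \<Sum>i\<le>m. a i * x ^ i)"
      unfolding real_polynomial_function_iff_sum by blast
    define p where "p = (\<Sum>i\<le>m. monom (complex_of_real (a i)) i)"
    have "coeff p k \<in> \<real>" for k by (auto simp: p_def coeff_sum)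
    moreover have "poly p (complex_of_real t) = complex_of_real (g t)" for t
      by (simp add: p_def poly_sum poly_monom ga)
    then have "cmod (poly p (complex_of_real t) - complex_of_real (f t)) = \<bar>f t - g t\<bar>" for t
      by (metis abs_minus_commute norm_of_real of_real_diff)
    ultimately show ?thesis using g by (intro exI[of _ p]) auto
  qed
  then obtain p where p: "\<And>n k. coeff (p n :: complex poly) k \<in> \<real>"
    "\<And>n t. t \<in> {-1..1} \<Longrightarrow> cmod (poly (p n) (complex_of_real t) - complex_of_real (f t)) < 1 / Suc n"
    by metis
  have "uniform_limit {-1..1} (\<lambda>n t. poly (p n) (complex_of_real t)) (\<lambda>t. complex_of_real (f t)) sequentially"
  proof (rule uniform_limitI)
    fix e :: real assume "e > 0"
    then obtain N where N: "1 / Suc N < e" using nat_approx_posE by blast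
    show "\<forall>\<^sub>F n in sequentially. \<forall>t\<in>{-1..1}. dist (poly (p n) (complex_of_real t)) (complex_of_real (f t)) < e"
      unfolding eventually_sequentially
    proof (intro exI allI impI ballI)
      fix n t assume "N \<le> n" "t \<in> {-1..1::real}"
      then have "1 / real (Suc n) \<le> 1 / Suc N" by (simp add: field_simps)
      with p(2)[of t n] N \<open>t \<in> _\<close> show "dist (poly (p n) (complex_of_real t)) (complex_of_real (f t)) < e"
        by (simp add: dist_norm)
    qed
  qed
  with p(1) show ?thesis unfolding poly_approx_def by blast
qed

lemma poly_approxD:
  assumes "poly_approx p f" and "d > 0"
  shows "\<forall>\<^sub>F n in sequentially. \<forall>t\<in>{-1..1}. cmod (poly (p n) (complex_of_real t) - complex_of_real (f t)) < d"
proof -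
  have "uniform_limit {-1..1} (\<lambda>n t. poly (p n) (complex_of_real t)) (\<lambda>t. complex_of_real (f t)) sequentially"
    using assms(1) by (simp add: poly_approx_def)
  from uniform_limitD[OF this assms(2)] show ?thesis by (simp add: dist_norm)
qed

text \<open>\<open>cfc h f y\<close> is \<open>f(h) y\<close>. The operator \<open>f(h)\<close> is a multiplier, in general not an element of the algebra,
so only its action is defined.\<close>

definition cfc :: "'a::cstar_algebra \<Rightarrow> (real \<Rightarrow> real) \<Rightarrow> 'a \<Rightarrow> 'a" where
  "cfc h f y = lim (\<lambda>n. opoly ((SOME p. poly_approx p f) n) ((*) h) y)"

lemma opoly_diff: "opoly (p - q) f y = opoly p f y - opoly q f y"
  using opoly_add[of "p - q" q f y] by simp

context
  fixes h :: "'a::cstar_algebra"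
  assumes h: "star h = h" "norm h \<le> 1/2"
begin

lemma poly_approx_bound:
  assumes "poly_approx p f" and "poly_approx q f" and "e > 0"
  shows "\<exists>N. \<forall>m\<ge>N. \<forall>n\<ge>N. \<forall>y. norm (opoly (p m) ((*) h) y - opoly (q n) ((*) h) y) \<le> e * norm y"
proof -
  have "\<forall>\<^sub>F n in sequentially. \<forall>t\<in>{-1..1}. cmod (poly (p n) (complex_of_real t) - complex_of_real (f t)) < e / 2"
    "\<forall>\<^sub>F n in sequentially. \<forall>t\<in>{-1..1}. cmod (poly (q n) (complex_of_real t) - complex_of_real (f t)) < e / 2"
    using poly_approxD[OF assms(1), of "e / 2"] poly_approxD[OF assms(2), of "e / 2"] assms(3) by simp_all
  then obtain N1 N2 where
    N: "\<And>n t. n \<ge> N1 \<Longrightarrow> t \<in> {-1..1} \<Longrightarrow> cmod (poly (p n) (complex_of_real t) - complex_of_real (f t)) < e / 2"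
      "\<And>n t. n \<ge> N2 \<Longrightarrow> t \<in> {-1..1} \<Longrightarrow> cmod (poly (q n) (complex_of_real t) - complex_of_real (f t)) < e / 2"
    unfolding eventually_sequentially by blast
  have "norm (opoly (p m) ((*) h) y - opoly (q n) ((*) h) y) \<le> e * norm y" if "m \<ge> max N1 N2" "n \<ge> max N1 N2" for m n y
  proof -
    have "norm (opoly (p m - q n) ((*) h) y) \<le> e * norm y"
    proof (rule norm_opoly_le[OF h])
      show "coeff (p m - q n) k \<in> \<real>" for k using assms by (simp add: poly_approx_def)
      fix t :: real assume "\<bar>t\<bar> \<le> 1"
      then have t: "t \<in> {-1..1}" by (auto simp: abs_le_iff)
      let ?z = "complex_of_real t"
      have "cmod (poly (p m - q n) ?z) \<le> cmod (poly (p m) ?z - complex_of_real (f t)) + cmod (poly (q n) ?z - complex_of_real (f t))"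
        using norm_triangle_ineq4[of "poly (p m) ?z - complex_of_real (f t)" "poly (q n) ?z - complex_of_real (f t)"] by simp
      then show "cmod (poly (p m - q n) ?z) \<le> e"
        using N(1)[of m, OF _ t] N(2)[of n, OF _ t] that by simp
    qed
    then show ?thesis by (simp add: opoly_diff)
  qed
  then show ?thesis by blast
qed

lemma cfc_limit:
  assumes "poly_approx p f"
  shows "(\<lambda>n. opoly (p n) ((*) h) y) \<longlonglongrightarrow> cfc h f y"
proof -
  define q where "q = (SOME p. poly_approx p f)"
  have q: "poly_approx q f" unfolding q_def by (rule someI[of "\<lambda>p. poly_approx p f", OF assms])
  have small: "\<exists>N. \<forall>m\<ge>N. \<forall>n\<ge>N. norm (opoly (r m) ((*) h) y - opoly (q n) ((*) h) y) < e" if r: "poly_approx r f" and e: "e > 0" for r e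
  proof -
    have "e / (norm y + 1) > 0" using e by (simp add: add_nonneg_pos)
    then obtain N where N: "\<And>m n. m \<ge> N \<Longrightarrow> n \<ge> N \<Longrightarrow> norm (opoly (r m) ((*) h) y - opoly (q n) ((*) h) y) \<le> e / (norm y + 1) * norm y"
      using poly_approx_bound[OF r q] by blast
    have pos: "norm y + 1 > 0" by (simp add: add_nonneg_pos)
    then have "e / (norm y + 1) * norm y < e / (norm y + 1) * (norm y + 1)"
      using e by (intro mult_strict_left_mono) auto
    then have "e / (norm y + 1) * norm y < e" using pos by simp
    then show ?thesis using N le_less_trans by blast
  qed
  have "Cauchy (\<lambda>n. opoly (q n) ((*) h) y)"
    by (rule CauchyI) (use small[OF q] in blast)
  then have lim: "(\<lambda>n. opoly (q n) ((*) h) y) \<longlonglongrightarrow> cfc h f y"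
    unfolding cfc_def q_def[symmetric] by (simp add: Cauchy_convergent convergent_LIMSEQ_iff[symmetric])
  have "(\<lambda>n. opoly (p n) ((*) h) y - opoly (q n) ((*) h) y) \<longlonglongrightarrow> 0"
    by (rule LIMSEQ_I) (use small[OF assms] in force)
  from tendsto_add[OF this lim] show ?thesis by simp
qed

lemma cfc_add:
  assumes "continuous_on {-1..1} f" "continuous_on {-1..1} g"
  shows "cfc h (\<lambda>t. f t + g t) y = cfc h f y + cfc h g y"
proof -
  obtain p q where pq: "poly_approx p f" "poly_approx q g" using poly_approx_exists assms by blast
  then have "poly_approx (\<lambda>n. p n + q n) (\<lambda>t. f t + g t)"
    unfolding poly_approx_def by (auto intro!: uniform_limit_add)
  then have "(\<lambda>n. opoly (p n) ((*) h) y + opoly (q n) ((*) h) y) \<longlonglongrightarrow> cfc h (\<lambda>t. f t + g t) y"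
    using cfc_limit[of "\<lambda>n. p n + q n"] by (simp add: opoly_add)
  moreover have "(\<lambda>n. opoly (p n) ((*) h) y + opoly (q n) ((*) h) y) \<longlonglongrightarrow> cfc h f y + cfc h g y"
    using pq by (intro tendsto_add cfc_limit)
  ultimately show ?thesis by (rule LIMSEQ_unique)
qed

lemma poly_approx_of_poly:
  assumes "\<And>k. coeff p k \<in> \<real>" and "\<And>t. poly p (complex_of_real t) = complex_of_real (f t)"
  shows "poly_approx (\<lambda>_. p) f"
  using assms by (simp add: poly_approx_def uniform_limit_const)

lemma cfc_poly:
  assumes "\<And>k. coeff p k \<in> \<real>" and "\<And>t. poly p (complex_of_real t) = complex_of_real (f t)"
  shows "cfc h f y = opoly p ((*) h) y"
  using cfc_limit[OF poly_approx_of_poly[OF assms], of y] by (simp add: LIMSEQ_const_iff)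

lemma cfc_one: "cfc h (\<lambda>_. 1) y = y"
  by (subst cfc_poly[where p = 1]) (auto simp: opoly_def one_pCons coeff_pCons split: nat.splits)

lemma cfc_id: "cfc h (\<lambda>t. t) y = h * y"
  by (subst cfc_poly[where p = "[:0, 1:]"])
    (auto simp: opoly_pCons clinear_left_mult coeff_pCons split: nat.splits)

lemma cfc_mult:
  assumes "continuous_on {-1..1} f" "continuous_on {-1..1} g"
  shows "star (cfc h f x) * cfc h g y = star x * cfc h (\<lambda>t. f t * g t) y"
proof -
  obtain p q where pq: "poly_approx p f" "poly_approx q g" using poly_approx_exists assms by blast
  have bdd: "bounded (f ` {-1..1})" "bounded (g ` {-1..1})"
    using assms by (auto intro!: compact_imp_bounded compact_continuous_image)
  then have "bounded ((\<lambda>t. complex_of_real (f t)) ` {-1..1})" "bounded ((\<lambda>t. complex_of_real (g t)) ` {-1..1})"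
    by (simp_all add: bounded_iff)
  then have approx: "poly_approx (\<lambda>n. p n * q n) (\<lambda>t. f t * g t)"
    using pq coeff_mult_Reals unfolding poly_approx_def of_real_mult poly_mult
    by (auto intro!: uniform_lim_mult)
  have real: "coeff (p n) k \<in> \<real>" for n k using pq by (simp add: poly_approx_def)
  have "(\<lambda>n. star (opoly (p n) ((*) h) x) * opoly (q n) ((*) h) y) \<longlonglongrightarrow> star (cfc h f x) * cfc h g y"
    using pq by (intro tendsto_mult bounded_linear.tendsto[OF bounded_linear_star] cfc_limit)
  moreover have "(\<lambda>n. star x * opoly (p n * q n) ((*) h) y) \<longlonglongrightarrow> star x * cfc h (\<lambda>t. f t * g t) y"
    using approx by (intro tendsto_mult tendsto_const cfc_limit)
  moreover have "star (opoly (p n) ((*) h) x) * opoly (q n) ((*) h) y = star x * opoly (p n * q n) ((*) h) y" for n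
    by (simp add: opoly_symmetric[OF h(1) real] opoly_mult clinear_left_mult)
  ultimately show ?thesis using LIMSEQ_unique by simp
qed

lemma norm_cfc_le:
  assumes f: "continuous_on {-1..1} f" and M: "\<And>t. t \<in> {-1..1} \<Longrightarrow> \<bar>f t\<bar> \<le> M"
  shows "norm (cfc h f y) \<le> M * norm y"
proof (rule field_le_epsilon)
  fix e :: real assume e: "e > 0"
  obtain p where p: "poly_approx p f" using poly_approx_exists f by blast
  define d where "d = e / (norm y + 1)"
  have pos: "norm y + 1 > 0" by (simp add: add_nonneg_pos)
  have d: "d > 0" using e pos by (simp add: d_def)
  have "d * norm y \<le> d * (norm y + 1)" using d by (intro mult_left_mono) auto
  also have "\<dots> = e" using pos by (simp add: d_def)
  finally have de: "d * norm y \<le> e" .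
  have "\<forall>\<^sub>F n in sequentially. \<forall>t\<in>{-1..1}. cmod (poly (p n) (complex_of_real t) - complex_of_real (f t)) < d"
    using p d by (rule poly_approxD)
  then have "\<forall>\<^sub>F n in sequentially. norm (opoly (p n) ((*) h) y) \<le> M * norm y + e"
  proof eventually_elim
    case (elim n)
    have "norm (opoly (p n) ((*) h) y) \<le> (M + d) * norm y"
    proof (rule norm_opoly_le[OF h])
      show "coeff (p n) k \<in> \<real>" for k using p by (simp add: poly_approx_def)
      fix t :: real assume "\<bar>t\<bar> \<le> 1"
      then have t: "t \<in> {-1..1}" by (auto simp: abs_le_iff)
      have "cmod (poly (p n) (complex_of_real t)) \<le> cmod (complex_of_real (f t)) + cmod (poly (p n) (complex_of_real t) - complex_of_real (f t))"
        by (metis add_diff_cancel_left' diff_add_cancel norm_triangle_ineq add.commute)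
      then show "cmod (poly (p n) (complex_of_real t)) \<le> M + d"
        using M[OF t] elim t by force
    qed
    then show ?case using de by (simp add: distrib_right)
  qed
  then show "norm (cfc h f y) \<le> M * norm y + e"
    by (intro tendsto_upperbound[OF tendsto_norm[OF cfc_limit[OF p]]]) auto
qed

lemma cfc_scale:
  assumes "continuous_on {-1..1} f"
  shows "cfc h (\<lambda>t. c * f t) y = c *\<^sub>R cfc h f y"
proof -
  obtain p where p: "poly_approx p f" using poly_approx_exists assms by blast
  have "uniform_limit {-1..1} (\<lambda>n t. complex_of_real c * poly (p n) (complex_of_real t)) (\<lambda>t. complex_of_real c * complex_of_real (f t)) sequentially"
    using p unfolding poly_approx_def
    by (intro bounded_linear.uniform_limit[OF bounded_linear_mult_right]) auto
  then have "poly_approx (\<lambda>n. smult (complex_of_real c) (p n)) (\<lambda>t. c * f t)"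
    using p unfolding poly_approx_def by simp
  from cfc_limit[OF this] have "(\<lambda>n. c *\<^sub>R opoly (p n) ((*) h) y) \<longlonglongrightarrow> cfc h (\<lambda>t. c * f t) y"
    by (simp add: opoly_smult scaleR_scaleC)
  moreover have "(\<lambda>n. c *\<^sub>R opoly (p n) ((*) h) y) \<longlonglongrightarrow> c *\<^sub>R cfc h f y"
    using p by (intro tendsto_scaleR tendsto_const cfc_limit)
  ultimately show ?thesis by (rule LIMSEQ_unique)
qed

lemma cfc_orthogonal:
  assumes "continuous_on {-1..1} f" "continuous_on {-1..1} g" and "\<And>t. t \<in> {-1..1} \<Longrightarrow> f t * g t = 0"
  shows "star (cfc h f x) * cfc h g y = 0"
proof -
  have "norm (cfc h (\<lambda>t. f t * g t) y) \<le> 0 * norm y"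
    using assms by (intro norm_cfc_le continuous_intros) auto
  then show ?thesis by (simp add: cfc_mult assms)
qed

end

section \<open>Zero products determine bounded bilinear maps\<close>

text \<open>With \<open>x = N (t + 1)\<close>, which runs through \<open>[0, 2N]\<close>, the function \<open>ramp N i\<close> rises linearly from 0 to 1 for
\<open>x\<close> between \<open>i - 1\<close> and \<open>i\<close>. Thus \<open>ramp N 0\<close> is 1 on \<open>[-1,1]\<close>, and the hat function
\<open>hat N i\<close> is concentrated between \<open>i - 1\<close> and \<open>i + 1\<close>.\<close>

definition ramp :: "real \<Rightarrow> nat \<Rightarrow> real \<Rightarrow> real" where
  "ramp N i t = max 0 (min 1 (N * (t + 1) - i + 1))"

definition hat :: "real \<Rightarrow> nat \<Rightarrow> real \<Rightarrow> real" where
  "hat N i t = ramp N i t - ramp N (Suc i) t"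

lemma sum_of_ramps:
  assumes "0 \<le> x"
  shows "(\<Sum>i<n. max 0 (min 1 (x - real i))) = min x n"
  by (induction n) (use assms in auto)

text \<open>Up to a constant and the factor \<open>N\<close>, the identity function is the sum of the ramps \<open>e\<^sub>i\<close>, \<open>1 \<le> i \<le> 2N\<close>.
For a single ramp, \<open>\<psi>(e\<^sub>i,1) - \<psi>(1,e\<^sub>i) = \<psi>(e\<^sub>i,1-e\<^sub>i) - \<psi>(1-e\<^sub>i,e\<^sub>i)\<close>, and by
orthogonality only the values of \<open>\<psi>\<close> at two neighbouring hats survive. Sorting the indices modulo 3
makes hats with different indices in one class far apart, so that the sum of these values over a class is one value
of \<open>\<psi>\<close> at two functions bounded by 1. Hence \<open>N (\<psi>(id,1) - \<psi>(1,id))\<close> stays bounded by \<open>6 C\<close>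
for every \<open>N\<close>.\<close>

lemma diagonal_determines_bilinear_form:
  fixes \<psi> :: "(real \<Rightarrow> real) \<Rightarrow> (real \<Rightarrow> real) \<Rightarrow> 'x::real_normed_vector"
  assumes addl: "\<And>f f' g. continuous_on {-1..1} f \<Longrightarrow> continuous_on {-1..1} f' \<Longrightarrow> continuous_on {-1..1} g \<Longrightarrow>
      \<psi> (\<lambda>t. f t + f' t) g = \<psi> f g + \<psi> f' g"
    and addr: "\<And>f g g'. continuous_on {-1..1} f \<Longrightarrow> continuous_on {-1..1} g \<Longrightarrow> continuous_on {-1..1} g' \<Longrightarrow>
      \<psi> f (\<lambda>t. g t + g' t) = \<psi> f g + \<psi> f g'"
    and scl: "\<And>c f g. continuous_on {-1..1} f \<Longrightarrow> continuous_on {-1..1} g \<Longrightarrow> \<psi> (\<lambda>t. c * f t) g = c *\<^sub>R \<psi> f g"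
    and scr: "\<And>c f g. continuous_on {-1..1} f \<Longrightarrow> continuous_on {-1..1} g \<Longrightarrow> \<psi> f (\<lambda>t. c * g t) = c *\<^sub>R \<psi> f g"
    and bound: "\<And>f g. continuous_on {-1..1} f \<Longrightarrow> continuous_on {-1..1} g \<Longrightarrow>
      (\<And>t. t \<in> {-1..1} \<Longrightarrow> \<bar>f t\<bar> \<le> 1) \<Longrightarrow> (\<And>t. t \<in> {-1..1} \<Longrightarrow> \<bar>g t\<bar> \<le> 1) \<Longrightarrow> norm (\<psi> f g) \<le> C"
    and orth: "\<And>f g. continuous_on {-1..1} f \<Longrightarrow> continuous_on {-1..1} g \<Longrightarrow>
      (\<And>t. t \<in> {-1..1} \<Longrightarrow> f t * g t = 0) \<Longrightarrow> \<psi> f g = 0"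
  shows "\<psi> (\<lambda>t. t) (\<lambda>_. 1) = \<psi> (\<lambda>_. 1) (\<lambda>t. t)"
proof -
  let ?C = "\<lambda>f :: real \<Rightarrow> real. continuous_on {-1..1} f"
  have diffl: "\<psi> (\<lambda>t. f t - f' t) g = \<psi> f g - \<psi> f' g" if "?C f" "?C f'" "?C g" for f f' g :: "real \<Rightarrow> real"
    using addl[of f "\<lambda>t. - 1 * f' t" g] scl[of f' g "- 1"] that by (auto intro: continuous_intros)
  have diffr: "\<psi> f (\<lambda>t. g t - g' t) = \<psi> f g - \<psi> f g'" if "?C f" "?C g" "?C g'" for f g g' :: "real \<Rightarrow> real"
    using addr[of f g "\<lambda>t. - 1 * g' t"] scr[of f g' "- 1"] that by (auto intro: continuous_intros)
  have suml: "\<psi> (\<lambda>t. \<Sum>i\<in>A. F i t) g = (\<Sum>i\<in>A. \<psi> (F i) g)" if "\<And>i. ?C (F i)" "?C g" "finite A" for F g and A :: "nat set"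
    using that(3)
  proof (induction A rule: finite_induct)
    case (insert i A)
    have "?C (\<lambda>t. \<Sum>i\<in>A. F i t)" by (intro continuous_intros that)
    then show ?case using insert that by (simp add: addl)
  qed (simp add: orth that)
  have sumr: "\<psi> f (\<lambda>t. \<Sum>i\<in>A. G i t) = (\<Sum>i\<in>A. \<psi> f (G i))" if "?C f" "\<And>i. ?C (G i)" "finite A" for f G and A :: "nat set"
    using that(3)
  proof (induction A rule: finite_induct)
    case (insert i A)
    have "?C (\<lambda>t. \<Sum>i\<in>A. G i t)" by (intro continuous_intros that)
    then show ?case using insert that by (simp add: addr)
  qed (simp add: orth that)
  have estimate: "real N * norm (\<psi> (\<lambda>t. t) (\<lambda>_. 1) - \<psi> (\<lambda>_. 1) (\<lambda>t. t)) \<le> 6 * C" for N :: nat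
  proof -
    define n where "n = 2 * N"
    let ?e = "ramp N" and ?a = "hat N"
    have Ce: "?C (?e i)" for i unfolding ramp_def by (intro continuous_intros)
    have Ca: "?C (?a i)" for i unfolding hat_def by (intro continuous_intros Ce)
    have C1: "?C (\<lambda>_. 1)" "?C (\<lambda>t. t)" by (intro continuous_intros)+
    have Ce1: "?C (\<lambda>t. 1 - ?e i t)" for i by (intro continuous_intros Ce)
    have e01: "0 \<le> ?e i t" "?e i t \<le> 1" for i t by (auto simp: ramp_def)
    have mono: "?e (Suc i) t \<le> ?e i t" for i t by (auto simp: ramp_def)
    have a0: "0 \<le> ?a i t" for i t using mono by (simp add: hat_def)
    have e_full: "?e i t = 1" if "?e (Suc i) t \<noteq> 0" for i t using that by (auto simp: ramp_def split: if_splits) 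
    have e_zero: "?e (Suc i) t = 0" if "?e i t \<noteq> 1" for i t using e_full that by blast
    have e_le: "?e j t \<le> ?e i t" if "i \<le> j" for i j t using lift_Suc_antimono_le[of "\<lambda>i. ?e i t", OF mono that] .
    have a_orth: "?a i t * ?a j t = 0" if "Suc i < j" for i j t
    proof (cases "?e (Suc i) t = 1")
      case True
      then have "?e i t = 1" using e_le[of i "Suc i" t] e01[of i t] by simp
      then show ?thesis using True by (simp add: hat_def)
    next
      case False
      then have "?e (Suc (Suc i)) t = 0" by (rule e_zero)
      then have "?e j t = 0" "?e (Suc j) t = 0"
        using e_le[of "Suc (Suc i)" j t] e_le[of "Suc (Suc i)" "Suc j" t] e01[of j t] e01[of "Suc j" t] that by auto
      then show ?thesis by (simp add: hat_def)
    qed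
    have a_orth': "?a i t * ?a j t = 0" if "Suc i < j \<or> Suc j < i" for i j t
      using a_orth[of i j t] a_orth[of j i t] that by (auto simp: mult.commute)
    \<comment> \<open>Both orders of the two neighbouring hats are treated at once: \<open>u\<close> and \<open>v\<close> are \<open>Suc\<close> and \<open>id\<close>.\<close>
    have key: "norm (\<Sum>j<n. \<psi> (?a (u j)) (?a (v j))) \<le> 3 * C"
      if uv: "u = Suc \<and> v = id \<or> u = id \<and> v = Suc" for u v :: "nat \<Rightarrow> nat"
    proof -
      let ?A = "\<lambda>r. {j. j < n \<and> j mod 3 = r}"
      have "norm (\<Sum>j\<in>?A r. \<psi> (?a (u j)) (?a (v j))) \<le> C" for r
      proof -
        have off: "\<psi> (?a (u i)) (?a (v j)) = 0" if "i \<in> ?A r" "j \<in> ?A r" "i \<noteq> j" for i j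
        proof (intro orth Ca a_orth')
          have "i mod 3 = j mod 3" using that by simp
          then have "i + 2 < j \<or> j + 2 < i" using that(3) by presburger
          then show "Suc (u i) < v j \<or> Suc (v j) < u i" using uv by auto
        qed
        have sup: "\<bar>\<Sum>j\<in>?A r. ?a (w j) t\<bar> \<le> 1" if w: "w = Suc \<or> w = id" for w t
        proof -
          have "(\<Sum>j\<in>?A r. ?a (w j) t) \<le> (\<Sum>j<n. ?a (w j) t)"
            by (intro sum_mono2) (auto simp: a0)
          also have "\<dots> = ?e (w 0) t - ?e (w n) t"
            using w sum_lessThan_telescope'[of "\<lambda>i. ?e (w i) t" n] by (auto simp: hat_def)
          also have "\<dots> \<le> 1" using e01[of "w 0" t] e01[of "w n" t] by simp
          finally show ?thesis by (simp add: sum_nonneg a0)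
        qed
        have "\<psi> (\<lambda>t. \<Sum>i\<in>?A r. ?a (u i) t) (\<lambda>t. \<Sum>j\<in>?A r. ?a (v j) t) = (\<Sum>i\<in>?A r. \<Sum>j\<in>?A r. \<psi> (?a (u i)) (?a (v j)))"
          by (subst suml) (auto intro!: continuous_intros Ca sum.cong simp: sumr Ca)
        also have "\<dots> = (\<Sum>i\<in>?A r. \<Sum>j\<in>?A r. if i = j then \<psi> (?a (u i)) (?a (v i)) else 0)"
          by (intro sum.cong refl) (use off in auto)
        also have "\<dots> = (\<Sum>j\<in>?A r. \<psi> (?a (u j)) (?a (v j)))" by (intro sum.cong refl) simp
        finally have "(\<Sum>j\<in>?A r. \<psi> (?a (u j)) (?a (v j))) = \<psi> (\<lambda>t. \<Sum>i\<in>?A r. ?a (u i) t) (\<lambda>t. \<Sum>j\<in>?A r. ?a (v j) t)" ..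
        also have "norm \<dots> \<le> C" using uv by (intro bound continuous_intros Ca sup) auto
        finally show ?thesis .
      qed
      note le = this
      have "(\<Sum>j<n. \<psi> (?a (u j)) (?a (v j))) = (\<Sum>r<3. \<Sum>j\<in>?A r. \<psi> (?a (u j)) (?a (v j)))"
      proof -
        have "(\<Sum>r<3. \<Sum>j\<in>{x \<in> {..<n}. x mod 3 = r}. \<psi> (?a (u j)) (?a (v j))) = (\<Sum>j<n. \<psi> (?a (u j)) (?a (v j)))"
          by (rule sum.group) auto
        then show ?thesis by simp
      qed
      also have "norm \<dots> \<le> (\<Sum>r<3::nat. C)" by (intro order_trans[OF norm_sum] sum_mono le)
      finally show ?thesis by simp
    qed
    have step: "\<psi> (?e (Suc j)) (\<lambda>_. 1) - \<psi> (\<lambda>_. 1) (?e (Suc j)) = \<psi> (?a (Suc j)) (?a j) - \<psi> (?a j) (?a (Suc j))" for j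
    proof -
      let ?f = "?e (Suc j)"
      have split1: "?e (Suc j) = (\<lambda>t. ?a (Suc j) t + ?e (Suc (Suc j)) t)" by (simp add: hat_def)
      have split2: "(\<lambda>t. 1 - ?e (Suc j) t) = (\<lambda>t. ?a j t + (1 - ?e j t))" by (simp add: hat_def)
      have o1: "?e (Suc (Suc j)) t * ?a j t = 0" for t
      proof (cases "?e (Suc (Suc j)) t = 0")
        case False
        then have "?e (Suc j) t = 1" by (rule e_full)
        then have "?a j t = 0" using e_le[of j "Suc j" t] e01[of j t] by (simp add: hat_def)
        then show ?thesis by simp
      qed simp
      have o2: "?e (Suc j) t * (1 - ?e j t) = 0" for t using e_full[of j t] by auto
      have 1: "\<psi> ?f (\<lambda>t. 1 - ?f t) = \<psi> (?a (Suc j)) (?a j)"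
      proof -
        have "\<psi> ?f (\<lambda>t. 1 - ?f t) = \<psi> ?f (?a j) + \<psi> ?f (\<lambda>t. 1 - ?e j t)"
          unfolding split2 by (rule addr[OF Ce Ca Ce1])
        also have "\<psi> ?f (\<lambda>t. 1 - ?e j t) = 0" by (intro orth Ce Ce1 o2)
        also have "\<psi> ?f (?a j) = \<psi> (?a (Suc j)) (?a j) + \<psi> (?e (Suc (Suc j))) (?a j)"
          by (subst split1) (rule addl[OF Ca Ce Ca])
        also have "\<psi> (?e (Suc (Suc j))) (?a j) = 0" by (intro orth Ce Ca o1)
        finally show ?thesis by simp
      qed
      have 2: "\<psi> (\<lambda>t. 1 - ?f t) ?f = \<psi> (?a j) (?a (Suc j))"
      proof -
        have "\<psi> (\<lambda>t. 1 - ?f t) ?f = \<psi> (?a j) ?f + \<psi> (\<lambda>t. 1 - ?e j t) ?f"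
          unfolding split2 by (rule addl[OF Ca Ce1 Ce])
        also have "\<psi> (\<lambda>t. 1 - ?e j t) ?f = 0" by (intro orth Ce Ce1) (subst mult.commute, rule o2)
        also have "\<psi> (?a j) ?f = \<psi> (?a j) (?a (Suc j)) + \<psi> (?a j) (?e (Suc (Suc j)))"
          by (subst split1) (rule addr[OF Ca Ca Ce])
        also have "\<psi> (?a j) (?e (Suc (Suc j))) = 0" by (intro orth Ce Ca) (subst mult.commute, rule o1)
        finally show ?thesis by simp
      qed
      show ?thesis unfolding 1[symmetric] 2[symmetric] diffl[OF C1(1) Ce Ce] diffr[OF Ce C1(1) Ce] by simp
    qed
    have sum_e: "(\<Sum>j<n. ?e (Suc j) t) = real N * (t + 1)" if "t \<in> {-1..1}" for t :: real
    proof -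
      have "(\<Sum>j<n. ?e (Suc j) t) = (\<Sum>j<n. max 0 (min 1 (real N * (t + 1) - real j)))"
        by (simp add: ramp_def algebra_simps)
      also have "\<dots> = min (real N * (t + 1)) (real n)" by (rule sum_of_ramps) (use that in auto)
      also have "\<dots> = real N * (t + 1)"
      proof -
        have "real N * (t + 1) \<le> real N * 2" using that by (intro mult_left_mono) auto
        then show ?thesis by (simp add: n_def min_absorb1 mult.commute)
      qed
      finally show ?thesis .
    qed
    have congl: "\<psi> f g = \<psi> f' g" if "?C f" "?C f'" "?C g" "\<And>t. t \<in> {-1..1} \<Longrightarrow> f t = f' t" for f f' g :: "real \<Rightarrow> real"
      using diffl[OF that(1,2,3)] orth[of "\<lambda>t. f t - f' t" g] that by (simp add: continuous_on_diff)
    have congr: "\<psi> g f = \<psi> g f'" if "?C f" "?C f'" "?C g" "\<And>t. t \<in> {-1..1} \<Longrightarrow> f t = f' t" for f f' g :: "real \<Rightarrow> real"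
      using diffr[OF that(3,1,2)] orth[of g "\<lambda>t. f t - f' t"] that by (simp add: continuous_on_diff)
    have Cs: "?C (\<lambda>t. \<Sum>j<n. ?e (Suc j) t)" "?C (\<lambda>t. real N * (t + 1))" "?C (\<lambda>t. t + 1)"
      by (intro continuous_intros Ce)+
    have L: "(\<Sum>j<n. \<psi> (?e (Suc j)) (\<lambda>_. 1)) = N *\<^sub>R (\<psi> (\<lambda>t. t) (\<lambda>_. 1) + \<psi> (\<lambda>_. 1) (\<lambda>_. 1))"
      using congl[OF Cs(1,2) C1(1) sum_e] suml[of "\<lambda>j. ?e (Suc j)" "\<lambda>_. 1" "{..<n}"]
        scl[OF Cs(3) C1(1), of N] addl[OF C1(2,1,1)] Ce C1 by simp
    have R: "(\<Sum>j<n. \<psi> (\<lambda>_. 1) (?e (Suc j))) = N *\<^sub>R (\<psi> (\<lambda>_. 1) (\<lambda>t. t) + \<psi> (\<lambda>_. 1) (\<lambda>_. 1))"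
      using congr[OF Cs(1,2) C1(1) sum_e] sumr[of "\<lambda>_. 1" "\<lambda>j. ?e (Suc j)" "{..<n}"]
        scr[OF C1(1) Cs(3), of N] addr[OF C1(1,2,1)] Ce C1 by simp
    have "N *\<^sub>R (\<psi> (\<lambda>t. t) (\<lambda>_. 1) - \<psi> (\<lambda>_. 1) (\<lambda>t. t))
        = (\<Sum>j<n. \<psi> (?e (Suc j)) (\<lambda>_. 1)) - (\<Sum>j<n. \<psi> (\<lambda>_. 1) (?e (Suc j)))"
      unfolding L R by (simp add: algebra_simps)
    also have "\<dots> = (\<Sum>j<n. \<psi> (?a (Suc j)) (?a j)) - (\<Sum>j<n. \<psi> (?a j) (?a (Suc j)))"
      unfolding sum_subtractf[symmetric] by (simp add: step)
    also have "norm \<dots> \<le> 3 * C + 3 * C"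
      using key[of Suc id] key[of id Suc] norm_triangle_ineq4 by (intro order_trans[OF norm_triangle_ineq4] add_mono) auto
    finally show ?thesis by simp
  qed
  have "norm (\<psi> (\<lambda>t. t) (\<lambda>_. 1) - \<psi> (\<lambda>_. 1) (\<lambda>t. t)) = 0"
  proof (rule ccontr)
    let ?z = "norm (\<psi> (\<lambda>t. t) (\<lambda>_. 1) - \<psi> (\<lambda>_. 1) (\<lambda>t. t))"
    assume "?z \<noteq> 0"
    then have "?z > 0" by simp
    then obtain N :: nat where "6 * C < real N * ?z" using reals_Archimedean3 by blast
    with estimate[of N] show False by simp
  qed
  then show ?thesis by simp
qed

text \<open>By linearity the middle factor may be taken self-adjoint and of small norm. In that case
\<open>diagonal_determines_bilinear_form\<close> applies to \<open>\<psi>(f,g) = \<phi>(af(h), g(h)c)\<close>, where \<open>af(h)\<close> is written as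
\<open>(f(h)a\<^sup>*)\<^sup>*\<close>; the product \<open>(af(h))(g(h)c) = a(fg)(h)c\<close> is zero when \<open>fg = 0\<close>.\<close>

theorem zero_product_determined:
  fixes \<phi> :: "'a::cstar_algebra \<Rightarrow> 'a \<Rightarrow> 'x::complex_normed_vector"
  assumes \<phi>: "bounded_bilinear \<phi>"
    and cl: "\<And>c a b. \<phi> (c *\<^sub>C a) b = c *\<^sub>C \<phi> a b" and cr: "\<And>c a b. \<phi> a (c *\<^sub>C b) = c *\<^sub>C \<phi> a b"
    and zero: "\<And>a b. a * b = 0 \<Longrightarrow> \<phi> a b = 0"
  shows "\<phi> (a * b) c = \<phi> a (b * c)"
proof -
  interpret bounded_bilinear \<phi> by fact
  obtain K where K: "K \<ge> 0" "\<And>x y. norm (\<phi> x y) \<le> norm x * norm y * K"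
    using nonneg_bounded by blast
  have small: "\<phi> (a * h) c = \<phi> a (h * c)" if h: "star h = h" "norm h \<le> 1/2" for h a c
  proof -
    note calc = cfc_add[OF h] cfc_scale[OF h] cfc_orthogonal[OF h] norm_cfc_le[OF h]
    define \<psi> where "\<psi> f g = \<phi> (star (cfc h f (star a))) (cfc h g c)" for f g
    have "\<psi> (\<lambda>t. t) (\<lambda>_. 1) = \<psi> (\<lambda>_. 1) (\<lambda>t. t)"
    proof (rule diagonal_determines_bilinear_form[where C = "norm a * norm c * K"])
      fix f g :: "real \<Rightarrow> real" assume fg: "continuous_on {-1..1} f" "continuous_on {-1..1} g"
        and le: "\<And>t. t \<in> {-1..1} \<Longrightarrow> \<bar>f t\<bar> \<le> 1" "\<And>t. t \<in> {-1..1} \<Longrightarrow> \<bar>g t\<bar> \<le> 1"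
      have "norm (\<psi> f g) \<le> norm (cfc h f (star a)) * norm (cfc h g c) * K"
        using K(2)[of "star (cfc h f (star a))" "cfc h g c"] by (simp add: \<psi>_def)
      also have "\<dots> \<le> norm a * norm c * K"
        using norm_cfc_le[OF h fg(1) le(1), of "star a"] norm_cfc_le[OF h fg(2) le(2), of c] K(1)
        by (intro mult_right_mono mult_mono) auto
      finally show "norm (\<psi> f g) \<le> norm a * norm c * K" .
    next
      fix f g :: "real \<Rightarrow> real"
      assume "continuous_on {-1..1} f" "continuous_on {-1..1} g" "\<And>t. t \<in> {-1..1} \<Longrightarrow> f t * g t = 0"
      then show "\<psi> f g = 0" unfolding \<psi>_def by (intro zero cfc_orthogonal[OF h])
    qed (simp_all add: \<psi>_def calc star_add star_scaleR add_left add_right scaleR_left scaleR_right zero)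
    then show ?thesis
      by (simp add: \<psi>_def cfc_one[OF h] cfc_id[OF h] star_star star_mult h)
  qed
  have sa: "\<phi> (a * h) c = \<phi> a (h * c)" if h: "star h = h" for h a c
  proof -
    define s where "s = 2 * norm h + 1"
    have s: "s > 0" by (simp add: s_def add_nonneg_pos)
    let ?h = "(1 / s) *\<^sub>R h"
    have "norm ?h \<le> 1/2" using s by (simp add: s_def field_simps)
    then have "\<phi> (a * ?h) c = \<phi> a (?h * c)" using h by (intro small) (simp_all add: star_scaleR)
    then have "(1 / s) *\<^sub>R \<phi> (a * h) c = (1 / s) *\<^sub>R \<phi> a (h * c)" by (simp add: scaleR_left scaleR_right)
    then show ?thesis using s by simp
  qed
  \<comment> \<open>Real and imaginary part of \<open>b\<close>.\<close>
  define x where "x = (1/2) *\<^sub>C (b + star b)"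
  define y where "y = (- \<i> / 2) *\<^sub>C (b - star b)"
  have x: "star x = x" by (simp add: x_def star_scaleC star_add star_star add.commute)
  have y: "star y = y"
    by (simp add: y_def star_scaleC star_diff star_star scaleC_diff_right scaleC_minus_left)
  have "\<i> *\<^sub>C y = (1/2) *\<^sub>C (b - star b)" by (simp add: y_def scaleC_scaleC)
  then have "x + \<i> *\<^sub>C y = (1/2) *\<^sub>C (b + b)"
    unfolding x_def by (simp only: scaleC_add_right[symmetric]) simp
  also have "\<dots> = (1/2 + 1/2) *\<^sub>C b" by (simp only: scaleC_add_left scaleC_add_right)
  finally have b: "b = x + \<i> *\<^sub>C y" by simp
  show ?thesis unfolding b
    by (simp add: distrib_left distrib_right add_left add_right mult_scaleC_left mult_scaleC_right cl cr sa[OF x] sa[OF y])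
qed

section \<open>Anti-biderivations vanish\<close>

lemma approximate_identityD:
  assumes "approximate_identity F"
  shows "F \<noteq> bot" "\<forall>\<^sub>F e in F. star e = e" "\<forall>\<^sub>F e in F. norm e \<le> 2"
    "((\<lambda>e. a * e) \<longlongrightarrow> a) F" "((\<lambda>e. e * a) \<longlongrightarrow> a) F"
  using assms by (auto simp: approximate_identity_def)

text \<open>The substitute for a polar decomposition: it turns \<open>v A v\<close> annihilating something into \<open>v\<close> annihilating it.\<close>

lemma approximate_cubic_factorization:
  fixes v :: "'a::cstar_algebra"
  shows "\<exists>k. (\<lambda>n. v * (star v * v * k n)) \<longlonglongrightarrow> v"
proof -
  have "\<exists>k. norm (v - v * (star v * v * k)) < 1 / Suc n" for n
    using right_unit_for_element[of "1 / Suc n" v] by auto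
  then obtain k where k: "\<And>n. norm (v - v * (star v * v * k n)) < 1 / Suc n" by metis
  have "(\<lambda>n. v - v * (star v * v * k n)) \<longlonglongrightarrow> 0"
    by (rule Lim_null_comparison[OF _ LIMSEQ_inverse_real_of_nat])
      (use k in \<open>auto simp: inverse_eq_divide intro!: always_eventually less_imp_le\<close>)
  from tendsto_diff[OF tendsto_const[of v] this] show ?thesis by auto
qed

lemma self_neg_zero:
  fixes x :: "'v::real_vector"
  assumes "x = - x"
  shows "x = 0"
proof -
  have "2 *\<^sub>R x = 0" using assms by (simp add: scaleR_2) (metis add.right_inverse)
  then show ?thesis by simp
qed

locale cstar_bimodule = banach_bimodule l r
  for l :: "'a::cstar_algebra \<Rightarrow> 'x::complex_banach \<Rightarrow> 'x" and r :: "'x \<Rightarrow> 'a \<Rightarrow> 'x"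
begin

sublocale l: bounded_bilinear l by (rule bounded_bilinear_l)
sublocale r: bounded_bilinear r by (rule bounded_bilinear_r)

lemmas action_simps = l.add_left l.add_right l.diff_left l.diff_right l.minus_left l.minus_right
  r.add_left r.add_right r.diff_left r.diff_right r.minus_left r.minus_right l_mult r_mult l_r

text \<open>Take \<open>w = v\<^sup>*\<close> and use that \<open>v v\<^sup>* v k\<close> approximates \<open>v\<close>.\<close>

lemma left_annihilator_of_sandwich:
  assumes "\<And>w z. l (v * w * v * z) x = 0"
  shows "l (v * z) x = 0"
proof -
  obtain k where k: "(\<lambda>n. v * (star v * v * k n)) \<longlonglongrightarrow> v" using approximate_cubic_factorization by blast
  have "(\<lambda>n. l (v * (star v * v * k n) * z) x) \<longlonglongrightarrow> l (v * z) x"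
    by (intro l.tendsto tendsto_mult k tendsto_const)
  moreover have "l (v * (star v * v * k n) * z) x = 0" for n
    using assms[of "star v" "k n * z"] by (simp add: mult.assoc)
  ultimately show ?thesis by (simp add: LIMSEQ_const_iff)
qed

text \<open>The hypothesis \<open>anti\<close> expands \<open>B(b,ca)\<close> as Leibniz' rule would expand \<open>B(b,ac)\<close>. It forces
the commutators \<open>[y,b]\<close> to annihilate the values of \<open>B\<close> from the left (\<open>K1\<close> to \<open>K6\<close>) and from the right
(\<open>K7\<close>); therefore \<open>B\<close> vanishes at commutators (\<open>K8\<close>). This means that \<open>aB(b,c) - B(b,c)a\<close> is symmetric
in \<open>a\<close> and \<open>c\<close>; it is also antisymmetric in \<open>b\<close> and \<open>c\<close>, and a function of three variables with both symmetries is
zero. So the values of \<open>B\<close> commute with the algebra, and \<open>c \<mapsto> B(b,c)\<close> is a derivation into a symmetric module.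
From \<open>ac = 0\<close> one gets \<open>a\<^sup>2B(b,c) = 0\<close> and then \<open>aB(b,c) = 0\<close>, so that
\<open>(a,c) \<mapsto> aB(b,c)\<close> is subject to \<open>zero_product_determined\<close>; with Leibniz' rule this leaves
\<open>acB(b,d) = 0\<close> for all \<open>a\<close>, \<open>c\<close>, \<open>d\<close>.\<close>

theorem antibiderivation_zero:
  assumes F: "approximate_identity F" and unit: "\<And>x. ((\<lambda>e. l e x) \<longlongrightarrow> x) F"
    and \<tau>: "bounded_clinear \<tau>"
    and B_def: "\<And>b c. B b c = \<tau> (b * c - c * b)"
    and anti: "\<And>b c a. B b (c * a) = r (B b a) c + l a (B b c)"
  shows "B b c = 0"
proof -
  note F' = approximate_identityD[OF F]
  note \<tau>D = clinearD[OF bounded_clinear_clinear[OF \<tau>]]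
  have cont: "((\<lambda>i. B b (f i)) \<longlongrightarrow> B b y) G" if "(f \<longlongrightarrow> y) G" for b f y and G :: "'i filter"
    unfolding B_def
    by (intro bounded_linear.tendsto[OF bounded_clinear_bounded_linear[OF \<tau>]] tendsto_intros that)
  have asym: "B c b = - B b c" for b c by (simp add: B_def \<tau>D(4)[symmetric])
  have self: "B b b = 0" for b by (simp add: B_def \<tau>D)
  have addl: "B (a + b) c = B a c + B b c" for a b c
    by (simp add: B_def \<tau>D(1)[symmetric] algebra_simps)
  have addr: "B c (a + b) = B c a + B c b" for a b c
    by (simp add: B_def \<tau>D(1)[symmetric] algebra_simps)
  have diffr: "B c (a - b) = B c a - B c b" for a b c
    by (simp add: B_def \<tau>D(5)[symmetric] algebra_simps)
  have anti': "B (c * a) b = r (B a b) c + l a (B c b)" for a b c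
    using anti[of b c a] asym[of "c * a" b] asym[of b a] asym[of b c] by (simp add: action_simps)
  \<comment> \<open>Two expansions of \<open>B a (x * y * c)\<close>.\<close>
  have E1: "r (B a c) (x * y - y * x) = l (y * c - c * y) (B a x)" for a c x y
  proof -
    have "B a ((x * y) * c) = B a (x * (y * c))" by (simp add: mult.assoc)
    then show ?thesis unfolding anti[of a "x * y"] anti[of a x "y * c"] anti[of a x y] anti[of a y c]
      by (simp add: action_simps) (simp add: algebra_simps)
  qed
  have K1: "l (y * a - a * y) (B a x) = 0" for a x y
    using E1[of a a x y] by (simp add: self r.zero_left)
  have K2: "l (y * a - a * y) (l z (B a x)) = 0" for a x y z
  proof -
    have "0 = l (y * a - a * y) (B a (x * z))" using K1 by simp
    also have "\<dots> = r (l (y * a - a * y) (B a z)) x + l (y * a - a * y) (l z (B a x))"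
      unfolding anti l.add_right l_r ..
    finally show ?thesis by (simp add: K1 r.zero_left)
  qed
  \<comment> \<open>Linearization of \<open>K2\<close> in \<open>a\<close>.\<close>
  have K3: "l (y * a - a * y) (l z (B a' x)) = - l (y * a' - a' * y) (l z (B a x))" for a a' x y z
  proof -
    have "l (y * (a + a') - (a + a') * y) (l z (B (a + a') x)) = 0" by (rule K2)
    moreover have "y * (a + a') - (a + a') * y = (y * a - a * y) + (y * a' - a' * y)"
      by (simp add: algebra_simps)
    ultimately have "l (y * a - a * y) (l z (B a' x)) + l (y * a' - a' * y) (l z (B a x)) = 0"
      by (simp only: addl l.add_left l.add_right K2) (simp add: add.commute)
    then show ?thesis by (simp add: eq_neg_iff_add_eq_0 add.commute)
  qed
  \<comment> \<open>By \<open>K3\<close> the inner commutator can be traded for one with \<open>a\<close>, after which \<open>K2\<close> applies to the outer one.\<close>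
  have K5: "l ((y * b - b * y) * z) (B a x) = 0" for y a b x z
  proof (rule left_annihilator_of_sandwich)
    fix w z
    let ?v = "y * b - b * y"
    have "l (?v * w * ?v * z) (B a x) = l (?v * w) (l ?v (l z (B a x)))" by (simp only: l_mult)
    also have "\<dots> = - l (?v * w) (l (y * a - a * y) (l z (B b x)))"
      unfolding K3[of y b z a x] by (rule l.minus_right)
    also have "\<dots> = - l ?v (l (w * (y * a - a * y) * z) (B b x))" by (simp only: l_mult)
    also have "\<dots> = 0" unfolding K2 by simp
    finally show "l (?v * w * ?v * z) (B a x) = 0" .
  qed
  have K6: "l (y * b - b * y) (B a x) = 0" for y b a x
  proof -
    have "((\<lambda>e. l ((y * b - b * y) * e) (B a x)) \<longlongrightarrow> l (y * b - b * y) (B a x)) F"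
      by (intro l.tendsto F' tendsto_const)
    then show ?thesis unfolding K5 using F'(1) by (simp add: tendsto_const_iff)
  qed
  \<comment> \<open>Two expansions of \<open>B (a * b) (c * d)\<close>.\<close>
  have K7: "r (B b d) (a * c - c * a) = 0" for a b c d
  proof -
    have "r (B b (c * d)) a + l b (B a (c * d)) = r (B (a * b) d) c + l d (B (a * b) c)"
      using anti'[of a b "c * d"] anti[of "a * b" c d] by simp
    then have "r (B b d) (a * c - c * a) = l (b * d - d * b) (B a c)"
      unfolding anti anti' by (simp add: action_simps) (simp add: algebra_simps)
    then show ?thesis by (simp add: K6)
  qed
  have K8: "B b (c * a - a * c) = 0" for a b c
  proof -
    let ?v = "c * a - a * c"
    obtain k where "(\<lambda>n. ?v * (star ?v * ?v * k n)) \<longlonglongrightarrow> ?v" using approximate_cubic_factorization by blast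
    from cont[OF this, of b] have "(\<lambda>n. B b (?v * (star ?v * ?v * k n))) \<longlonglongrightarrow> B b ?v" .
    moreover have "B b (?v * (star ?v * ?v * k n)) = 0" for n
    proof -
      have "B b (?v * (star ?v * ?v * k n)) = r (B b (star ?v * ?v * k n)) ?v + l (star ?v * (?v * k n)) (B b ?v)"
        unfolding anti by (simp only: mult.assoc)
      also have "\<dots> = l (star ?v) (l (?v * k n) (B b ?v))" unfolding K7 l_mult by simp
      also have "\<dots> = 0" unfolding K5 by (rule l.zero_right)
      finally show ?thesis .
    qed
    ultimately show ?thesis by (simp add: LIMSEQ_const_iff)
  qed
  define g where "g b c a = l a (B b c) - r (B b c) a" for a b c
  have g_sym: "g b c a = g b a c" for a b c
    using K8[of b c a] by (simp add: diffr anti g_def algebra_simps)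
  have g_asym: "g b c a = - g c b a" for a b c
    unfolding g_def asym[of b c] by (simp add: action_simps)
  \<comment> \<open>Apply the two rules in turn, three times each: the permutation is trivial and the sign is \<open>- 1\<close>.\<close>
  have "g b c a = - g b c a" for a b c
    by (metis g_sym g_asym minus_minus)
  then have g0: "g b c a = 0" for a b c by (rule self_neg_zero)
  then have central: "r (B b c) a = l a (B b c)" for a b c by (simp add: g_def)
  have orth: "l a (B b c) = 0" if ac: "a * c = 0" for a b c
  proof -
    let ?x = "B b c"
    have "0 = B b (a * c)" by (simp add: ac B_def \<tau>D)
    also have "\<dots> = l a ?x + l c (B b a)" by (simp add: anti central)
    finally have "l a ?x = - l c (B b a)" by (simp add: eq_neg_iff_add_eq_0)
    then have "l a (l a ?x) = - l (a * c) (B b a)" by (simp add: l.minus_right l_mult)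
    then have aa: "l a (l a ?x) = 0" by (simp add: ac l.zero_left)
    \<comment> \<open>Up to a commutator, which annihilates the values of \<open>B\<close>, the factors of \<open>a a\<^sup>* a\<close> can be rearranged.\<close>
    have cube: "l (a * star a * a) ?x = 0"
    proof -
      have "a * star a * a = star a * a * a + (a * star a - star a * a) * a" by (simp add: algebra_simps)
      then have "l (a * star a * a) ?x = l (star a) (l a (l a ?x)) + l ((a * star a - star a * a) * a) ?x"
        by (simp only: l.add_left l_mult)
      then show ?thesis by (simp only: aa K5 l.zero_right) simp
    qed
    obtain k where "(\<lambda>n. star a * (star (star a) * star a * k n)) \<longlonglongrightarrow> star a"
      using approximate_cubic_factorization by blast
    from bounded_linear.tendsto[OF bounded_linear_star this]
    have "(\<lambda>n. star (k n) * (a * star a * a)) \<longlonglongrightarrow> a" by (simp add: star_mult star_star mult.assoc)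
    then have "(\<lambda>n. l (star (k n) * (a * star a * a)) ?x) \<longlonglongrightarrow> l a ?x" by (intro l.tendsto tendsto_const)
    then show ?thesis by (simp only: l_mult[of "star _"] cube l.zero_right LIMSEQ_const_iff)
  qed
  have BC: "B b (k *\<^sub>C c) = k *\<^sub>C B b c" for b c k
    by (simp add: B_def \<tau>D(2)[symmetric] mult_scaleC_left mult_scaleC_right scaleC_diff_right)
  have bl: "bounded_bilinear (\<lambda>a c. l a (B b c))"
  proof -
    have "bounded_linear (\<lambda>c. b * c - c * b)"
      by (intro bounded_linear_sub bounded_linear_mult_left bounded_linear_mult_right)
    from bounded_linear_compose[OF bounded_clinear_bounded_linear[OF \<tau>] this]
    have "bounded_linear (B b)" by (simp add: B_def[abs_def])
    from l.comp[OF bounded_linear_ident this] show ?thesis .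
  qed
  have kill: "l a (l c (B b d)) = 0" for a c d
  proof -
    have "l (a * d) (B b c) = l a (B b (d * c))"
      by (rule zero_product_determined[OF bl]) (simp_all add: l_scaleC_left l_scaleC_right BC orth)
    then show ?thesis by (simp add: anti central l_mult l.add_right)
  qed
  have "l c (B b d) = 0" for c d
    using unit[of "l c (B b d)"] F'(1) by (simp add: kill tendsto_const_iff)
  then show ?thesis using unit[of "B b c"] F'(1) by (simp add: tendsto_const_iff)
qed

end

section \<open>Limits along an approximate identity in an essential bimodule\<close>

lemma convergent_on_closure:
  fixes G :: "'e \<Rightarrow> 'v::real_normed_vector \<Rightarrow> 'w::banach"
  assumes F: "F \<noteq> bot" and lip: "\<forall>\<^sub>F e in F. \<forall>x y. norm (G e x - G e y) \<le> C * norm (x - y)"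
    and S: "\<And>y. y \<in> S \<Longrightarrow> \<exists>L. ((\<lambda>e. G e y) \<longlongrightarrow> L) F" and x: "x \<in> closure S"
  shows "\<exists>L. ((\<lambda>e. G e x) \<longlongrightarrow> L) F"
proof -
  obtain y where y: "\<And>n. y n \<in> S" "y \<longlonglongrightarrow> x" using x unfolding closure_sequential by blast
  obtain L where L: "\<And>n. ((\<lambda>e. G e (y n)) \<longlongrightarrow> L n) F" 
  proof -
    have "\<forall>n. \<exists>L. ((\<lambda>e. G e (y n)) \<longlongrightarrow> L) F" using S y(1) by blast
    from choice[OF this] show thesis using that by blast
  qed
  have LL: "norm (L m - L n) \<le> C * norm (y m - y n)" for m n
  proof (rule tendsto_upperbound[OF _ _ F])
    show "((\<lambda>e. norm (G e (y m) - G e (y n))) \<longlongrightarrow> norm (L m - L n)) F" by (intro tendsto_intros L)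
    show "\<forall>\<^sub>F e in F. norm (G e (y m) - G e (y n)) \<le> C * norm (y m - y n)"
      using lip by (rule eventually_mono) blast
  qed
  have Cy: "Cauchy y" using y(2) by (rule LIMSEQ_imp_Cauchy)
  define C' where "C' = max C 1"
  have C': "C' > 0" "C \<le> C'" by (auto simp: C'_def)
  have "Cauchy L"
  proof (rule CauchyI)
    fix e :: real assume "e > 0"
    then obtain N where N: "\<And>m n. m \<ge> N \<Longrightarrow> n \<ge> N \<Longrightarrow> norm (y m - y n) < e / C'"
      using CauchyD[OF Cy, of "e / C'"] C' by auto
    have "norm (L m - L n) < e" if "m \<ge> N" "n \<ge> N" for m n
    proof -
      have "norm (L m - L n) \<le> C' * norm (y m - y n)"
        using LL[of m n] mult_right_mono[OF C'(2), of "norm (y m - y n)"] by simp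
      also have "\<dots> < e" using N[OF that] C'(1) by (simp add: field_simps)
      finally show ?thesis .
    qed
    then show "\<exists>M. \<forall>m\<ge>M. \<forall>n\<ge>M. norm (L m - L n) < e" by blast
  qed
  then obtain L' where L': "L \<longlonglongrightarrow> L'" using Cauchy_convergent convergent_def by blast
  have "((\<lambda>e. G e x) \<longlongrightarrow> L') F"
  proof (rule tendstoI)
    fix e :: real assume e: "e > 0"
    have "\<forall>\<^sub>F n in sequentially. dist (y n) x < e / (3 * C')"
      by (rule tendstoD[OF y(2)]) (use e C' in simp)
    moreover have "\<forall>\<^sub>F n in sequentially. dist (L n) L' < e / 3"
      by (rule tendstoD[OF L']) (use e in simp)
    ultimately have "\<forall>\<^sub>F n in sequentially. dist (y n) x < e / (3 * C') \<and> dist (L n) L' < e / 3"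
      by (rule eventually_conj)
    then obtain n where n: "dist (y n) x < e / (3 * C')" "dist (L n) L' < e / 3"
      using eventually_happens'[OF sequentially_bot] by blast
    have "\<forall>\<^sub>F i in F. dist (G i (y n)) (L n) < e / 3" using L e by (intro tendstoD) auto
    with lip show "\<forall>\<^sub>F i in F. dist (G i x) L' < e"
    proof eventually_elim
      case (elim i)
      have "dist (G i x) (G i (y n)) \<le> C * norm (x - y n)" using elim(1) by (simp add: dist_norm)
      also have "\<dots> \<le> C' * dist (y n) x" using C'(2) by (simp add: dist_norm norm_minus_commute mult_right_mono)
      also have "\<dots> < e / 3" using n(1) C'(1) by (simp add: field_simps)
      finally have "dist (G i x) (G i (y n)) < e / 3" .
      then show ?case
        using elim(2) n(2) dist_triangle[of "G i x" L' "G i (y n)"] dist_triangle[of "G i (y n)" L' "L n"] by simp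
    qed
  qed
  then show ?thesis by blast
qed

lemma identity_limit_on_closure:
  fixes G :: "'e \<Rightarrow> 'v::banach \<Rightarrow> 'v"
  assumes F: "F \<noteq> bot" and lip: "\<forall>\<^sub>F e in F. \<forall>x y. norm (G e x - G e y) \<le> C * norm (x - y)"
    and S: "\<And>y. y \<in> S \<Longrightarrow> ((\<lambda>e. G e y) \<longlongrightarrow> y) F" and x: "x \<in> closure S"
  shows "((\<lambda>e. G e x) \<longlongrightarrow> x) F"
proof -
  obtain L where L: "((\<lambda>e. G e x) \<longlongrightarrow> L) F" using convergent_on_closure[OF F lip _ x] S by blast
  obtain y where y: "\<And>n. y n \<in> S" "y \<longlonglongrightarrow> x" using x unfolding closure_sequential by blast
  have le: "norm (L - y n) \<le> C * norm (x - y n)" for n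
  proof (rule tendsto_upperbound[OF _ _ F])
    show "((\<lambda>e. norm (G e x - G e (y n))) \<longlongrightarrow> norm (L - y n)) F" by (intro tendsto_intros L S y)
    show "\<forall>\<^sub>F e in F. norm (G e x - G e (y n)) \<le> C * norm (x - y n)"
      using lip by (rule eventually_mono) blast
  qed
  have "(\<lambda>n. norm (L - y n)) \<longlonglongrightarrow> norm (L - x)" by (intro tendsto_intros y)
  moreover have "(\<lambda>n. C * norm (x - y n)) \<longlonglongrightarrow> C * norm (x - x)" by (intro tendsto_intros y)
  ultimately have "norm (L - x) \<le> C * norm (x - x)" using le by (intro LIMSEQ_le) auto
  then show ?thesis using L by simp
qed

lemma cspan_induct [consumes 1, case_names zero add]:
  fixes S :: "'v::complex_normed_vector set"
  assumes "x \<in> cspan S" "P 0" "\<And>c a y. a \<in> S \<Longrightarrow> P y \<Longrightarrow> P (c *\<^sub>C a + y)"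
  shows "P x"
proof -
  interpret V: vector_space "scaleC :: complex \<Rightarrow> 'v \<Rightarrow> 'v" by (rule vector_space_scaleC)
  show ?thesis using assms by (rule V.span_induct_alt)
qed

lemma bounded_linear_scaleC: "bounded_linear (\<lambda>y :: 'v::complex_normed_vector. c *\<^sub>C y)"
proof (rule bounded_linear_intro[where K = "cmod c"])
  show "c *\<^sub>C (t *\<^sub>R y) = t *\<^sub>R (c *\<^sub>C y)" for t and y :: 'v
    by (simp add: scaleR_scaleC scaleC_scaleC mult.commute)
qed (simp_all add: scaleC_add_right norm_scaleC mult.commute)

text \<open>Clear for the generators \<open>azb\<close>; it passes to the closed span since the elements of norm at most 2 act by uniformly
bounded operators.\<close>

lemma (in cstar_bimodule) essential_unit_limits:
  assumes ess: "essential_bimodule l r" and F: "approximate_identity F"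
  shows "((\<lambda>e. l e x) \<longlongrightarrow> x) F" and "((\<lambda>e. r x e) \<longlongrightarrow> x) F"
proof -
  note F' = approximate_identityD[OF F]
  let ?S = "cspan {r (l a x) b | a b x. True}"
  have "closure ?S = UNIV" using ess unfolding essential_bimodule_def .
  then have x: "x \<in> closure ?S" by (simp only: UNIV_I)
  obtain K where K: "K \<ge> 0" "\<And>a x. norm (l a x) \<le> norm a * norm x * K" using l.nonneg_bounded by blast
  obtain K' where K': "K' \<ge> 0" "\<And>x a. norm (r x a) \<le> norm x * norm a * K'" using r.nonneg_bounded by blast
  show "((\<lambda>e. l e x) \<longlongrightarrow> x) F"
  proof (rule identity_limit_on_closure[OF F'(1) _ _ x, where C = "2 * K"])
    show "\<forall>\<^sub>F e in F. \<forall>x y. norm (l e x - l e y) \<le> 2 * K * norm (x - y)"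
      using F'(3)
    proof eventually_elim
      case (elim e)
      have "norm (l e (x - y)) \<le> 2 * K * norm (x - y)" for x y
      proof -
        have "norm (l e (x - y)) \<le> norm e * (norm (x - y) * K)" using K(2)[of e "x - y"] by (simp add: mult.assoc)
        also have "\<dots> \<le> 2 * (norm (x - y) * K)" using elim K(1) by (intro mult_right_mono) auto
        finally show ?thesis by (simp add: mult_ac)
      qed
      then show ?case by (simp add: l.diff_right)
    qed
    fix y assume "y \<in> ?S"
    then show "((\<lambda>e. l e y) \<longlongrightarrow> y) F"
    proof (induction rule: cspan_induct)
      case zero
      then show ?case by (simp add: l.zero_right)
    next
      case (add c x y)
      then obtain a b z where x: "x = r (l a z) b" by blast
      have "((\<lambda>e. r (l (e * a) z) b) \<longlongrightarrow> r (l a z) b) F"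
        by (intro r.tendsto l.tendsto F' tendsto_const)
      then have "((\<lambda>e. l e x) \<longlongrightarrow> x) F" by (simp add: x l_r l_mult)
      from tendsto_add[OF bounded_linear.tendsto[OF bounded_linear_scaleC this] add(2)] show ?case
        by (simp add: l.add_right l_scaleC_right)
    qed
  qed
  show "((\<lambda>e. r x e) \<longlongrightarrow> x) F"
  proof (rule identity_limit_on_closure[OF F'(1) _ _ x, where C = "2 * K'"])
    show "\<forall>\<^sub>F e in F. \<forall>x y. norm (r x e - r y e) \<le> 2 * K' * norm (x - y)"
      using F'(3)
    proof eventually_elim
      case (elim e)
      have "norm (r (x - y) e) \<le> 2 * K' * norm (x - y)" for x y
      proof -
        have "norm (r (x - y) e) \<le> norm e * (norm (x - y) * K')" using K'(2)[of "x - y" e] by (simp add: mult_ac)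
        also have "\<dots> \<le> 2 * (norm (x - y) * K')" using elim K'(1) by (intro mult_right_mono) auto
        finally show ?thesis by (simp add: mult_ac)
      qed
      then show ?case by (simp add: r.diff_left)
    qed
    fix y assume "y \<in> ?S"
    then show "((\<lambda>e. r y e) \<longlongrightarrow> y) F"
    proof (induction rule: cspan_induct)
      case zero
      then show ?case by (simp add: r.zero_left)
    next
      case (add c x y)
      then obtain a b z where x: "x = r (l a z) b" by blast
      have "((\<lambda>e. r (l a z) (b * e)) \<longlongrightarrow> r (l a z) b) F"
        by (intro r.tendsto F' tendsto_const)
      then have "((\<lambda>e. r x e) \<longlongrightarrow> x) F" by (simp add: x r_mult)
      from tendsto_add[OF bounded_linear.tendsto[OF bounded_linear_scaleC this] add(2)] show ?case
        by (simp add: r.add_left r_scaleC_left)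
    qed
  qed
qed

section \<open>Decomposition of a map that is anti-derivable at zero\<close>

lemma bounded_bilinear_sum:
  assumes "bounded_bilinear f" and "bounded_bilinear g"
  shows "bounded_bilinear (\<lambda>a b. f a b + g a b)"
proof -
  interpret f: bounded_bilinear f by fact
  interpret g: bounded_bilinear g by fact
  obtain K where K: "\<And>a b. norm (f a b) \<le> norm a * norm b * K" using f.bounded by blast
  obtain L where L: "\<And>a b. norm (g a b) \<le> norm a * norm b * L" using g.bounded by blast
  have "norm (f a b + g a b) \<le> norm a * norm b * (K + L)" for a b
    using norm_triangle_mono[OF K[of a b] L[of a b]] by (simp add: distrib_left)
  then have "\<exists>K. \<forall>a b. norm (f a b + g a b) \<le> norm a * norm b * K" by blast
  then show ?thesis
    by unfold_locales
      (auto simp: f.add_left f.add_right g.add_left g.add_right f.scaleR_left f.scaleR_right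
        g.scaleR_left g.scaleR_right scaleR_add_right)
qed

context banach_star_bimodule
begin

lemma bounded_linear_s: "bounded_linear s"
  by (intro bounded_linear_if_continuous linearI continuous_s)
    (simp_all add: s_add scaleR_scaleC s_scaleC)

sublocale cstar_bimodule l r by unfold_locales

lemma s_diff: "s (x - y) = s x - s y"
  by (rule linear_diff[OF bounded_linear.linear[OF bounded_linear_s]])

text \<open>This is the passage from the condition on \<open>T\<close> to a *-derivation, carried out inside the bimodule. The
map \<open>R\<close> plays the role of \<open>a \<mapsto> a\<xi>\<close>, and \<open>a \<mapsto> R(a\<^sup>*)\<^sup>*\<close>, called \<open>R'\<close> in the proof, that of
\<open>a \<mapsto> \<xi>\<^sup>*a\<close>.\<close>

theorem anti_derivable_decomposition:
  assumes F: "approximate_identity F"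
    and lunit: "\<And>x. ((\<lambda>e. l e x) \<longlongrightarrow> x) F" and runit: "\<And>x. ((\<lambda>e. r x e) \<longlongrightarrow> x) F"
    and T: "bounded_clinear T" and anti: "r_star_anti_derivable_at_zero l r s T"
  shows "\<exists>R. (\<forall>a. ((\<lambda>e. l a (T e)) \<longlongrightarrow> R a) F) \<and> (\<forall>a b. R (a * b) = l a (R b)) \<and>
    star_derivation l r s (\<lambda>a. T a - R a) \<and>
    (\<forall>a b. T (commutator a b) + s (R (star (commutator a b))) = 0)"
proof -
  note F' = approximate_identityD[OF F]
  note TD = clinearD[OF bounded_clinear_clinear[OF T]]
  note Tlim = bounded_linear.tendsto[OF bounded_clinear_bounded_linear[OF T]]
  define S where "S c = s (T (star c))" for c
  have S: "bounded_clinear S"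
  proof -
    have "bounded_linear S" unfolding S_def[abs_def]
      by (intro bounded_linear_compose[OF bounded_linear_s] bounded_linear_star
          bounded_linear_compose[OF bounded_clinear_bounded_linear[OF T]])
    then show ?thesis by (simp add: bounded_clinear_iff S_def star_scaleC TD s_scaleC)
  qed
  note SD = clinearD[OF bounded_clinear_clinear[OF S]]
  note Slim = bounded_linear.tendsto[OF bounded_clinear_bounded_linear[OF S]]
  have factor: "r (S c) (a * b) + l c (T (a * b)) = r (S (b * c)) a + l (b * c) (T a)" for a b c
  proof -
    have "bounded_bilinear (\<lambda>b a. r (S b) a + l b (T a))"
      by (intro bounded_bilinear_sum r.comp l.comp bounded_clinear_bounded_linear S T bounded_linear_ident)
    from this have flip: "bounded_bilinear (\<lambda>a b. r (S a) b + l a (T b))" .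
    have zero: "r (S c) a + l c (T a) = 0" if "a * c = 0" for a c
      using anti[unfolded r_star_anti_derivable_at_zero_def, rule_format, of a "star c"] that
      by (simp add: star_star S_def)
    have "(\<lambda>a c. r (S c) a + l c (T a)) (a * b) c = (\<lambda>a c. r (S c) a + l c (T a)) a (b * c)"
      by (rule zero_product_determined[OF bounded_bilinear.flip[OF flip]])
        (simp_all add: zero SD TD l_scaleC_left l_scaleC_right r_scaleC_left r_scaleC_right scaleC_add_right)
    then show ?thesis by simp
  qed
  \<comment> \<open>The limit of \<open>factor\<close> when its argument \<open>a\<close> runs through the approximate identity.\<close>
  have lim_on_products: "((\<lambda>e. l (b * c) (T e)) \<longlongrightarrow> r (S c) b + l c (T b) - S (b * c)) F" for b c
  proof -
    have "((\<lambda>e. r (S c) (e * b) + l c (T (e * b)) - r (S (b * c)) e) \<longlongrightarrow> r (S c) b + l c (T b) - S (b * c)) F"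
      by (intro tendsto_add tendsto_diff r.tendsto l.tendsto Tlim tendsto_const F' runit)
    moreover have "r (S c) (e * b) + l c (T (e * b)) - r (S (b * c)) e = l (b * c) (T e)" for e
      using factor[of c e b] by simp
    ultimately show ?thesis by simp
  qed
  obtain KT where KT: "KT \<ge> 0" "\<And>x. norm (T x) \<le> norm x * KT"
    using bounded_linear.nonneg_bounded[OF bounded_clinear_bounded_linear[OF T]] by blast
  obtain K where K: "K \<ge> 0" "\<And>a x. norm (l a x) \<le> norm a * norm x * K" using l.nonneg_bounded by blast
  have bnd: "\<forall>\<^sub>F e in F. \<forall>a. norm (l a (T e)) \<le> 2 * KT * K * norm a"
    using F'(3)
  proof eventually_elim
    case (elim e)
    have "norm (l a (T e)) \<le> 2 * KT * K * norm a" for a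
    proof -
      have "norm (T e) \<le> 2 * KT" using KT(2)[of e] mult_right_mono[OF elim KT(1)] by simp
      then have "norm a * norm (T e) * K \<le> norm a * (2 * KT) * K"
        using K(1) by (intro mult_right_mono mult_left_mono) auto
      then show ?thesis using K(2)[of a "T e"] by (simp add: mult_ac)
    qed
    then show ?case by blast
  qed
  have "\<exists>L. ((\<lambda>e. l a (T e)) \<longlongrightarrow> L) F" for a
  proof (rule convergent_on_closure[OF F'(1), where S = "{b * c |b c. True}"])
    show "\<forall>\<^sub>F e in F. \<forall>x y. norm (l x (T e) - l y (T e)) \<le> 2 * KT * K * norm (x - y)"
      using bnd by eventually_elim (simp add: l.diff_left[symmetric])
    show "\<exists>L. ((\<lambda>e. l y (T e)) \<longlongrightarrow> L) F" if "y \<in> {b * c |b c. True}" for y using lim_on_products that by blast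
    show "a \<in> closure {b * c |b c. True}"
    proof (rule Lim_in_closed_set[OF closed_closure _ F'(1) F'(4)[of a]])
      show "\<forall>\<^sub>F e in F. a * e \<in> closure {b * c |b c. True}"
        by (intro always_eventually allI subsetD[OF closure_subset]) blast
    qed
  qed
  then have "\<forall>a. \<exists>L. ((\<lambda>e. l a (T e)) \<longlongrightarrow> L) F" by blast
  from choice[OF this] obtain R where R: "\<And>a. ((\<lambda>e. l a (T e)) \<longlongrightarrow> R a) F" by blast
  have R_eq: "R a = L" if "((\<lambda>e. l a (T e)) \<longlongrightarrow> L) F" for a L
    using tendsto_unique[OF F'(1) R that] .
  have Radd: "R (a + b) = R a + R b" for a b
    by (rule R_eq) (unfold l.add_left, intro tendsto_add R)
  have RC: "R (c *\<^sub>C a) = c *\<^sub>C R a" for c a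
    by (rule R_eq) (unfold l_scaleC_left, intro bounded_linear.tendsto[OF bounded_linear_scaleC] R)
  have Rl: "R (a * b) = l a (R b)" for a b
    by (rule R_eq) (unfold l_mult, intro l.tendsto tendsto_const R)
  have "norm (R a) \<le> norm a * (2 * KT * K)" for a
  proof (rule tendsto_upperbound[OF tendsto_norm[OF R] _ F'(1)])
    show "\<forall>\<^sub>F e in F. norm (l a (T e)) \<le> norm a * (2 * KT * K)"
      using bnd by eventually_elim (simp add: mult_ac)
  qed
  then have Rbl: "bounded_linear R"
    by (intro bounded_linear_intro[where K = "2 * KT * K"]) (simp_all add: Radd RC scaleR_scaleC)
  then have R_bc: "bounded_clinear R" by (simp add: bounded_clinear_iff RC)
  note RD = clinearD[OF bounded_clinear_clinear[OF R_bc]]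
  have R_prod: "R (b * c) = r (S c) b + l c (T b) - S (b * c)" for b c
    by (rule R_eq[OF lim_on_products])
  define R' where "R' a = s (R (star a))" for a
  have R'_bc: "bounded_clinear R'"
  proof -
    have "bounded_linear R'" unfolding R'_def[abs_def]
      by (intro bounded_linear_compose[OF bounded_linear_s] bounded_linear_star
          bounded_linear_compose[OF Rbl])
    then show ?thesis by (simp add: bounded_clinear_iff R'_def star_scaleC RC s_scaleC)
  qed
  note R'D = clinearD[OF bounded_clinear_clinear[OF R'_bc]]
  have R'r: "R' (a * b) = r (R' a) b" for a b
    by (simp add: R'_def star_mult Rl s_l star_star)
  have R'lim: "((\<lambda>e. r (S e) a) \<longlongrightarrow> R' a) F" for a
  proof -
    have "((\<lambda>e. s (l (star a) (T e))) \<longlongrightarrow> R' a) F"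
      unfolding R'_def by (intro bounded_linear.tendsto[OF bounded_linear_s] R)
    then have "((\<lambda>e. r (s (T e)) a) \<longlongrightarrow> R' a) F" by (simp add: s_l star_star)
    moreover have "\<forall>\<^sub>F e in F. r (s (T e)) a = r (S e) a"
      using F'(2) by eventually_elim (simp add: S_def)
    ultimately show ?thesis by (simp cong: filterlim_cong)
  qed
  \<comment> \<open>The limit of \<open>R_prod\<close> when \<open>c\<close> runs through the approximate identity.\<close>
  have balance: "R b = R' b + T b - S b" for b
  proof (rule tendsto_unique[OF F'(1)])
    show "((\<lambda>e. R (b * e)) \<longlongrightarrow> R b) F" by (intro bounded_linear.tendsto[OF Rbl] F')
    show "((\<lambda>e. R (b * e)) \<longlongrightarrow> R' b + T b - S b) F"
      unfolding R_prod by (intro tendsto_add tendsto_diff R'lim lunit Slim F')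
  qed
  define d where "d a = T a - R a" for a
  have dS: "S a = d a + R' a" for a using balance[of a] by (simp add: d_def algebra_simps)
  have dT: "T a = d a + R a" for a by (simp add: d_def)
  have d_star: "d (star a) = s (d a)" for a
  proof -
    have "d (star a) = S (star a) - R' (star a)" using dS[of "star a"] by simp
    then show ?thesis by (simp add: S_def R'_def star_star d_def s_diff)
  qed
  have d_bc: "bounded_clinear d"
    using bounded_linear_sub[OF bounded_clinear_bounded_linear[OF T] Rbl]
    by (simp add: bounded_clinear_iff d_def[abs_def] TD RC scaleC_diff_right)
  note dD = clinearD[OF bounded_clinear_clinear[OF d_bc]]
  define \<tau> where "\<tau> a = T a + R' a" for a
  have \<tau>_bc: "bounded_clinear \<tau>"
    using bounded_linear_add[OF bounded_clinear_bounded_linear[OF T] bounded_clinear_bounded_linear[OF R'_bc]]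
    by (simp add: bounded_clinear_iff \<tau>_def[abs_def] TD R'D scaleC_add_right)
  note \<tau>D = clinearD[OF bounded_clinear_clinear[OF \<tau>_bc]]
  have \<tau>_prod: "\<tau> (b * c) = r (d c) b + l c (d b) + R (c * b) + R' (c * b)" for b c
  proof -
    have "\<tau> (b * c) = R (b * c) + S (b * c)" by (simp add: \<tau>_def balance)
    also have "\<dots> = r (S c) b + l c (T b)" by (simp add: R_prod)
    also have "\<dots> = r (d c) b + l c (d b) + R (c * b) + R' (c * b)"
      unfolding dS[of c] dT[of b] by (simp add: action_simps Rl R'r)
    finally show ?thesis .
  qed
  define B where "B b c = \<tau> (b * c - c * b)" for b c
  have defect: "B b c = d (b * c) - r (d b) c - l b (d c)" for b c
    unfolding B_def \<tau>D(5) \<tau>_prod[of c b] by (simp add: \<tau>_def d_def)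
  have "B b c = 0" for b c
  proof (rule antibiderivation_zero[OF F lunit \<tau>_bc B_def])
    fix b c a
    \<comment> \<open>The coboundary of a coboundary is zero.\<close>
    have cocycle: "l a (B b c) - B (a * b) c + B a (b * c) - r (B a b) c = 0"
      unfolding defect by (simp add: action_simps mult.assoc)
    have "B a (b * c) - B (a * b) c = - B b (c * a)"
      unfolding B_def \<tau>D(4)[symmetric] \<tau>D(5)[symmetric] by (simp add: algebra_simps)
    moreover have "B a b = - B b a"
      unfolding B_def \<tau>D(4)[symmetric] by simp
    ultimately have "B a (b * c) + B b (c * a) = B a (b * c) + (r (B b a) c + l a (B b c))"
      using cocycle by (simp add: r.minus_left algebra_simps)
    then show "B b (c * a) = r (B b a) c + l a (B b c)" by (rule add_left_imp_eq)
  qed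
  note B0 = this
  have "derivation l r d"
    unfolding derivation_def using defect B0 d_bc by (auto simp: bounded_clinear_clinear algebra_simps)
  then have "star_derivation l r s (\<lambda>a. T a - R a)"
    by (simp add: star_derivation_def d_star d_def[symmetric])
  moreover have "T (commutator a b) + s (R (star (commutator a b))) = 0" for a b
    using B0[of a b] by (simp add: B_def \<tau>_def R'_def commutator_def)
  ultimately show ?thesis using R Rl by blast
qed

end

section \<open>Duals of *-bimodules\<close>

lemma norm_cdual_le:
  assumes "K \<ge> 0" and "\<And>x. cmod (cdual_apply \<phi> x) \<le> K * norm x"
  shows "norm \<phi> \<le> K"
  unfolding norm_cdual_eq_onorm using assms by (rule onorm_bound)

lemma cdual_apply_simps:
  "cdual_apply \<phi> (x + y) = cdual_apply \<phi> x + cdual_apply \<phi> y"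
  "cdual_apply \<phi> (c *\<^sub>C x) = c * cdual_apply \<phi> x"
  using clinearD[OF bounded_clinear_clinear[OF bounded_clinear_cdual_apply[of \<phi>]]]
  by (simp_all add: scaleC_complex_def)

lemma cdual_apply_scaleR: "cdual_apply (t *\<^sub>R \<phi>) x = complex_of_real t * cdual_apply \<phi> x"
  by (simp add: scaleR_scaleC cdual_apply_scaleC)

context banach_bimodule
begin

lemma bounded_clinear_left: "bounded_clinear (l a)"
  by (simp add: bounded_clinear_iff bounded_bilinear.bounded_linear_right[OF bounded_bilinear_l] l_scaleC_right)

lemma bounded_clinear_right: "bounded_clinear (\<lambda>x. r x a)"
  by (simp add: bounded_clinear_iff bounded_bilinear.bounded_linear_left[OF bounded_bilinear_r] r_scaleC_left)

lemma dual_left_apply: "cdual_apply (dual_left r a \<phi>) x = cdual_apply \<phi> (r x a)"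
  by (simp add: dual_left_def dual_map_apply bounded_clinear_right)

lemma dual_right_apply: "cdual_apply (dual_right l \<phi> a) x = cdual_apply \<phi> (l a x)"
  by (simp add: dual_right_def dual_map_apply bounded_clinear_left)

theorem dual_is_banach_bimodule: "banach_bimodule (dual_left r) (dual_right l)"
proof (rule banach_bimodule.intro)
  note ops = dual_left_apply dual_right_apply cdual_apply_add cdual_apply_simps cdual_apply_scaleC cdual_apply_scaleR
    l_mult r_mult l_r l_scaleC_left l_scaleC_right r_scaleC_left r_scaleC_right
  interpret l: bounded_bilinear l by (rule bounded_bilinear_l)
  interpret r: bounded_bilinear r by (rule bounded_bilinear_r)
  show "bounded_bilinear (dual_left r)"
  proof
    obtain K where K: "K \<ge> 0" "\<And>x a. norm (r x a) \<le> norm x * norm a * K" using r.nonneg_bounded by blast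
    have "norm (dual_left r a \<phi>) \<le> norm a * norm \<phi> * K" for a \<phi>
    proof (rule norm_cdual_le)
      fix x
      have "cmod (cdual_apply \<phi> (r x a)) \<le> norm \<phi> * (norm x * norm a * K)"
        using norm_cdual_apply[of \<phi> "r x a"] mult_left_mono[OF K(2)[of x a], of "norm \<phi>"] by simp
      then show "cmod (cdual_apply (dual_left r a \<phi>) x) \<le> norm a * norm \<phi> * K * norm x"
        by (simp add: ops mult_ac)
    qed (use K in simp)
    then show "\<exists>K. \<forall>a b. norm (dual_left r a b) \<le> norm a * norm b * K" by blast
  qed (intro cdual_eqI; simp add: ops r.add_right r.scaleR_right scaleR_scaleC algebra_simps)+
  show "bounded_bilinear (dual_right l)"
  proof
    obtain K where K: "K \<ge> 0" "\<And>x a. norm (l x a) \<le> norm x * norm a * K" using l.nonneg_bounded by blast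
    have "norm (dual_right l \<phi> a) \<le> norm \<phi> * norm a * K" for a \<phi>
    proof (rule norm_cdual_le)
      fix x
      have "cmod (cdual_apply \<phi> (l a x)) \<le> norm \<phi> * (norm a * norm x * K)"
        using norm_cdual_apply[of \<phi> "l a x"] mult_left_mono[OF K(2)[of a x], of "norm \<phi>"] by simp
      then show "cmod (cdual_apply (dual_right l \<phi> a) x) \<le> norm \<phi> * norm a * K * norm x"
        by (simp add: ops mult_ac)
    qed (use K in simp)
    then show "\<exists>K. \<forall>a b. norm (dual_right l a b) \<le> norm a * norm b * K" by blast
  qed (intro cdual_eqI; simp add: ops l.add_left l.scaleR_left scaleR_scaleC algebra_simps)+
qed (intro cdual_eqI; simp add: dual_left_apply dual_right_apply cdual_apply_simps cdual_apply_scaleC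
    l_mult r_mult l_r l_scaleC_left l_scaleC_right r_scaleC_left r_scaleC_right)+

end

context banach_star_bimodule
begin

lemma dual_star_apply': "cdual_apply (dual_star s \<phi>) x = cnj (cdual_apply \<phi> (s x))"
  by (rule dual_star_apply[OF continuous_s s_add s_scaleC])

text \<open>Duals of *-bimodules are *-bimodules; applied twice, this covers the bidual.\<close>

theorem dual_is_banach_star_bimodule: "banach_star_bimodule (dual_left r) (dual_right l) (dual_star s)"
proof -
  interpret D: banach_bimodule "dual_left r" "dual_right l" by (rule dual_is_banach_bimodule)
  note ops = dual_left_apply dual_right_apply cdual_apply_add cdual_apply_simps cdual_apply_scaleC dual_star_apply'
    s_s s_l s_r star_star
  show ?thesis
  proof
    obtain K where K: "K \<ge> 0" "\<And>x. norm (s x) \<le> norm x * K"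
      using bounded_linear.nonneg_bounded[OF bounded_linear_s] by blast
    have "bounded_linear (dual_star s)"
    proof (rule bounded_linear_intro)
      show "norm (dual_star s \<phi>) \<le> norm \<phi> * K" for \<phi>
      proof (rule norm_cdual_le)
        fix x
        have "cmod (cdual_apply \<phi> (s x)) \<le> norm \<phi> * (norm x * K)"
          using norm_cdual_apply[of \<phi> "s x"] mult_left_mono[OF K(2)[of x], of "norm \<phi>"] by simp
        then show "cmod (cdual_apply (dual_star s \<phi>) x) \<le> norm \<phi> * K * norm x" by (simp add: ops mult_ac)
      qed (use K in simp)
    qed (intro cdual_eqI; simp add: ops cdual_apply_scaleR)+
    then show "continuous_on UNIV (dual_star s)" by (rule linear_continuous_on)
  qed (intro cdual_eqI; simp add: ops)+
qed

lemma bidual_is_banach_star_bimodule: "banach_star_bimodule (bidual_left l) (bidual_right r) (bidual_star s)"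
proof -
  interpret D: banach_star_bimodule "dual_left r" "dual_right l" "dual_star s"
    by (rule dual_is_banach_star_bimodule)
  have right: "dual_left r a = dual_map (\<lambda>x. r x a)" for a by (simp add: fun_eq_iff dual_left_def)
  have "bidual_left l = dual_left (dual_right l)"
    by (intro ext) (simp add: bidual_left_def dual_left_def dual_right_def)
  moreover have "bidual_right r = dual_right (dual_left r)"
    by (intro ext) (simp add: bidual_right_def dual_right_def right)
  ultimately show ?thesis using D.dual_is_banach_star_bimodule by (simp add: bidual_star_def)
qed

end

section \<open>Characterization of maps that are anti-derivable at zero\<close>

text \<open>The two characterizations, with \<open>\<xi>\<close> in the bidual and with \<open>\<xi>\<close> in the bimodule itself, are treated
together: the first one uses the canonical embedding for \<open>E\<close>, the second one the identity map.\<close>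

locale star_bimodule_hom =
  X: banach_star_bimodule l r s + Z: banach_star_bimodule lz rz sz
  for l :: "'a::cstar_algebra \<Rightarrow> 'x::complex_banach \<Rightarrow> 'x" and r s
    and lz :: "'a \<Rightarrow> 'z::complex_banach \<Rightarrow> 'z" and rz sz +
  fixes E :: "'x \<Rightarrow> 'z"
  assumes linear: "clinear E" and hom_l: "E (l a x) = lz a (E x)" and hom_r: "E (r x a) = rz (E x) a"
    and hom_s: "E (s x) = sz (E x)"
begin

definition realizes :: "('a \<Rightarrow> 'x) \<Rightarrow> ('a \<Rightarrow> 'z) \<Rightarrow> 'z \<Rightarrow> bool" where
  "realizes T d \<xi> \<longleftrightarrow> star_derivation lz rz sz d \<and>
    (\<forall>a b. d (commutator a b) + lz (commutator a b) \<xi> + rz (sz \<xi>) (commutator a b) = 0) \<and>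
    (\<forall>a b. E (T (a * b)) = lz a (E (T b)) + rz (E (T a)) b - rz (lz a \<xi>) b) \<and>
    (\<forall>a. E (T a) = d a + lz a \<xi>)"

text \<open>Property (i) holds because \<open>\<xi>\<^sup>*v = (v\<^sup>*\<xi>)\<^sup>* = E(R(v\<^sup>*)\<^sup>*)\<close>; the product formula in (ii) is
Leibniz' rule for \<open>T - R\<close> rewritten with \<open>R(ab) = aR(b)\<close>.\<close>

lemma realizesI:
  assumes d: "star_derivation l r s (\<lambda>a. T a - R a)" and Rl: "\<And>a b. R (a * b) = l a (R b)"
    and comm: "\<And>a b. T (commutator a b) + s (R (star (commutator a b))) = 0"
    and \<xi>: "\<And>a. lz a \<xi> = E (R a)"
  shows "realizes T (\<lambda>a. E (T a - R a)) \<xi>"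
  unfolding realizes_def
proof (intro conjI allI)
  note E = clinearD[OF linear]
  have der: "T (a * b) - R (a * b) = r (T a - R a) b + l a (T b - R b)" for a b
    using d by (simp add: star_derivation_def derivation_def)
  have cl: "clinear (\<lambda>a. T a - R a)" using d by (simp add: star_derivation_def derivation_def)
  have "clinear (\<lambda>a. E (T a - R a))"
    using cl linear unfolding clinear_iff by simp
  then show "star_derivation lz rz sz (\<lambda>a. E (T a - R a))"
    using d by (simp only: star_derivation_def derivation_def der E(1) hom_l hom_r hom_s[symmetric]) simp
  show "E (T (commutator a b) - R (commutator a b)) + lz (commutator a b) \<xi> + rz (sz \<xi>) (commutator a b) = 0" for a b
  proof -
    let ?v = "commutator a b"
    have "rz (sz \<xi>) ?v = sz (lz (star ?v) \<xi>)" by (simp add: Z.s_l star_star)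
    also have "\<dots> = E (s (R (star ?v)))" by (simp add: \<xi> hom_s)
    finally have "E (T ?v - R ?v) + lz ?v \<xi> + rz (sz \<xi>) ?v = E (T ?v + s (R (star ?v)))"
      by (simp add: \<xi> E)
    then show ?thesis by (simp add: comm E)
  qed
  show "E (T (a * b)) = lz a (E (T b)) + rz (E (T a)) b - rz (lz a \<xi>) b" for a b
  proof -
    have "T (a * b) = l a (T b) + r (T a) b - r (R a) b"
      using der[of a b] by (simp add: Rl X.action_simps algebra_simps)
    then show ?thesis by (simp add: \<xi> E hom_l hom_r)
  qed
  show "E (T a) = E (T a - R a) + lz a \<xi>" for a by (simp add: \<xi> E)
qed

text \<open>If \<open>ab\<^sup>* = 0\<close> then \<open>b\<^sup>*a\<close> is the commutator of \<open>b\<^sup>*\<close> and \<open>a\<close>, and Leibniz' rule collects the expression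
\<open>T(b)\<^sup>*a + b\<^sup>*T(a)\<close> into the left side of (i) at this commutator.\<close>

lemma anti_derivable_if_realizes:
  assumes inj: "\<And>x. E x = 0 \<Longrightarrow> x = 0" and real: "realizes T d \<xi>"
  shows "r_star_anti_derivable_at_zero l r s T"
  unfolding r_star_anti_derivable_at_zero_def
proof (intro allI impI)
  fix a b :: 'a assume ab: "a * star b = 0"
  have d: "d (x * y) = rz (d x) y + lz x (d y)" "d (star x) = sz (d x)" and T: "E (T x) = d x + lz x \<xi>" for x y
    using real by (auto simp: realizes_def star_derivation_def derivation_def)
  have "E (r (s (T b)) a + l (star b) (T a)) = d (star b * a) + lz (star b * a) \<xi> + rz (sz \<xi>) (star b * a)"
    by (simp add: clinearD[OF linear] hom_l hom_r hom_s T d Z.s_add Z.s_l Z.action_simps)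
  also have "star b * a = commutator (star b) a" using ab by (simp add: commutator_def)
  also have "d (commutator (star b) a) + lz (commutator (star b) a) \<xi> + rz (sz \<xi>) (commutator (star b) a) = 0"
    using real unfolding realizes_def by blast
  finally show "r (s (T b)) a + l (star b) (T a) = 0" by (rule inj)
qed

end

lemma clinear_bidual_embed: "clinear bidual_embed"
  unfolding clinear_iff
  by (intro conjI allI cdual_eqI)
    (simp_all add: bidual_embed_apply cdual_apply_add cdual_apply_scaleC cdual_apply_simps)

lemma norm_bidual_embed_le: "norm (bidual_embed x) \<le> norm x"
proof (rule norm_cdual_le)
  show "cmod (cdual_apply (bidual_embed x) \<phi>) \<le> norm x * norm \<phi>" for \<phi>
    using norm_cdual_apply[of \<phi> x] by (simp add: bidual_embed_apply mult.commute)
qed simp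

lemma bidual_embed_eq_0: "bidual_embed x = 0 \<Longrightarrow> x = 0"
proof (rule cdual_separates_points)
  assume "bidual_embed x = 0"
  then show "cdual_apply \<phi> x = 0" for \<phi>
    using bidual_embed_apply[of x \<phi>] by (simp add: zero_cdual.rep_eq cdual_apply.rep_eq)
qed

context banach_star_bimodule
begin

lemma bidual_embed_hom:
  "star_bimodule_hom l r s (bidual_left l) (bidual_right r) (bidual_star s) bidual_embed"
proof -
  interpret D: banach_star_bimodule "dual_left r" "dual_right l" "dual_star s"
    by (rule dual_is_banach_star_bimodule)
  show ?thesis
  proof (intro star_bimodule_hom.intro star_bimodule_hom_axioms.intro
      banach_star_bimodule_axioms bidual_is_banach_star_bimodule)
    show "clinear (bidual_embed :: 'x \<Rightarrow> _)" by (rule clinear_bidual_embed)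
    show "bidual_embed (l a x) = bidual_left l a (bidual_embed x)" for a x
      by (intro cdual_eqI) (simp add: bidual_left_def dual_map_apply bounded_clinear_dual_map
          bounded_clinear_left bidual_embed_apply)
    show "bidual_embed (r x a) = bidual_right r (bidual_embed x) a" for a x
      by (intro cdual_eqI) (simp add: bidual_right_def dual_map_apply bounded_clinear_dual_map
          bounded_clinear_right bidual_embed_apply)
    show "bidual_embed (s x) = bidual_star s (bidual_embed x)" for x
      by (intro cdual_eqI) (simp add: bidual_star_def D.dual_star_apply' dual_star_apply' bidual_embed_apply)
  qed
qed

text \<open>A weak* limit \<open>\<xi>\<close> of \<open>T(e)\<close> satisfies \<open>(a\<xi>)(\<phi>) = \<xi>(\<phi>a) = lim \<phi>(aT(e)) = \<phi>(R(a))\<close>.\<close>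

lemma bidual_limit_exists:
  assumes F: "F \<noteq> bot" and bound: "\<forall>\<^sub>F e in F. norm (T e) \<le> K"
    and R: "\<And>a. ((\<lambda>e. l a (T e)) \<longlongrightarrow> R a) F"
  shows "\<exists>\<xi>. \<forall>a. bidual_left l a \<xi> = bidual_embed (R a)"
proof -
  have "\<forall>\<^sub>F e in F. norm (bidual_embed (T e)) \<le> K"
    using bound by eventually_elim (use norm_bidual_embed_le order_trans in blast)
  from weak_star_limit[OF F this] obtain \<xi> where
    \<xi>: "\<And>\<phi> L. ((\<lambda>e. cdual_apply (bidual_embed (T e)) \<phi>) \<longlongrightarrow> L) F \<Longrightarrow> cdual_apply \<xi> \<phi> = L" by blast
  have "bidual_left l a \<xi> = bidual_embed (R a)" for a
  proof (rule cdual_eqI)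
    fix \<phi>
    have "((\<lambda>e. cdual_apply \<phi> (l a (T e))) \<longlongrightarrow> cdual_apply \<phi> (R a)) F"
      by (rule bounded_linear.tendsto[OF bounded_clinear_bounded_linear[OF bounded_clinear_cdual_apply] R])
    then have "((\<lambda>e. cdual_apply (bidual_embed (T e)) (dual_map (l a) \<phi>)) \<longlongrightarrow> cdual_apply \<phi> (R a)) F"
      by (simp add: bidual_embed_apply dual_map_apply bounded_clinear_left)
    then have "cdual_apply \<xi> (dual_map (l a) \<phi>) = cdual_apply \<phi> (R a)" by (rule \<xi>)
    then show "cdual_apply (bidual_left l a \<xi>) \<phi> = cdual_apply (bidual_embed (R a)) \<phi>"
      by (simp add: bidual_left_def dual_map_apply bounded_clinear_dual_map bounded_clinear_left bidual_embed_apply)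
  qed
  then show ?thesis by blast
qed

text \<open>The same argument with the weak* topology of \<open>X\<close> as the dual of \<open>Y\<close>.\<close>

lemma predual_limit_exists:
  assumes F: "F \<noteq> bot" and bound: "\<forall>\<^sub>F e in F. norm (T e) \<le> K"
    and R: "\<And>a. ((\<lambda>e. l a (T e)) \<longlongrightarrow> R a) F"
    and dual: "dual_banach_bimodule (Y :: 'y::complex_banach itself) l r"
  shows "\<exists>\<xi>. \<forall>a. l a \<xi> = R a"
proof -
  obtain lY and rY :: "'y \<Rightarrow> 'a \<Rightarrow> 'y" and \<Phi> :: "'x \<Rightarrow> 'y cdual" where
    Y: "banach_bimodule lY rY" and \<Phi>: "clinear \<Phi>" "bij \<Phi>" "\<And>x. norm (\<Phi> x) = norm x"
      "\<And>a x. \<Phi> (l a x) = dual_left rY a (\<Phi> x)"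
    using dual unfolding dual_banach_bimodule_def by blast
  interpret Y: banach_bimodule lY rY by (rule Y)
  note lin = clinearD[OF \<Phi>(1)]
  have bl: "bounded_linear \<Phi>"
    by (rule bounded_linear_intro[where K = 1]) (simp_all add: lin \<Phi>(3) scaleR_scaleC)
  have "\<forall>\<^sub>F e in F. norm (\<Phi> (T e)) \<le> K" using bound by (simp add: \<Phi>(3))
  from weak_star_limit[OF F this] obtain \<eta> where
    \<eta>: "\<And>y L. ((\<lambda>e. cdual_apply (\<Phi> (T e)) y) \<longlongrightarrow> L) F \<Longrightarrow> cdual_apply \<eta> y = L" by blast
  obtain \<xi> where \<xi>: "\<Phi> \<xi> = \<eta>" using \<Phi>(2) by (metis bij_pointE)
  have "l a \<xi> = R a" for a
  proof -
    have "dual_left rY a \<eta> = \<Phi> (R a)"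
    proof (rule cdual_eqI)
      fix y
      have evl: "bounded_linear (\<lambda>\<phi> :: 'y cdual. cdual_apply \<phi> y)"
        by (rule bounded_linear_intro[where K = "norm y"])
          (simp_all add: cdual_apply_add scaleR_scaleC cdual_apply_scaleC scaleC_complex_def norm_cdual_apply)
      have "((\<lambda>e. cdual_apply (\<Phi> (l a (T e))) y) \<longlongrightarrow> cdual_apply (\<Phi> (R a)) y) F"
        by (intro bounded_linear.tendsto[OF evl] bounded_linear.tendsto[OF bl] R)
      then have "((\<lambda>e. cdual_apply (\<Phi> (T e)) (rY y a)) \<longlongrightarrow> cdual_apply (\<Phi> (R a)) y) F"
        by (simp add: \<Phi>(4) Y.dual_left_apply)
      then show "cdual_apply (dual_left rY a \<eta>) y = cdual_apply (\<Phi> (R a)) y"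
        using \<eta> by (simp add: Y.dual_left_apply)
    qed
    then have "\<Phi> (l a \<xi>) = \<Phi> (R a)" by (simp add: \<Phi>(4) \<xi>)
    then show ?thesis using \<Phi>(2) by (simp add: bij_def inj_eq)
  qed
  then show ?thesis by blast
qed

end

text \<open>\<open>anti_derivable_decomposition\<close> supplies \<open>R\<close>, and the cases differ only in where \<open>R\<close> is represented as
\<open>a \<mapsto> a\<xi>\<close>: in the bidual always, in \<open>X\<close> by \<open>\<xi> = R(1)\<close> if the algebra has a unit, and by a weak*
limit if \<open>X\<close> is a dual bimodule.\<close>

theorem theorem9:
  fixes l :: "'a::cstar_algebra \<Rightarrow> 'x::complex_banach \<Rightarrow> 'x"
    and r :: "'x \<Rightarrow> 'a \<Rightarrow> 'x"
    and s :: "'x \<Rightarrow> 'x"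
    and T :: "'a \<Rightarrow> 'x"
    and Y :: "'y::complex_banach itself"
  assumes "banach_star_bimodule l r s"
    and "essential_bimodule l r"
    and "bounded_clinear T"
  shows "(r_star_anti_derivable_at_zero l r s T \<longleftrightarrow>
           (\<exists>(d :: 'a \<Rightarrow> 'x cdual cdual) (\<xi> :: 'x cdual cdual).
              star_derivation (bidual_left l) (bidual_right r) (bidual_star s) d \<and>
              (\<forall>a b. d (commutator a b) + bidual_left l (commutator a b) \<xi>
                      + bidual_right r (bidual_star s \<xi>) (commutator a b) = 0) \<and>
              (\<forall>a b. bidual_embed (T (a * b)) =
                      bidual_left l a (bidual_embed (T b)) + bidual_right r (bidual_embed (T a)) b
                      - bidual_right r (bidual_left l a \<xi>) b) \<and>
              (\<forall>a. bidual_embed (T a) = d a + bidual_left l a \<xi>)))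
       \<and> (unital_algebra TYPE('a) \<or> dual_banach_bimodule Y l r \<longrightarrow>
           (r_star_anti_derivable_at_zero l r s T \<longleftrightarrow>
             (\<exists>(d :: 'a \<Rightarrow> 'x) (\<xi> :: 'x).
                star_derivation l r s d \<and>
                (\<forall>a b. d (commutator a b) + l (commutator a b) \<xi> + r (s \<xi>) (commutator a b) = 0) \<and>
                (\<forall>a b. T (a * b) = l a (T b) + r (T a) b - r (l a \<xi>) b) \<and>
                (\<forall>a. T a = d a + l a \<xi>))))"
proof -
  interpret banach_star_bimodule l r s by fact
  interpret bidual: star_bimodule_hom l r s "bidual_left l" "bidual_right r" "bidual_star s" bidual_embed
    by (rule bidual_embed_hom)
  interpret self: star_bimodule_hom l r s l r s "\<lambda>x. x"
    by (intro star_bimodule_hom.intro star_bimodule_hom_axioms.intro banach_star_bimodule_axioms)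
      (simp_all add: clinear_iff)
  obtain F :: "'a filter" where F: "approximate_identity F" using approximate_identity_exists by blast
  note F' = approximate_identityD[OF F]
  obtain K where K: "K \<ge> 0" "\<And>x. norm (T x) \<le> norm x * K"
    using bounded_linear.nonneg_bounded[OF bounded_clinear_bounded_linear[OF assms(3)]] by blast
  have bound: "\<forall>\<^sub>F e in F. norm (T e) \<le> 2 * K"
    using F'(3) by eventually_elim (use K order_trans mult_right_mono in blast)
  have decomposition: "\<exists>R. (\<forall>a. ((\<lambda>e. l a (T e)) \<longlongrightarrow> R a) F) \<and> (\<forall>a b. R (a * b) = l a (R b)) \<and>
      star_derivation l r s (\<lambda>a. T a - R a) \<and>
      (\<forall>a b. T (commutator a b) + s (R (star (commutator a b))) = 0)"
    if "r_star_anti_derivable_at_zero l r s T"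
    by (rule anti_derivable_decomposition[OF F essential_unit_limits[OF assms(2) F] assms(3) that])
  have to_bidual: "\<exists>d \<xi>. bidual.realizes T d \<xi>" if anti: "r_star_anti_derivable_at_zero l r s T"
  proof -
    obtain R where R: "\<And>a. ((\<lambda>e. l a (T e)) \<longlongrightarrow> R a) F" "\<And>a b. R (a * b) = l a (R b)"
      "star_derivation l r s (\<lambda>a. T a - R a)" "\<And>a b. T (commutator a b) + s (R (star (commutator a b))) = 0"
      using decomposition[OF anti] by blast
    obtain \<xi> where "\<And>a. bidual_left l a \<xi> = bidual_embed (R a)"
      using bidual_limit_exists[OF F'(1) bound R(1)] by blast
    from bidual.realizesI[OF R(3,2,4) this] show ?thesis by blast
  qed
  have to_self: "\<exists>d \<xi>. self.realizes T d \<xi>"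
    if anti: "r_star_anti_derivable_at_zero l r s T"
      and cases: "unital_algebra TYPE('a) \<or> dual_banach_bimodule Y l r"
  proof -
    obtain R where R: "\<And>a. ((\<lambda>e. l a (T e)) \<longlongrightarrow> R a) F" "\<And>a b. R (a * b) = l a (R b)"
      "star_derivation l r s (\<lambda>a. T a - R a)" "\<And>a b. T (commutator a b) + s (R (star (commutator a b))) = 0"
      using decomposition[OF anti] by blast
    have "\<exists>\<xi>. \<forall>a. l a \<xi> = R a"
      using cases
    proof
      assume "unital_algebra TYPE('a)"
      then obtain e :: 'a where "\<And>a. a * e = a" unfolding unital_algebra_def by blast
      then have "l a (R e) = R a" for a using R(2)[of a e] by simp
      then show ?thesis by blast
    next
      assume "dual_banach_bimodule Y l r"
      from predual_limit_exists[OF F'(1) bound R(1) this] show ?thesis .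
    qed
    then obtain \<xi> where "\<And>a. l a \<xi> = R a" by blast
    from self.realizesI[OF R(3,2,4) this] show ?thesis by blast
  qed
  have "r_star_anti_derivable_at_zero l r s T \<longleftrightarrow> (\<exists>d \<xi>. bidual.realizes T d \<xi>)"
    using to_bidual bidual.anti_derivable_if_realizes[OF bidual_embed_eq_0] by blast
  moreover have "unital_algebra TYPE('a) \<or> dual_banach_bimodule Y l r \<longrightarrow>
      (r_star_anti_derivable_at_zero l r s T \<longleftrightarrow> (\<exists>d \<xi>. self.realizes T d \<xi>))"
    using to_self self.anti_derivable_if_realizes by blast
  ultimately show ?thesis unfolding bidual.realizes_def self.realizes_def by blast
qed

end
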